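(* Let $I \subseteq \mathbb{R}$ be an interval. Consider a generic curve of monic polynomials \[ P(t)(z) = z^n + \sum_{j=1}^n (-1)^j a_j(t) z^{n-j}, \qquad t\in I, \] with smooth coefficients $a_j : I \to \mathbb{C}$, $1 \le j \le n$. Then any continuous parameterization $\lambda=(\lambda_1,\ldots,\lambda_n) : I \to \mathbb{C}^n$ of the roots of $P$ is locally absolutely continuous.
   Context: Smooth means $C^\infty$. A continuous parameterization of the roots of $P$ on $I$ is an $n$-tuple of continuous functions $\lambda_1,\ldots,\lambda_n : I \to \mathbb{C}$ such that $P(t)(z)=\prod_{j=1}^n (z-\lambda_j(t))$ for all $t\in I$. Locally absolutely continuous means that every point of $I$ has a neighborhood in $I$ on which the function is absolutely continuous. For a monic polynomial $P$ of degree $n$ with roots $\lambda_1,\ldots,\lambda_n\in\mathbb{C}$ (with multiplicity) and $1\le k\le n$ put \[ \tilde\Delta_k(P) := \sum_{i_1<\cdots<i_k}\ \prod_{1\le p<q\le k} (\lambda_{i_p}-\lambda_{i_q})^2 , \] which is a polynomial in the coefficients of $P$ (so $\tilde\Delta_1(P)=n$). For a continuous function $f$ defined near $t_0$, the multiplicity (order of flatness) $m_{t_0}(f)$ is the supremum of all integers $p$ such that $f(t)=(t-t_0)^p g(t)$ near $t_0$ with $g$ continuous; $f$ is infinitely flat at $t_0$ if $m_{t_0}(f)=\infty$. The curve $P$ is called generic if for every $t_0\in I$: when $k$ is maximal such that the germ at $t_0$ of $t\mapsto \tilde\Delta_k(P(t))$ is not $0$, then $t\mapsto\tilde\Delta_k(P(t))$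 is not infinitely flat at $t_0$. (Equivalently: for continuous parameterizations of the roots, if two of the roots meet of infinite order of flatness at $t_0$, i.e. $m_{t_0}(\lambda_i-\lambda_j)=\infty$, then their germs at $t_0$ are equal.) *)

theory Defs
  imports
    "HOL-Analysis.Analysis"
    "HOL-Computational_Algebra.Computational_Algebra"
    "HOL-Combinatorics.Permutations"
    "HOL-Library.Extended_Nat"
begin

text \<open>
  \<open>D k\<close> is the \<open>k\<close>-th derivative of \<open>f\<close>; at an endpoint that belongs to \<open>S\<close>, derivatives are
  one-sided.
\<close>
definition smooth_on :: "real set \<Rightarrow> (real \<Rightarrow> complex) \<Rightarrow> bool" where
  "smooth_on S f \<longleftrightarrow>
     (\<exists>D :: nat \<Rightarrow> real \<Rightarrow> complex.
        (\<forall>t\<in>S. D 0 t = f t) \<and>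
        (\<forall>k. \<forall>t\<in>S. (D k has_vector_derivative D (Suc k) t) (at t within S)))"

definition poly_curve :: "nat \<Rightarrow> (nat \<Rightarrow> real \<Rightarrow> complex) \<Rightarrow> real \<Rightarrow> complex poly" where
  "poly_curve n a t = monom 1 n + (\<Sum>j = 1..n. monom ((-1) ^ j * a j t) (n - j))"

text \<open>Tuples of length \<open>n\<close> are functions on \<open>nat\<close> of which only the values on \<open>{1..n}\<close> matter.\<close>
definition root_tuple :: "nat \<Rightarrow> complex poly \<Rightarrow> (nat \<Rightarrow> complex) \<Rightarrow> bool" where
  "root_tuple n p r \<longleftrightarrow> (\<forall>z. poly p z = (\<Prod>j = 1..n. z - r j))"

definition continuous_root_param ::
    "real set \<Rightarrow> nat \<Rightarrow> (real \<Rightarrow> complex poly) \<Rightarrow> (nat \<Rightarrow> real \<Rightarrow> complex) \<Rightarrow> bool" where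
  "continuous_root_param I n P lam \<longleftrightarrow>
     (\<forall>j\<in>{1..n}. continuous_on I (lam j)) \<and>
     (\<forall>t\<in>I. root_tuple n (P t) (\<lambda>j. lam j t))"

definition Delta_roots :: "nat \<Rightarrow> nat \<Rightarrow> (nat \<Rightarrow> complex) \<Rightarrow> complex" where
  "Delta_roots n k r =
     (\<Sum>S | S \<subseteq> {1..n} \<and> card S = k. \<Prod>(p, q)\<in>{(p, q). p \<in> S \<and> q \<in> S \<and> p < q}. (r p - r q)\<^sup>2)"

text \<open>
  For monic \<open>P\<close> the choice of the enumeration of the roots is immaterial: see \<open>Delta_eq\<close> below.
\<close>
definition Delta :: "nat \<Rightarrow> complex poly \<Rightarrow> complex" where
  "Delta k P = Delta_roots (degree P) k (SOME r. root_tuple (degree P) P r)"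

lemma root_tuple_poly_eq:
  assumes "root_tuple n p r"
  shows "p = (\<Prod>j = 1..n. [:- r j, 1:])"
proof -
  have "poly p = poly (\<Prod>j = 1..n. [:- r j, 1:])"
    using assms by (auto simp: root_tuple_def poly_prod)
  then show ?thesis by (simp add: poly_eq_poly_eq_iff)
qed

lemma root_tuple_degree:
  assumes "root_tuple n p r"
  shows "degree p = n"
  unfolding root_tuple_poly_eq[OF assms] by (subst degree_prod_sum_eq) auto

lemma root_tuple_proots:
  assumes "root_tuple n p r"
  shows "proots p = image_mset r (mset_set {1..n})"
proof -
  have "proots p = (\<Sum>j = 1..n. proots [:- r j, 1:])"
    unfolding root_tuple_poly_eq[OF assms] by (rule proots_prod) auto
  also have "\<dots> = image_mset r (mset_set {1..n})"
    by (simp add: sum_unfold_sum_mset)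
  finally show ?thesis .
qed

lemma Delta_roots_permutes:
  assumes pi: "\<pi> permutes {1..n}"
  shows "Delta_roots n k (\<lambda>j. r (\<pi> j)) = Delta_roots n k r"
proof -
  define f where "f = inv \<pi>"
  have inv: "\<pi> (f x) = x" "f (\<pi> x) = x" for x
    using pi permutes_inverses f_def by metis+
  have f: "f permutes {1..n}" unfolding f_def using pi by (rule permutes_inv)
  have injs: "inj_on \<pi> A" "inj_on f A" for A
    using permutes_inj_on pi f by blast+
  let ?D = "\<lambda>S. {(p, q). p \<in> S \<and> q \<in> S \<and> p < (q::nat)}"
  have inner: "(\<Prod>(p, q)\<in>?D S. (r (\<pi> p) - r (\<pi> q))\<^sup>2) = (\<Prod>(p, q)\<in>?D (\<pi> ` S). (r p - r q)\<^sup>2)" for S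
    by (rule prod.reindex_bij_witness[where
        i = "\<lambda>(p, q). (min (f p) (f q), max (f p) (f q))" and
        j = "\<lambda>(p, q). (min (\<pi> p) (\<pi> q), max (\<pi> p) (\<pi> q))"])
      (auto simp: inv min_def max_def power2_commute image_iff split: if_splits,
       (metis inv linorder_neqE_nat not_le order_less_le)+)
  have sub: "\<pi> ` S \<subseteq> {1..n}" "f ` S \<subseteq> {1..n}" if "S \<subseteq> {1..n}" for S
    using that permutes_image[OF pi] permutes_image[OF f] by blast+
  have img: "f ` \<pi> ` S = S" "\<pi> ` f ` S = S" for S
    by (simp_all add: image_image inv)
  show ?thesis
    unfolding Delta_roots_def
    by (rule sum.reindex_bij_witness[where i = "\<lambda>S. f ` S" and j = "\<lambda>S. \<pi> ` S"])
      (use sub img in \<open>auto simp: inner card_image injs\<close>)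
qed

lemma Delta_eq:
  assumes "root_tuple n P r"
  shows "Delta k P = Delta_roots n k r"
proof -
  define s where "s = (SOME r. root_tuple n P r)"
  have s: "root_tuple n P s"
    unfolding s_def using someI[of "root_tuple n P" r, OF assms] .
  have "image_mset r (mset_set {1..n}) = image_mset s (mset_set {1..n})"
    using root_tuple_proots[OF assms] root_tuple_proots[OF s] by metis
  then obtain \<pi> where pi: "\<pi> permutes {1..n}" and eq: "\<forall>x\<in>{1..n}. r x = s (\<pi> x)"
    by (rule image_mset_eq_implies_permutes[OF finite_atLeastAtMost])
  have "Delta_roots n k r = Delta_roots n k (\<lambda>j. s (\<pi> j))"
    unfolding Delta_roots_def
  proof (intro sum.cong prod.cong refl, clarify)
    fix S p q assume "S \<subseteq> {1..n}" "p \<in> S" "q \<in> S"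
    then have "p \<in> {1..n}" "q \<in> {1..n}" by blast+
    then show "(r p - r q)\<^sup>2 = (s (\<pi> p) - s (\<pi> q))\<^sup>2" using eq by simp
  qed
  also have "\<dots> = Delta_roots n k s" using pi by (rule Delta_roots_permutes)
  finally show ?thesis
    by (simp add: Delta_def s_def root_tuple_degree[OF assms])
qed

text \<open>
  Germs at \<open>t\<^sub>0 \<in> I\<close> are those of functions on \<open>I\<close>, hence one-sided at an endpoint of \<open>I\<close>.
\<close>
definition zero_germ :: "real set \<Rightarrow> real \<Rightarrow> (real \<Rightarrow> complex) \<Rightarrow> bool" where
  "zero_germ I t\<^sub>0 f \<longleftrightarrow> (\<exists>U. open U \<and> t\<^sub>0 \<in> U \<and> (\<forall>t\<in>I \<inter> U. f t = 0))"

text \<open>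
  Only exponents \<open>p \<ge> 0\<close> need to be considered: \<open>p = 0\<close> always qualifies if \<open>f\<close> is continuous.
\<close>
definition flatness :: "real set \<Rightarrow> real \<Rightarrow> (real \<Rightarrow> complex) \<Rightarrow> enat" where
  "flatness I t\<^sub>0 f =
     Sup {enat p | p. \<exists>U g. open U \<and> t\<^sub>0 \<in> U \<and> continuous_on (I \<inter> U) g \<and>
                        (\<forall>t\<in>I \<inter> U. f t = of_real ((t - t\<^sub>0) ^ p) * g t)}"

definition generic_curve :: "real set \<Rightarrow> nat \<Rightarrow> (real \<Rightarrow> complex poly) \<Rightarrow> bool" where
  "generic_curve I n P \<longleftrightarrow>
     (\<forall>t\<^sub>0\<in>I. \<forall>k\<in>{1..n}.
        \<not> zero_germ I t\<^sub>0 (\<lambda>t. Delta k (P t)) \<and>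
        (\<forall>l\<in>{k<..n}. zero_germ I t\<^sub>0 (\<lambda>t. Delta l (P t)))
        \<longrightarrow> flatness I t\<^sub>0 (\<lambda>t. Delta k (P t)) \<noteq> \<infinity>)"

text \<open>
  The usual \<open>\<epsilon>\<close>-\<open>\<delta>\<close> condition over finite families of non-overlapping compact subintervals
  \<open>[u\<^sub>i, v\<^sub>i]\<close>, \<open>i < m\<close>, of an interval \<open>S\<close>.
\<close>
definition abs_continuous_on :: "real set \<Rightarrow> (real \<Rightarrow> complex) \<Rightarrow> bool" where
  "abs_continuous_on S f \<longleftrightarrow>
     (\<forall>\<epsilon>>0. \<exists>\<delta>>0. \<forall>(m::nat) (u :: nat \<Rightarrow> real) (v :: nat \<Rightarrow> real).
        (\<forall>i<m. u i \<le> v i \<and> {u i..v i} \<subseteq> S) \<and>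
        (\<forall>i<m. \<forall>j<m. i \<noteq> j \<longrightarrow> {u i<..<v i} \<inter> {u j<..<v j} = {}) \<and>
        (\<Sum>i<m. v i - u i) < \<delta>
        \<longrightarrow> (\<Sum>i<m. norm (f (v i) - f (u i))) < \<epsilon>)"

definition locally_abs_continuous_on :: "real set \<Rightarrow> (real \<Rightarrow> complex) \<Rightarrow> bool" where
  "locally_abs_continuous_on I f \<longleftrightarrow> (\<forall>t\<in>I. \<exists>e>0. abs_continuous_on (I \<inter> ball t e) f)"

end

(*
  Near a point s at most k roots are distinct, and by genericity the discriminant for k roots
  vanishes at s to finite order only; so on each side of s there are exactly k distinct roots of
  locally constant multiplicity, and the roots are differentiable there. Lagrange interpolation of
  the derivatives at the distinct roots shows that (t - s) times the derivatives are the roots of a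
  monic polynomial whose coefficients have Laurent expansions at s to every order. The lowest order
  of these coefficients determines the growth of the derivatives. If it were at least like
  1 / |t - s| for one root, that root would be unbounded; hence the derivatives are
  O(|t - s| powr (gamma - 1)) with gamma > 0, which is integrable.
*)
theory Submission
  imports Defs "HOL-Library.Landau_Symbols"
begin

text \<open>Smooth functions have Taylor expansions to every order without being determined by them,
  so Puiseux series are replaced by functions with polynomial expansions to arbitrary order. These
  form a ring in which elements can be infinitely flat and quotients do not exist. Hence the
  interpolation denominators are cleared and multiplied into one common denominator
  \<open>interp_norm\<close>, which by genericity has an exact order \<open>p\<close> at
  \<open>s\<close>; the derivatives are \<open>u j / ((t - s) * interp_norm)\<close>, where the
  \<open>u j\<close> are the roots of a monic polynomial over the ring. The distinct roots cannot be
  enumerated without choices, so interpolation formulas are summed over all index tuples. This makes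
  them polynomials in one root whose coefficients are polynomials in power sums of the roots, and
  those lie in the ring. The exponent comes from integrality: if the \<open>m\<close>-th coefficient
  of the polynomial of \<open>u\<close> vanishes beyond order \<open>m * p\<close> for every
  \<open>m\<close>, it vanishes to order \<open>m * p + 1\<close>, so the roots \<open>u j\<close>
  have order at least \<open>p + 1 / n\<close>, which gives \<gamma> = 1 / n.\<close>

section \<open>Newton identities and function algebras\<close>

text \<open>The logarithmic derivative of the product is the sum of the
  \<open>- x i / (1 - x i * X)\<close>, and each summand expands into a geometric series. In
  multiplied form this follows by induction from the product rule.\<close>

lemma newton_fps:
  fixes x :: "'i \<Rightarrow> complex"
  assumes "finite A"
  shows "fps_deriv (\<Prod>i\<in>A. 1 - fps_const (x i) * fps_X) =
    - (\<Prod>i\<in>A. 1 - fps_const (x i) * fps_X) * Abs_fps (\<lambda>l. \<Sum>i\<in>A. x i ^ Suc l)"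
  using assms
proof (induction A)
  case empty
  have "Abs_fps (\<lambda>l. 0) = (0::complex fps)" by (rule fps_ext) simp
  then show ?case by simp
next
  case (insert j A)
  define R where "R = (\<Prod>i\<in>A. 1 - fps_const (x i) * fps_X)"
  define G where "G = Abs_fps (\<lambda>l. \<Sum>i\<in>A. x i ^ Suc l)"
  define H where "H = Abs_fps (\<lambda>l. x j ^ l)"
  define c where "c = fps_const (x j)"
  have geo: "(1 - c * fps_X) * H = 1"
  proof (rule fps_ext)
    fix m show "fps_nth ((1 - c * fps_X) * H) m = fps_nth 1 m"
      unfolding c_def H_def
      by (cases m) (simp_all add: left_diff_distrib mult.assoc)
  qed
  have split: "Abs_fps (\<lambda>l. \<Sum>i\<in>insert j A. x i ^ Suc l) = c * H + G"
    unfolding c_def H_def G_def using insert(1,2) by (intro fps_ext) simp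
  have IH: "fps_deriv R = - R * G" using insert.IH unfolding R_def G_def .
  have ins: "(\<Prod>i\<in>insert j A. 1 - fps_const (x i) * fps_X) = (1 - c * fps_X) * R"
    unfolding c_def R_def using insert(1,2) by simp
  have dc: "fps_deriv (1 - c * fps_X) = - c" by (simp add: c_def)
  \<comment> \<open>The factor \<open>(1 - c * fps_X) * H\<close> equals 1; inserting it makes
    \<open>(1 - c * fps_X) * R\<close> a common factor of both summands.\<close>
  have "fps_deriv ((1 - c * fps_X) * R) = (1 - c * fps_X) * (- R * G) - c * R * ((1 - c * fps_X) * H)"
    unfolding geo fps_deriv_mult IH dc by (simp add: algebra_simps)
  also have "\<dots> = - ((1 - c * fps_X) * R) * (c * H + G)"
    by (simp add: algebra_simps)
  finally show ?case unfolding split ins .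
qed

text \<open>This is \<open>(-1) ^ m\<close> times the \<open>m\<close>-th elementary symmetric
  function of \<open>x 1, ..., x n\<close>. The reversed linear factors put it at degree
  \<open>m\<close>, so it makes sense, as zero, also for \<open>m > n\<close>, where Newton's
  identities continue to hold.\<close>

definition vieta :: "nat \<Rightarrow> (nat \<Rightarrow> complex) \<Rightarrow> nat \<Rightarrow> complex" where
  "vieta n x m = coeff (\<Prod>i = 1..n. [:1, - x i:]) m"

lemma vieta_0: "vieta n x 0 = 1"
  using poly_0_coeff_0[of "\<Prod>i = 1..n. [:1, - x i:]"] by (simp add: vieta_def poly_prod)

text \<open>Comparison of the coefficients of degree \<open>m\<close> in the logarithmic derivative.
  The term \<open>j = 0\<close> is the plain power sum of exponent \<open>m + 1\<close>, so the
  identity can be solved for that power sum as well as for \<open>vieta n x (Suc m)\<close>.\<close>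

lemma newton:
  "of_nat (Suc m) * vieta n x (Suc m) = - (\<Sum>j\<le>m. vieta n x j * (\<Sum>i = 1..n. x i ^ Suc (m - j)))"
proof -
  define R where "R = (\<Prod>i = 1..n. 1 - fps_const (x i) * fps_X)"
  have lin: "fps_of_poly [:1, - x i:] = 1 - fps_const (x i) * fps_X" for i
  proof (rule fps_ext)
    fix m show "fps_nth (fps_of_poly [:1, - x i:]) m = fps_nth (1 - fps_const (x i) * fps_X) m"
      unfolding fps_of_poly_nth by (cases m; cases "m - 1") auto
  qed
  have R: "fps_of_poly (\<Prod>i = 1..n. [:1, - x i:]) = R"
    by (simp only: R_def fps_of_poly_prod lin)
  have nth: "vieta n x m = fps_nth R m" for m
    unfolding vieta_def R[symmetric] fps_of_poly_nth ..
  have "fps_deriv R = - R * Abs_fps (\<lambda>l. \<Sum>i = 1..n. x i ^ Suc l)"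
    unfolding R_def by (rule newton_fps) simp
  from arg_cong[OF this, of "\<lambda>f. fps_nth f m"]
  have "fps_nth (fps_deriv R) m = fps_nth (- R * Abs_fps (\<lambda>l. \<Sum>i = 1..n. x i ^ Suc l)) m" .
  also have "\<dots> = (\<Sum>j = 0..m. fps_nth (- R) j * (\<Sum>i = 1..n. x i ^ Suc (m - j)))"
    by (simp only: fps_mult_nth fps_nth_Abs_fps)
  finally show ?thesis
    unfolding nth fps_deriv_nth Suc_eq_plus1[symmetric] atMost_atLeast0
    by (simp only: fps_neg_nth mult_minus_left sum_negf)
qed

lemma vieta_eq_coeff:
  assumes "m \<le> n"
  shows "vieta n x m = coeff (\<Prod>i = 1..n. [:- x i, 1:]) (n - m)"
proof -
  define p where "p = (\<Prod>i = 1..n. [:- x i, 1:])"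
  have deg: "degree p = n"
    unfolding p_def by (subst degree_prod_sum_eq) auto
  have "reflect_poly [:- x i, 1:] = [:1, - x i:]" for i
    by (simp add: reflect_poly_def)
  then have refl: "reflect_poly p = (\<Prod>i = 1..n. [:1, - x i:])"
    by (simp add: reflect_poly_prod p_def)
  show ?thesis
    unfolding vieta_def refl[symmetric] coeff_reflect_poly deg p_def[symmetric] using assms by simp
qed

lemma prod_eq_vieta:
  "(\<Prod>i = 1..n. z - x i) = (\<Sum>m\<le>n. vieta n x m * z ^ (n - m))"
proof -
  define p where "p = (\<Prod>i = 1..n. [:- x i, 1:])"
  have deg: "degree p = n"
    unfolding p_def by (subst degree_prod_sum_eq) auto
  have "(\<Prod>i = 1..n. z - x i) = poly p z" by (simp add: poly_prod p_def)
  also have "\<dots> = (\<Sum>i\<le>n. coeff p i * z ^ i)" unfolding poly_altdef deg ..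
  also have "\<dots> = (\<Sum>m\<le>n. vieta n x m * z ^ (n - m))"
    by (rule sum.reindex_bij_witness[where i = "\<lambda>m. n - m" and j = "\<lambda>m. n - m"])
      (auto simp: vieta_eq_coeff p_def)
  finally show ?thesis .
qed

lemma vieta_unique:
  assumes "\<And>z. (\<Prod>i = 1..n. z - x i) = (\<Sum>m\<le>n. c m * z ^ (n - m))" "m \<le> n"
  shows "vieta n x m = c m"
proof -
  define p where "p c = (\<Sum>m\<le>n. monom (c m) (n - m))" for c :: "nat \<Rightarrow> complex"
  have "poly (p (vieta n x)) = poly (p c)"
    by (rule ext) (use assms(1) prod_eq_vieta[where n = n and x = x] in \<open>simp add: p_def poly_sum poly_monom\<close>)
  then have e: "p (vieta n x) = p c" by (simp add: poly_eq_poly_eq_iff)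
  have "coeff (p c) (n - m) = c m" for c
  proof -
    have "coeff (p c) (n - m) = (\<Sum>j\<le>n. if j = m then c j else 0)"
      unfolding p_def coeff_sum coeff_monom using assms(2) by (intro sum.cong) auto
    then show ?thesis using assms(2) by simp
  qed
  then show ?thesis using e by metis
qed

lemma vieta_large: "n < m \<Longrightarrow> vieta n x m = 0"
proof -
  assume "n < m"
  have "degree (\<Prod>i = 1..n. [:1, - x i:]) \<le> (\<Sum>i = 1..n. 1)"
    by (rule order.trans[OF degree_prod_sum_le]) (auto intro!: sum_mono simp del: sum_constant simp: degree_pCons_eq_if)
  then show ?thesis unfolding vieta_def using \<open>n < m\<close> by (intro coeff_eq_0) auto
qed

lemma vieta_top: "vieta n x n = (\<Prod>i = 1..n. - x i)"
proof -
  have "(\<Prod>i = 1..n. 0 - x i) = (\<Sum>m\<le>n. vieta n x m * 0 ^ (n - m))" by (rule prod_eq_vieta)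
  also have "\<dots> = (\<Sum>m\<le>n. if m = n then vieta n x m else 0)"
    by (intro sum.cong) (auto simp: power_0_left)
  finally show ?thesis by simp
qed

lemma vieta_cong: "(\<And>i. i \<in> {1..n} \<Longrightarrow> x i = y i) \<Longrightarrow> vieta n x m = vieta n y m"
  unfolding vieta_def by (intro arg_cong2[where f = coeff] prod.cong) auto

lemma vieta_scale:
  assumes "c \<noteq> 0" "m \<le> n"
  shows "vieta n (\<lambda>i. c * x i) m = c ^ m * vieta n x m"
proof (rule vieta_unique[OF _ assms(2)])
  fix z
  have "(\<Prod>i = 1..n. z - c * x i) = (\<Prod>i = 1..n. c * (z / c - x i))"
    using assms(1) by (intro prod.cong) (auto simp: field_simps)
  also have "\<dots> = c ^ n * (\<Sum>m\<le>n. vieta n x m * (z / c) ^ (n - m))"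
    by (simp only: prod.distrib prod_constant card_atLeastAtMost diff_Suc_1 prod_eq_vieta)
  also have "\<dots> = (\<Sum>m\<le>n. c ^ m * vieta n x m * z ^ (n - m))"
    unfolding sum_distrib_left
  proof (rule sum.cong[OF refl])
    fix m assume "m \<in> {..n}"
    then have "c ^ n = c ^ m * c ^ (n - m)" by (simp flip: power_add)
    then show "c ^ n * (vieta n x m * (z / c) ^ (n - m)) = c ^ m * vieta n x m * z ^ (n - m)"
      using assms(1) by (simp add: power_divide)
  qed
  finally show "(\<Prod>i = 1..n. z - c * x i) = (\<Sum>m\<le>n. c ^ m * vieta n x m * z ^ (n - m))" .
qed

lemma vieta_root:
  assumes "j \<in> {1..n}"
  shows "(\<Sum>m\<le>n. vieta n x m * x j ^ (n - m)) = 0"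
  unfolding prod_eq_vieta[symmetric] using assms by (intro prod_zero) auto

text \<open>A Cauchy bound: if the root has modulus above 1, dividing its equation by the power
  \<open>n - 1\<close> of the modulus leaves only the coefficients.\<close>

lemma norm_root_le:
  assumes j: "j \<in> {1..n}"
  shows "norm (x j) \<le> 1 + (\<Sum>m = 1..n. norm (vieta n x m))"
proof (cases "norm (x j) \<le> 1")
  case True
  then show ?thesis by (intro add_increasing2 sum_nonneg) auto
next
  case False
  let ?S = "\<Sum>m = 1..n. norm (vieta n x m)"
  have "{..n} = insert 0 {1..n}" by auto
  then have "x j ^ n + (\<Sum>m = 1..n. vieta n x m * x j ^ (n - m)) = 0"
    using vieta_root[OF j, of x] by (simp add: vieta_0)
  then have "x j ^ n = - (\<Sum>m = 1..n. vieta n x m * x j ^ (n - m))"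
    by (simp add: eq_neg_iff_add_eq_0)
  then have "norm (x j) ^ n \<le> (\<Sum>m = 1..n. norm (vieta n x m) * norm (x j) ^ (n - m))"
    by (simp flip: norm_power norm_mult) (rule sum_norm_le, simp)
  also have "\<dots> \<le> (\<Sum>m = 1..n. norm (vieta n x m) * norm (x j) ^ (n - 1))"
    using False by (intro sum_mono mult_left_mono power_increasing) auto
  also have "\<dots> = ?S * norm (x j) ^ (n - 1)" by (simp add: sum_distrib_right)
  finally have "norm (x j) * norm (x j) ^ (n - 1) \<le> ?S * norm (x j) ^ (n - 1)"
    using j by (simp flip: power_Suc)
  then have "norm (x j) \<le> ?S" by (rule mult_right_le_imp_le) (use False in \<open>simp add: less_le_trans[of 0 1]\<close>)
  then show ?thesis by simp
qed

text \<open>The arguments with symmetric functions are carried out once and then applied both to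
  functions with expansions (\<open>asymp_alg\<close>) and to functions whose derivatives have
  expansions as well (\<open>diff_alg\<close>). By \<open>cong\<close>, membership depends on the
  values on \<open>U\<close> alone.\<close>

locale function_algebra =
  fixes U :: "real set" and X :: "(real \<Rightarrow> complex) set"
  assumes const: "(\<lambda>t. c) \<in> X"
    and add: "f \<in> X \<Longrightarrow> g \<in> X \<Longrightarrow> (\<lambda>t. f t + g t) \<in> X"
    and mult: "f \<in> X \<Longrightarrow> g \<in> X \<Longrightarrow> (\<lambda>t. f t * g t) \<in> X"
    and cong: "f \<in> X \<Longrightarrow> (\<And>t. t \<in> U \<Longrightarrow> f t = g t) \<Longrightarrow> g \<in> X"
begin

lemma uminus: "f \<in> X \<Longrightarrow> (\<lambda>t. - f t) \<in> X"
  using mult[OF const[of "-1"]] by simp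

lemma sum: "(\<And>i. i \<in> A \<Longrightarrow> f i \<in> X) \<Longrightarrow> (\<lambda>t. \<Sum>i\<in>A. f i t) \<in> X"
  by (induction A rule: infinite_finite_induct) (auto intro: const add)

text \<open>Newton's identity solved for its term \<open>j = 0\<close>; beyond exponent
  \<open>n\<close> the recursion continues with vanishing \<open>vieta\<close>.\<close>

lemma power_sum:
  assumes "\<And>m. m \<in> {1..n} \<Longrightarrow> (\<lambda>t. vieta n (\<lambda>i. x i t) m) \<in> X"
  shows "(\<lambda>t. \<Sum>i = 1..n. x i t ^ l) \<in> X"
proof (induction l rule: less_induct)
  case (less l)
  have v: "(\<lambda>t. vieta n (\<lambda>i. x i t) m) \<in> X" for m
    using assms[of m] by (cases "m = 0"; cases "m \<le> n") (auto simp: vieta_0 vieta_large const)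
  show ?case
  proof (cases l)
    case 0
    then show ?thesis by (simp add: const)
  next
    case (Suc m)
    let ?v = "\<lambda>t. vieta n (\<lambda>i. x i t)"
    have "(\<Sum>i = 1..n. x i t ^ l) =
        - (of_nat (Suc m) * ?v t (Suc m) + (\<Sum>j\<in>{1..m}. ?v t j * (\<Sum>i = 1..n. x i t ^ Suc (m - j))))" for t
    proof -
      have "{..m} = insert 0 {1..m}" by auto
      then show ?thesis
        using newton[of m n "\<lambda>i. x i t"] by (simp add: vieta_0 Suc del: power_Suc of_nat_Suc)
    qed
    moreover have "(\<lambda>t. - (of_nat (Suc m) * ?v t (Suc m) +
        (\<Sum>j\<in>{1..m}. ?v t j * (\<Sum>i = 1..n. x i t ^ Suc (m - j))))) \<in> X"
      by (intro uminus add mult const sum v less) (use Suc in auto)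
    ultimately show ?thesis by simp
  qed
qed

text \<open>The same recursion solved for \<open>vieta\<close>: the only division is by the constant
  \<open>Suc k\<close>, whose inverse lies in \<open>X\<close>.\<close>

lemma vieta_mem:
  assumes "\<And>l. (\<lambda>t. \<Sum>i = 1..n. x i t ^ l) \<in> X"
  shows "(\<lambda>t. vieta n (\<lambda>i. x i t) m) \<in> X"
proof (induction m rule: less_induct)
  case (less m)
  show ?case
  proof (cases m)
    case 0
    then show ?thesis by (simp add: const vieta_0)
  next
    case (Suc k)
    have "(\<lambda>t. (- 1 / of_nat (Suc k)) * (\<Sum>j\<le>k. vieta n (\<lambda>i. x i t) j * (\<Sum>i = 1..n. x i t ^ Suc (k - j)))) \<in> X"
      by (intro mult const sum less assms) (use Suc in auto)
    moreover have "(- 1 / of_nat (Suc k)) * (\<Sum>j\<le>k. vieta n (\<lambda>i. x i t) j * (\<Sum>i = 1..n. x i t ^ Suc (k - j))) =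
        vieta n (\<lambda>i. x i t) m" for t
      using newton[of k n "\<lambda>i. x i t"] unfolding Suc
      by (simp add: field_simps del: power_Suc of_nat_Suc)
    ultimately show ?thesis by simp
  qed
qed

text \<open>Polynomials over \<open>X\<close> in variables indexed by \<open>nat\<close>, kept as
  functions of time and of an assignment rather than as formal objects. Rule induction then replaces
  bookkeeping with monomials.\<close>

inductive poly_over :: "(real \<Rightarrow> (nat \<Rightarrow> complex) \<Rightarrow> complex) \<Rightarrow> bool" where
  coeff: "c \<in> X \<Longrightarrow> poly_over (\<lambda>t x. c t)"
| var: "poly_over (\<lambda>t x. x b)"
| plus: "poly_over f \<Longrightarrow> poly_over g \<Longrightarrow> poly_over (\<lambda>t x. f t x + g t x)"
| times: "poly_over f \<Longrightarrow> poly_over g \<Longrightarrow> poly_over (\<lambda>t x. f t x * g t x)"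

lemma poly_over_const: "poly_over (\<lambda>t x. c)"
  by (rule coeff[OF const])

lemma poly_over_diff: "poly_over f \<Longrightarrow> poly_over g \<Longrightarrow> poly_over (\<lambda>t x. f t x - g t x)"
  using plus[OF _ times[OF poly_over_const[of "-1"]]] by simp

lemma poly_over_sum: "(\<And>i. i \<in> A \<Longrightarrow> poly_over (f i)) \<Longrightarrow> poly_over (\<lambda>t x. \<Sum>i\<in>A. f i t x)"
  by (induction A rule: infinite_finite_induct) (auto intro: poly_over_const plus)

lemma poly_over_prod: "(\<And>i. i \<in> A \<Longrightarrow> poly_over (f i)) \<Longrightarrow> poly_over (\<lambda>t x. \<Prod>i\<in>A. f i t x)"
  by (induction A rule: infinite_finite_induct) (auto intro: poly_over_const times)

lemma poly_over_power: "poly_over f \<Longrightarrow> poly_over (\<lambda>t x. f t x ^ m)"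
  by (induction m) (auto intro: poly_over_const times)

lemma poly_over_eval: "poly_over f \<Longrightarrow> (\<lambda>t. f t x) \<in> X"
  by (induction rule: poly_over.induct) (auto intro: const add mult)

text \<open>
  The induction works because the factor \<open>g\<close> is arbitrary: the functions \<open>f\<close> for which the claim
  holds are multipliers, and multipliers form an algebra.
\<close>
lemma poly_over_eliminate_aux:
  assumes "poly_over f"
    and "\<And>l. poly_over (\<lambda>t x. \<Sum>i\<in>J. y i t ^ l * g t i x)"
  shows "poly_over (\<lambda>t x. \<Sum>i\<in>J. y i t ^ l * (f t (x(b := y i t)) * g t i x))"
  using assms
proof (induction arbitrary: g l rule: poly_over.induct)
  case (coeff c)
  then show ?case
    using times[OF poly_over.coeff[OF coeff(1)] coeff(2)[of l]]
    by (simp add: sum_distrib_left mult_ac)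
next
  case (var c)
  show ?case
  proof (cases "c = b")
    case True
    \<comment> \<open>Substituting for the eliminated variable multiplies by \<open>y i t\<close>,
      which raises \<open>l\<close> by one: hence premise and claim concern all exponents
      \<open>l\<close>.\<close>
    then show ?thesis using var[of "Suc l"] by (simp add: mult_ac)
  next
    case False
    then show ?thesis using times[OF poly_over.var[of c] var[of l]]
      by (simp add: sum_distrib_left mult_ac)
  qed
next
  case (plus f1 f2)
  show ?case
    using poly_over.plus[OF plus.IH(1)[OF plus.prems] plus.IH(2)[OF plus.prems], of l l]
    by (simp add: sum.distrib [symmetric] algebra_simps)
next
  case (times f1 f2)
  show ?case
    using times.IH(1)[OF times.IH(2)[OF times.prems], of l] by (simp add: mult.assoc)
qed

text \<open>The weights enter only through their moments against the powers of \<open>y\<close>. For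
  weights 1 these are power sums; weights \<open>lam'\<close> give access to the derivatives of the
  roots although no single derivative is known to lie in \<open>X\<close>.\<close>

lemma poly_over_eliminate:
  assumes "poly_over f"
    and "\<And>l. (\<lambda>t. \<Sum>i\<in>J. y i t ^ l * w i t) \<in> X"
  shows "poly_over (\<lambda>t x. \<Sum>i\<in>J. f t (x(b := y i t)) * w i t)"
  using poly_over_eliminate_aux[OF assms(1), where J = J and y = y and g = "\<lambda>t i x. w i t" and l = 0 and b = b] coeff[OF assms(2)]
  by simp

text \<open>The variables in \<open>B\<close> run independently through all \<open>y i\<close> and
  can be eliminated one after the other. A sum restricted to injective \<open>h\<close> would couple
  them.\<close>

lemma poly_over_sum_PiE:
  fixes y :: "'i \<Rightarrow> real \<Rightarrow> complex"
  assumes f: "poly_over f" and B: "finite B"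
    and y: "\<And>l. (\<lambda>t. \<Sum>i\<in>J. y i t ^ l) \<in> X"
  shows "poly_over (\<lambda>t x. \<Sum>h\<in>B \<rightarrow>\<^sub>E J. f t (\<lambda>b. if b \<in> B then y (h b) t else x b))"
  using B
proof (induction B)
  case empty
  then show ?case using f by simp
next
  case (insert b B)
  have "(\<Sum>h\<in>insert b B \<rightarrow>\<^sub>E J. f t (\<lambda>c. if c \<in> insert b B then y (h c) t else x c)) =
     (\<Sum>i\<in>J. (\<Sum>h\<in>B \<rightarrow>\<^sub>E J. f t (\<lambda>c. if c \<in> B then y (h c) t else (x(b := y i t)) c)) * 1)" for t x
  proof -
    have "(\<Sum>h\<in>insert b B \<rightarrow>\<^sub>E J. f t (\<lambda>c. if c \<in> insert b B then y (h c) t else x c)) =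
      (\<Sum>(i, h)\<in>J \<times> (B \<rightarrow>\<^sub>E J). f t (\<lambda>c. if c \<in> insert b B then y ((h(b := i)) c) t else x c))"
      unfolding PiE_insert_eq
      by (subst sum.reindex[OF inj_combinator[OF insert(2)]]) (simp add: case_prod_unfold o_def)
    also have "\<dots> = (\<Sum>i\<in>J. \<Sum>h\<in>B \<rightarrow>\<^sub>E J. f t (\<lambda>c. if c \<in> insert b B then y ((h(b := i)) c) t else x c))"
      by (rule sum.cartesian_product[symmetric])
    also have "\<dots> = (\<Sum>i\<in>J. (\<Sum>h\<in>B \<rightarrow>\<^sub>E J. f t (\<lambda>c. if c \<in> B then y (h c) t else (x(b := y i t)) c)) * 1)"
      using insert(2) by (intro sum.cong arg_cong2[where f = f] refl ext; simp, intro sum.cong refl arg_cong2[where f = f] ext; auto)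
    finally show ?thesis .
  qed
  then show ?case
    using poly_over_eliminate[OF insert.IH, where J = J and y = y and w = "\<lambda>_ _. 1" and b = b] y by simp
qed

text \<open>A Tschirnhaus transformation: the power sums of the transformed roots are sums of
  \<open>f ^ l\<close> over the roots, which elimination places in \<open>X\<close>, and Newton's
  identities lead back to the coefficients.\<close>

lemma vieta_poly_over:
  assumes f: "poly_over f" and y: "\<And>l. (\<lambda>t. \<Sum>i = 1..n. y i t ^ l) \<in> X"
  shows "(\<lambda>t. vieta n (\<lambda>i. f t (x(b := y i t))) m) \<in> X"
proof (rule vieta_mem)
  fix l
  have "poly_over (\<lambda>t x. \<Sum>i = 1..n. f t (x(b := y i t)) ^ l * 1)"
    by (rule poly_over_eliminate[OF poly_over_power[OF f]]) (use y in simp)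
  from poly_over_eval[OF this, of x] show "(\<lambda>t. \<Sum>i = 1..n. f t (x(b := y i t)) ^ l) \<in> X"
    by simp
qed

end

section \<open>Asymptotic expansions\<close>

text \<open>An asymptotic, not necessarily convergent, Taylor expansion: the polynomial may change
  with \<open>M\<close>. The expansion asks nothing at \<open>s\<close> itself, and on a two-sided
  \<open>U\<close> one polynomial serves both sides.\<close>

definition asymp_alg :: "real set \<Rightarrow> real \<Rightarrow> (real \<Rightarrow> complex) set" where
  "asymp_alg U s = {f. continuous_on U f \<and>
     (\<forall>M. \<exists>q. (\<lambda>t. f t - poly q (of_real (t - s))) \<in> O[at s within U](\<lambda>t. of_real (t - s) ^ M))}"

lemma poly_bigo_1: "(\<lambda>t. poly q (of_real (t - s)) :: complex) \<in> O[at s within U](\<lambda>t. 1)"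
proof (rule bigoI_tendsto)
  have "((\<lambda>t. poly q (of_real (t - s)) :: complex) \<longlongrightarrow> poly q (of_real (s - s))) (at s within U)"
    by (intro tendsto_intros)
  then show "((\<lambda>t. poly q (of_real (t - s)) / (1::complex)) \<longlongrightarrow> poly q 0) (at s within U)"
    by simp
qed simp

lemma asymp_alg_bigo_1:
  assumes "f \<in> asymp_alg U s"
  shows "f \<in> O[at s within U](\<lambda>t. 1)"
proof -
  obtain q where "(\<lambda>t. f t - poly q (of_real (t - s))) \<in> O[at s within U](\<lambda>t. of_real (t - s) ^ 0)"
    using assms unfolding asymp_alg_def by blast
  then have "(\<lambda>t. f t - poly q (of_real (t - s))) \<in> O[at s within U](\<lambda>t. 1)" by simp
  from sum_in_bigo(1)[OF this poly_bigo_1[of q]] show ?thesis by simp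
qed

lemma function_algebra_asymp_alg: "function_algebra U (asymp_alg U s)"
proof
  fix c show "(\<lambda>t. c) \<in> asymp_alg U s"
    unfolding asymp_alg_def by (auto intro!: exI[of _ "[:c:]"])
next
  fix f g assume f: "f \<in> asymp_alg U s" and g: "g \<in> asymp_alg U s"
  have cont: "continuous_on U f" "continuous_on U g"
    using f g by (auto simp: asymp_alg_def)
  show "(\<lambda>t. f t + g t) \<in> asymp_alg U s"
    unfolding asymp_alg_def
  proof (intro CollectI conjI allI continuous_on_add cont)
    fix M
    obtain q r where "(\<lambda>t. f t - poly q (of_real (t - s))) \<in> O[at s within U](\<lambda>t. of_real (t - s) ^ M)"
        "(\<lambda>t. g t - poly r (of_real (t - s))) \<in> O[at s within U](\<lambda>t. of_real (t - s) ^ M)"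
      using f g unfolding asymp_alg_def by blast
    from sum_in_bigo(1)[OF this]
    show "\<exists>q. (\<lambda>t. f t + g t - poly q (of_real (t - s))) \<in> O[at s within U](\<lambda>t. of_real (t - s) ^ M)"
      by (intro exI[of _ "q + r"]) (simp add: algebra_simps)
  qed
  show "(\<lambda>t. f t * g t) \<in> asymp_alg U s"
    unfolding asymp_alg_def
  proof (intro CollectI conjI allI continuous_on_mult cont)
    fix M
    obtain q r where q: "(\<lambda>t. f t - poly q (of_real (t - s))) \<in> O[at s within U](\<lambda>t. of_real (t - s) ^ M)"
        and r: "(\<lambda>t. g t - poly r (of_real (t - s))) \<in> O[at s within U](\<lambda>t. of_real (t - s) ^ M)"
      using f g unfolding asymp_alg_def by blast
    have "(\<lambda>t. f t * (g t - poly r (of_real (t - s))) + poly r (of_real (t - s)) * (f t - poly q (of_real (t - s))))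
        \<in> O[at s within U](\<lambda>t. of_real (t - s) ^ M)"
      using landau_o.big.mult[OF asymp_alg_bigo_1[OF f] r] landau_o.big.mult[OF poly_bigo_1[of r] q]
      by (intro sum_in_bigo) simp_all
    then show "\<exists>q. (\<lambda>t. f t * g t - poly q (of_real (t - s))) \<in> O[at s within U](\<lambda>t. of_real (t - s) ^ M)"
      by (intro exI[of _ "q * r"]) (simp add: algebra_simps)
  qed
next
  fix f g :: "real \<Rightarrow> complex"
  assume f: "f \<in> asymp_alg U s" and eq: "\<And>t. t \<in> U \<Longrightarrow> f t = g t"
  have ev: "\<forall>\<^sub>F t in at s within U. f t = g t"
    using eq by (auto simp: eventually_at_filter)
  have "(\<lambda>t. f t - poly q (of_real (t - s))) \<in> O[at s within U](h) \<longleftrightarrow>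
      (\<lambda>t. g t - poly q (of_real (t - s))) \<in> O[at s within U](h)" for q and h :: "real \<Rightarrow> complex"
    by (rule landau_o.big.in_cong) (use ev in \<open>auto elim: eventually_mono\<close>)
  then show "g \<in> asymp_alg U s"
    using f continuous_on_cong[of U U f g] eq unfolding asymp_alg_def by simp
qed

lemma asymp_alg_ident: "(\<lambda>t. of_real (t - s)) \<in> asymp_alg U s"
  unfolding asymp_alg_def
  by (auto intro!: exI[of _ "[:0, 1:]"] continuous_intros)

text \<open>The lowest nonzero coefficient below degree \<open>M\<close> of the approximating
  polynomial decides: its term dominates the other terms and the remainder. The bound
  \<open>M\<close> is fixed in advance because \<open>f\<close> may be infinitely flat.\<close>

lemma asymp_alg_dichotomy:
  assumes "f \<in> asymp_alg U s"
  obtains (big) "f \<in> O[at s within U](\<lambda>t. of_real (t - s) ^ M)"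
  | (lim) d c where "d < M" "c \<noteq> 0"
     "((\<lambda>t. f t / of_real (t - s) ^ d) \<longlongrightarrow> c) (at s within U)"
proof -
  let ?F = "at s within U"
  let ?x = "\<lambda>t. of_real (t - s) :: complex"
  obtain q where q: "(\<lambda>t. f t - poly q (?x t)) \<in> O[?F](\<lambda>t. ?x t ^ M)"
    using assms unfolding asymp_alg_def by blast
  have dvd: "\<exists>r. q = monom 1 d * r" if "\<forall>i<d. coeff q i = 0" for d
    using that unfolding monom_1_dvd_iff'[symmetric] by (auto elim: dvdE)
  show ?thesis
  proof (cases "\<forall>i<M. coeff q i = 0")
    case True
    then obtain r where "q = monom 1 M * r" using dvd by blast
    then have "(\<lambda>t. poly q (?x t)) = (\<lambda>t. ?x t ^ M * poly r (?x t))"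
      by (simp add: poly_monom)
    moreover have "(\<lambda>t. ?x t ^ M * poly r (?x t)) \<in> O[?F](\<lambda>t. ?x t ^ M * 1)"
      by (intro landau_o.big.mult poly_bigo_1) simp
    ultimately have "(\<lambda>t. poly q (?x t)) \<in> O[?F](\<lambda>t. ?x t ^ M)" by simp
    from sum_in_bigo(1)[OF q this] have "f \<in> O[?F](\<lambda>t. ?x t ^ M)" by (simp del: of_real_diff)
    then show ?thesis by (rule big)
  next
    case False
    define d where "d = (LEAST i. coeff q i \<noteq> 0)"
    obtain i where i: "i < M" "coeff q i \<noteq> 0" using False by blast
    have d: "coeff q d \<noteq> 0" "d < M" "\<forall>i<d. coeff q i = 0"
      unfolding d_def
    proof -
      show "coeff q (LEAST i. coeff q i \<noteq> 0) \<noteq> 0" by (rule LeastI) (rule i(2))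
      show "(LEAST i. coeff q i \<noteq> 0) < M"
        using Least_le[of "\<lambda>i. coeff q i \<noteq> 0", OF i(2)] i(1) by simp
      show "\<forall>i<(LEAST i. coeff q i \<noteq> 0). coeff q i = 0"
        using not_less_Least by blast
    qed
    then obtain r where r: "q = monom 1 d * r" using dvd by blast
    have "coeff q d = poly r 0" unfolding r by (simp add: coeff_monom_mult poly_0_coeff_0)
    then have r0: "poly r 0 \<noteq> 0" using d by simp
    have ne: "\<forall>\<^sub>F t in ?F. ?x t \<noteq> 0"
      by (auto simp: eventually_at_filter)
    have "(\<lambda>t. ?x t ^ M) \<in> o[?F](\<lambda>t. ?x t ^ d)"
    proof (rule smalloI_tendsto)
      have "((\<lambda>t. ?x t ^ (M - d)) \<longlongrightarrow> of_real (s - s) ^ (M - d)) ?F"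
        by (intro tendsto_intros)
      then have "((\<lambda>t. ?x t ^ (M - d)) \<longlongrightarrow> 0) ?F" using d by (simp add: power_0_left)
      moreover have "\<forall>\<^sub>F t in ?F. ?x t ^ (M - d) = ?x t ^ M / ?x t ^ d"
        using ne by eventually_elim (use d in \<open>simp add: power_diff\<close>)
      ultimately show "((\<lambda>t. ?x t ^ M / ?x t ^ d) \<longlongrightarrow> 0) ?F"
        by (rule Lim_transform_eventually)
    qed (rule eventually_mono[OF ne], simp)
    then have "((\<lambda>t. (f t - poly q (?x t)) / ?x t ^ d) \<longlongrightarrow> 0) ?F"
      using q by (intro smalloD_tendsto) (rule landau_o.big_small_trans)
    moreover have "((\<lambda>t. poly r (?x t)) \<longlongrightarrow> poly r (of_real (s - s))) ?F"
      by (intro tendsto_intros)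
    ultimately have "((\<lambda>t. (f t - poly q (?x t)) / ?x t ^ d + poly r (?x t)) \<longlongrightarrow> 0 + poly r (of_real (s - s))) ?F"
      by (intro tendsto_add)
    moreover have "\<forall>\<^sub>F t in ?F. (f t - poly q (?x t)) / ?x t ^ d + poly r (?x t) = f t / ?x t ^ d"
      using ne by eventually_elim (simp add: r poly_monom field_simps)
    ultimately have "((\<lambda>t. f t / ?x t ^ d) \<longlongrightarrow> poly r 0) ?F"
      by (auto dest: Lim_transform_eventually)
    with d r0 show ?thesis using lim by blast
  qed
qed

text \<open>Taylor's theorem, by induction on the order for all derivatives at once: an expansion of
  \<open>D (Suc k)\<close> to order \<open>M\<close> integrates to one of \<open>D k\<close> to
  order \<open>Suc M\<close>. Working within \<open>I\<close> covers the case that \<open>s\<close>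
  is an endpoint.\<close>

lemma derivatives_asymp_alg:
  fixes D :: "nat \<Rightarrow> real \<Rightarrow> complex"
  assumes I: "is_interval I" "s \<in> I" "U \<subseteq> I"
    and D: "\<And>k t. t \<in> I \<Longrightarrow> (D k has_vector_derivative D (Suc k) t) (at t within I)"
  shows "D k \<in> asymp_alg U s"
proof -
  have cont: "continuous_on I (D k)" for k
    using D by (meson continuous_on_eq_continuous_within has_vector_derivative_continuous)
  \<comment> \<open>Explicit constants instead of a Landau symbol: the mean value inequality needs
    the bound at every point of a segment, including \<open>s\<close>.\<close>
  have ex: "\<exists>q. \<exists>C\<ge>0. \<exists>e>0. \<forall>t\<in>I \<inter> ball s e. norm (D k t - poly q (of_real (t - s))) \<le> C * \<bar>t - s\<bar> ^ M" for k M
  proof (induction M arbitrary: k)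
    case 0
    have "((\<lambda>t. D k t) \<longlongrightarrow> D k s) (at s within I)"
      using cont I by (auto simp: continuous_on_def)
    then have "\<exists>e>0. \<forall>t\<in>I. t \<noteq> s \<and> dist t s < e \<longrightarrow> dist (D k t) (D k s) < 1"
      unfolding tendsto_iff eventually_at by simp
    then obtain e where "e > 0" "\<And>t. t \<in> I \<Longrightarrow> t \<noteq> s \<Longrightarrow> dist t s < e \<Longrightarrow> dist (D k t) (D k s) < 1"
      by blast
    then have "norm (D k t - D k s) \<le> 1" if "t \<in> I \<inter> ball s e" for t
      using that by (cases "t = s") (auto simp: dist_norm abs_minus_commute intro!: less_imp_le)
    then have "\<forall>t\<in>I \<inter> ball s e. norm (D k t - poly [:D k s:] (of_real (t - s))) \<le> 1 * \<bar>t - s\<bar> ^ 0"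
      by simp
    with \<open>e > 0\<close> show ?case by (intro exI[of _ "[:D k s:]"] exI[of _ 1]) auto
  next
    case (Suc M)
    obtain q C e where C: "C \<ge> 0" "e > 0"
        and q: "\<And>t. t \<in> I \<inter> ball s e \<Longrightarrow> norm (D (Suc k) t - poly q (of_real (t - s))) \<le> C * \<bar>t - s\<bar> ^ M"
      using Suc[of "Suc k"] by blast
    \<comment> \<open>The antiderivative of \<open>q\<close> whose constant term makes
      \<open>D k - r\<close> vanish at \<open>s\<close>.\<close>
    obtain r where r: "pderiv r = q" "poly r 0 = D k s"
    proof -
      define r where "r = Poly (map (\<lambda>i. if i = 0 then D k s else coeff q (i - 1) / of_nat i) [0..<Suc (Suc (degree q))])"
      have c: "coeff r i = (if i = 0 then D k s else coeff q (i - 1) / of_nat i)" for i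
        unfolding r_def coeff_Poly_eq by (cases i) (auto simp: nth_default_def coeff_eq_0 simp del: upt_Suc)
      show ?thesis
        by (rule that[of r]) (auto simp: poly_eq_iff coeff_pderiv c poly_0_coeff_0 simp del: of_nat_Suc)
    qed
    have "norm (D k t - poly r (of_real (t - s))) \<le> C * \<bar>t - s\<bar> ^ Suc M" if t: "t \<in> I \<inter> ball s e" for t
    proof -
      let ?S = "closed_segment s t"
      let ?g = "\<lambda>t. D k t - poly r (of_real (t - s))"
      have sub: "?S \<subseteq> I \<inter> ball s e"
        using I t C by (intro closed_segment_subset) (auto simp: is_interval_convex intro!: convex_Int)
      have der: "(?g has_derivative (\<lambda>h. h *\<^sub>R (D (Suc k) y - poly q (of_real (y - s))))) (at y within ?S)"
        if "y \<in> ?S" for y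
      proof -
        have 1: "(D k has_vector_derivative D (Suc k) y) (at y within ?S)"
          using D[of y k] sub that by (auto intro: has_vector_derivative_within_subset)
        have "((\<lambda>t. poly r (of_real (t - s))) has_vector_derivative 1 * poly q (of_real (y - s))) (at y within ?S)"
          unfolding r(1)[symmetric] o_def
          by (rule field_vector_diff_chain_within[where f = "\<lambda>t. of_real (t - s)" and g = "poly r", unfolded o_def])
            (auto intro!: derivative_eq_intros poly_DERIV simp: has_vector_derivative_def
              has_field_derivative_at_within scaleR_conv_of_real)
        then show ?thesis
          using has_vector_derivative_diff[OF 1] unfolding has_vector_derivative_def by simp
      qed
      have "norm (?g t - ?g s) \<le> (C * \<bar>t - s\<bar> ^ M) * norm (t - s)"
      proof (rule differentiable_bound[OF _ der])
        fix y assume y: "y \<in> ?S"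
        have "norm (D (Suc k) y - poly q (of_real (y - s))) \<le> C * \<bar>y - s\<bar> ^ M"
          using q sub y by blast
        also have "\<dots> \<le> C * \<bar>t - s\<bar> ^ M"
          using y C by (intro mult_left_mono power_mono)
            (auto simp: closed_segment_eq_real_ivl split: if_splits)
        finally show "onorm (\<lambda>h. h *\<^sub>R (D (Suc k) y - poly q (of_real (y - s)))) \<le> C * \<bar>t - s\<bar> ^ M"
          by (intro order.trans[OF onorm_le[where b = "norm (D (Suc k) y - poly q (of_real (y - s)))"]]) auto
      qed auto
      then show ?thesis using r(2) by (simp add: mult_ac)
    qed
    then show ?case using C by blast
  qed
  show ?thesis
    unfolding asymp_alg_def
  proof (intro CollectI conjI allI)
    show "continuous_on U (D k)" using cont I(3) by (rule continuous_on_subset)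
    fix M
    obtain q C e where C: "C \<ge> 0" "e > 0"
        and q: "\<And>t. t \<in> I \<inter> ball s e \<Longrightarrow> norm (D k t - poly q (of_real (t - s))) \<le> C * \<bar>t - s\<bar> ^ M"
      using ex[of k M] by blast
    have "(\<lambda>t. D k t - poly q (of_real (t - s))) \<in> O[at s within U](\<lambda>t. of_real (t - s) ^ M)"
    proof (rule bigoI)
      show "\<forall>\<^sub>F t in at s within U. norm (D k t - poly q (of_real (t - s))) \<le> C * norm (complex_of_real (t - s) ^ M)"
        unfolding eventually_at using I C q
        by (intro exI[of _ e]) (auto simp: norm_power dist_commute simp flip: of_real_diff)
    qed
    then show "\<exists>q. (\<lambda>t. D k t - poly q (of_real (t - s))) \<in> O[at s within U](\<lambda>t. of_real (t - s) ^ M)" ..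
  qed
qed

section \<open>Interpolation at the distinct roots\<close>

text \<open>Up to sign the product of the squared differences: both orders of a pair occur.\<close>
definition vandermonde_sq :: "complex set \<Rightarrow> complex" where
  "vandermonde_sq Y = (\<Prod>\<mu>\<in>Y. \<Prod>\<nu>\<in>Y - {\<mu>}. \<mu> - \<nu>)"

lemma vandermonde_sq_nonzero: "finite Y \<Longrightarrow> vandermonde_sq Y \<noteq> 0"
  by (auto simp: vandermonde_sq_def)

lemma vandermonde_sq_image:
  assumes "inj_on g A"
  shows "(\<Prod>p\<in>A. \<Prod>q\<in>A - {p}. g p - g q) = vandermonde_sq (g ` A)"
proof -
  have "(\<Prod>q\<in>A - {p}. g p - g q) = (\<Prod>\<nu>\<in>g ` A - {g p}. g p - \<nu>)" if "p \<in> A" for p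
  proof -
    have "g ` A - {g p} = g ` (A - {p})"
      using assms that by (auto simp: inj_on_def)
    then show ?thesis
      using assms by (simp add: prod.reindex inj_on_diff)
  qed
  then show ?thesis
    unfolding vandermonde_sq_def by (simp add: prod.reindex[OF assms])
qed

lemma vandermonde_sq_insert:
  assumes "finite Y" "u \<notin> Y"
  shows "vandermonde_sq (insert u Y) = (\<Prod>y\<in>Y. (u - y) * (y - u)) * vandermonde_sq Y"
proof -
  have "(\<Prod>\<nu>\<in>insert u Y - {\<mu>}. \<mu> - \<nu>) = (\<mu> - u) * (\<Prod>\<nu>\<in>Y - {\<mu>}. \<mu> - \<nu>)" if "\<mu> \<in> Y" for \<mu>
  proof -
    have "insert u Y - {\<mu>} = insert u (Y - {\<mu>})" using assms that by auto
    then show ?thesis using assms by simp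
  qed
  then show ?thesis
    unfolding vandermonde_sq_def using assms by (simp add: prod.distrib)
qed

text \<open>On the right each unordered pair occurs in both orders and contributes
  \<open>(r p - r q) * (r q - r p)\<close>, the negative of the square; the exponent of the sign is
  the number of unordered pairs.\<close>

lemma prod_pairs_less:
  fixes r :: "nat \<Rightarrow> complex"
  assumes "finite S"
  shows "(\<Prod>(p, q)\<in>{(p, q). p \<in> S \<and> q \<in> S \<and> p < q}. (r p - r q)\<^sup>2) =
    (-1) ^ ((card S * card S - card S) div 2) * (\<Prod>p\<in>S. \<Prod>q\<in>S - {p}. r p - r q)"
proof -
  let ?L = "{(p, q). p \<in> S \<and> q \<in> S \<and> p < q}"
  let ?G = "{(p, q). p \<in> S \<and> q \<in> S \<and> q < p}"
  have fin: "finite ?L" "finite ?G"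
    by (rule finite_subset[of _ "S \<times> S"], use assms in auto)+
  have G: "?G = prod.swap ` ?L" by auto
  have un: "Sigma S (\<lambda>p. S - {p}) = ?L \<union> ?G" and dis: "?L \<inter> ?G = {}" by auto
  have "(\<Sum>p\<in>S. card (S - {p})) = card ?L + card ?G"
    using card_Un_disjoint[OF fin dis] card_SigmaI[of S "\<lambda>p. S - {p}"] assms un by simp
  moreover have "card ?G = card ?L" unfolding G by (rule card_image) simp
  moreover have "(\<Sum>p\<in>S. card (S - {p})) = card S * (card S - 1)" using assms by simp
  ultimately have card: "card ?L = (card S * card S - card S) div 2"
    by (simp add: diff_mult_distrib2)
  have "(\<Prod>p\<in>S. \<Prod>q\<in>S - {p}. r p - r q) = (\<Prod>(p, q)\<in>?L. r p - r q) * (\<Prod>(p, q)\<in>?G. r p - r q)"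
    using prod.Sigma[of S "\<lambda>p. S - {p}" "\<lambda>p q. r p - r q"] assms
      prod.union_disjoint[OF fin dis] un by simp
  also have "(\<Prod>(p, q)\<in>?G. r p - r q) = (\<Prod>(p, q)\<in>?L. r q - r p)"
    unfolding G by (subst prod.reindex) (auto simp: case_prod_unfold)
  also have "(\<Prod>(p, q)\<in>?L. r p - r q) * (\<Prod>(p, q)\<in>?L. r q - r p) = (\<Prod>(p, q)\<in>?L. (-1) * (r p - r q)\<^sup>2)"
    unfolding prod.distrib[symmetric]
    by (intro prod.cong) (auto simp: power2_eq_square algebra_simps)
  also have "\<dots> = (-1) ^ card ?L * (\<Prod>(p, q)\<in>?L. (r p - r q)\<^sup>2)"
    unfolding case_prod_unfold prod.distrib by simp
  finally show ?thesis unfolding card by (simp add: power_add[symmetric] flip: mult.assoc)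
qed

section \<open>Discriminants as counted multiples of one Vandermonde product\<close>

lemma sum_zero_or_const:
  fixes w :: "'b :: comm_semiring_1"
  assumes "finite A" "\<And>a. a \<in> A \<Longrightarrow> f a = 0 \<or> f a = w"
  shows "sum f A = of_nat (card {a \<in> A. f a \<noteq> 0}) * w"
proof -
  have "sum f A = sum f {a \<in> A. f a \<noteq> 0}"
    using assms by (intro sum.mono_neutral_right) auto
  also have "\<dots> = sum (\<lambda>_. w) {a \<in> A. f a \<noteq> 0}"
    using assms(2) by (intro sum.cong) auto
  finally show ?thesis by simp
qed

text \<open>If there are at most \<open>k\<close> distinct values, \<open>k\<close> indices with
  distinct values already exhaust them, so the term is the discriminant of the whole set of values.
  A repeated value produces a zero factor.\<close>

lemma Delta_term:
  fixes x :: "nat \<Rightarrow> complex"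
  assumes "S \<subseteq> {1..n}" "card S = k" "card (x ` {1..n}) \<le> k"
  defines "T \<equiv> \<Prod>p\<in>S. \<Prod>q\<in>S - {p}. x p - x q"
  shows "T = (if inj_on x S then vandermonde_sq (x ` {1..n}) else 0)"
    and "inj_on x S \<Longrightarrow> x ` S = x ` {1..n}"
proof -
  have fin: "finite S" by (rule finite_subset[OF assms(1) finite_atLeastAtMost])
  show im: "x ` S = x ` {1..n}" if "inj_on x S"
  proof (rule card_subset_eq)
    show "x ` S \<subseteq> x ` {1..n}" using assms(1) by blast
    then show "card (x ` S) = card (x ` {1..n})"
      using assms(2,3) card_image[OF that] card_mono[of "x ` {1..n}" "x ` S"] by simp
  qed simp
  show "T = (if inj_on x S then vandermonde_sq (x ` {1..n}) else 0)"
  proof (cases "inj_on x S")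
    case True
    then show ?thesis using vandermonde_sq_image[OF True] im by (simp add: T_def)
  next
    case False
    then obtain p q where "p \<in> S" "q \<in> S" "p \<noteq> q" "x p = x q" by (auto simp: inj_on_def)
    then have "(\<Prod>q\<in>S - {p}. x p - x q) = 0"
      using fin by (intro prod_zero bexI[of _ q]) auto
    then have "T = 0" unfolding T_def using \<open>p \<in> S\<close> by (rule prod_zero[OF fin bexI])
    then show ?thesis using False by simp
  qed
qed

text \<open>All nonzero terms agree by \<open>Delta_term\<close>, so only their number remains. It
  is positive precisely if there are \<open>k\<close> distinct values.\<close>

lemma Delta_roots_eq:
  assumes "card (x ` {1..n}) \<le> k"
  shows "Delta_roots n k x = (-1) ^ ((k * k - k) div 2) *
    of_nat (card {S. S \<subseteq> {1..n} \<and> card S = k \<and> inj_on x S}) * vandermonde_sq (x ` {1..n})"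
proof -
  let ?A = "{S. S \<subseteq> {1..n} \<and> card S = k}"
  let ?T = "\<lambda>S. \<Prod>p\<in>S. \<Prod>q\<in>S - {p}. x p - x q"
  have W: "vandermonde_sq (x ` {1..n}) \<noteq> 0" by (rule vandermonde_sq_nonzero) simp
  have fin: "finite ?A" by (rule finite_subset[of _ "Pow {1..n}"]) auto
  have "Delta_roots n k x = (\<Sum>S\<in>?A. (-1) ^ ((k * k - k) div 2) * ?T S)"
    unfolding Delta_roots_def by (intro sum.cong refl) (auto simp: prod_pairs_less finite_subset)
  also have "\<dots> = (-1) ^ ((k * k - k) div 2) * (\<Sum>S\<in>?A. ?T S)"
    by (rule sum_distrib_left[symmetric])
  also have "(\<Sum>S\<in>?A. ?T S) = of_nat (card {S \<in> ?A. ?T S \<noteq> 0}) * vandermonde_sq (x ` {1..n})"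
    by (rule sum_zero_or_const[OF fin]) (use Delta_term(1)[OF _ _ assms] in auto)
  also have "{S \<in> ?A. ?T S \<noteq> 0} = {S. S \<subseteq> {1..n} \<and> card S = k \<and> inj_on x S}"
    using Delta_term(1)[OF _ _ assms] W by (auto split: if_splits)
  finally show ?thesis by (simp add: mult.assoc)
qed

text \<open>With \<open>K\<close> distinct roots, \<open>Delta_roots n K\<close> is up to sign a
  positive integer times a nonzero Vandermonde product, so \<open>K > k\<close> is
  impossible.\<close>

lemma card_roots_le:
  assumes "\<And>l. l \<in> {k<..n} \<Longrightarrow> Delta_roots n l x = 0"
  shows "card (x ` {1..n}) \<le> k"
proof (rule ccontr)
  assume k: "\<not> card (x ` {1..n}) \<le> k"
  let ?K = "card (x ` {1..n})"
  have "?K \<le> n" using card_image_le[of "{1..n}" x] by simp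
  then have 0: "Delta_roots n ?K x = 0" using assms k by simp
  obtain S where S: "S \<subseteq> {1..n}" "x ` S = x ` {1..n}" "inj_on x S"
    using subset_image_inj[of "x ` {1..n}" x "{1..n}"] by auto
  define A where "A = {S. S \<subseteq> {1..n} \<and> card S = ?K \<and> inj_on x S}"
  have "S \<in> A" using S card_image[OF S(3)] by (simp add: A_def)
  moreover have "finite A"
    unfolding A_def by (rule finite_subset[of _ "Pow {1..n}"]) auto
  ultimately have "card A \<noteq> 0" by auto
  moreover have "Delta_roots n ?K x = (-1) ^ ((?K * ?K - ?K) div 2) * of_nat (card A) * vandermonde_sq (x ` {1..n})"
    unfolding A_def by (rule Delta_roots_eq) simp
  ultimately show False
    using 0 vandermonde_sq_nonzero[of "x ` {1..n}"] by simp
qed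

text \<open>
  Lagrange interpolation at the distinct roots with denominators cleared. The sum runs over all
  index tuples, repeated ones contributing zero, so that \<open>interp_kernel\<close> is a polynomial in the
  power sums of the roots. The sign in \<open>(z 0 - z b) * (z b - z 1)\<close> is chosen such that the nonzero
  terms for \<open>z 0 = z 1\<close> equal \<open>vandermonde_sq\<close> of the set of roots.
\<close>
definition interp_term :: "nat \<Rightarrow> (nat \<Rightarrow> complex) \<Rightarrow> complex" where
  "interp_term k z = (\<Prod>b\<in>{2..k}. (z 0 - z b) * (z b - z 1)) * (\<Prod>p\<in>{2..k}. \<Prod>q\<in>{2..k} - {p}. z p - z q)"

text \<open>Variable \<open>0\<close> is the node \<open>u\<close>, variable \<open>1\<close> the
  argument \<open>v\<close>, and the others run through the roots. If there are at most
  \<open>k\<close> distinct roots and \<open>u\<close> is one of them, this is as a function of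
  \<open>v\<close> a (possibly zero) multiple of the Lagrange basis polynomial of the node
  \<open>u\<close>.\<close>

definition interp_kernel :: "nat \<Rightarrow> nat \<Rightarrow> (nat \<Rightarrow> complex) \<Rightarrow> complex \<Rightarrow> complex \<Rightarrow> complex" where
  "interp_kernel n k x u v = (\<Sum>h\<in>{2..k} \<rightarrow>\<^sub>E {1..n}.
     interp_term k (\<lambda>b. if b \<in> {2..k} then x (h b) else ((\<lambda>_. 0)(0 := u, 1 := v)) b))"

context
  fixes n k :: nat and x :: "nat \<Rightarrow> complex"
  assumes k: "1 \<le> k" and card_le: "card (x ` {1..n}) \<le> k"
begin

lemma interp_term_nonzeroD:
  assumes h: "h \<in> {2..k} \<rightarrow>\<^sub>E {1..n}"
    and nz: "interp_term k (\<lambda>b. if b \<in> {2..k} then x (h b) else ((\<lambda>_. 0)(0 := u, 1 := v)) b) \<noteq> 0"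
  shows "inj_on (x \<circ> h) {2..k}" "u \<notin> (x \<circ> h) ` {2..k}" "v \<notin> (x \<circ> h) ` {2..k}"
  using nz unfolding interp_term_def by (auto simp: inj_on_def; metis)+

text \<open>The \<open>k - 1\<close> distinct values of \<open>x \<circ> h\<close> together with
  \<open>u\<close> are \<open>k\<close> distinct roots, hence all of them.\<close>

lemma interp_term_eq:
  assumes h: "h \<in> {2..k} \<rightarrow>\<^sub>E {1..n}" and u: "u \<in> x ` {1..n}"
    and inj: "inj_on (x \<circ> h) {2..k}" "u \<notin> (x \<circ> h) ` {2..k}"
  shows "interp_term k (\<lambda>b. if b \<in> {2..k} then x (h b) else ((\<lambda>_. 0)(0 := u, 1 := u)) b) =
      vandermonde_sq (x ` {1..n})" (is "?T = _")
    and "insert u ((x \<circ> h) ` {2..k}) = x ` {1..n}"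
proof -
  let ?Y = "(x \<circ> h) ` {2..k}"
  have "card ?Y = k - 1" using card_image[OF inj(1)] by simp
  then have "card (insert u ?Y) = k" using inj(2) k by (subst card_insert_disjoint) auto
  moreover have sub: "insert u ?Y \<subseteq> x ` {1..n}" using h u by (auto simp: PiE_def Pi_def)
  ultimately show eq: "insert u ?Y = x ` {1..n}"
    using card_le card_mono[OF _ sub] by (intro card_subset_eq) auto
  have "?T = (\<Prod>b\<in>{2..k}. (u - (x \<circ> h) b) * ((x \<circ> h) b - u)) *
      (\<Prod>p\<in>{2..k}. \<Prod>q\<in>{2..k} - {p}. (x \<circ> h) p - (x \<circ> h) q)"
    unfolding interp_term_def by (intro arg_cong2[where f = "(*)"] prod.cong) auto
  also have "\<dots> = (\<Prod>y\<in>?Y. (u - y) * (y - u)) * vandermonde_sq ?Y"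
    unfolding vandermonde_sq_image[OF inj(1)] prod.reindex[OF inj(1)] by (simp add: o_def)
  also have "\<dots> = vandermonde_sq (insert u ?Y)"
    using inj(2) by (intro vandermonde_sq_insert[symmetric]) auto
  finally show "?T = vandermonde_sq (x ` {1..n})" unfolding eq .
qed

text \<open>A nonzero term needs \<open>k - 1\<close> distinct roots different from \<open>u\<close>
  and from \<open>v\<close>; with \<open>u\<close> they exhaust the roots and leave no place for
  \<open>v\<close>.\<close>

lemma interp_kernel_off_diag:
  assumes "u \<in> x ` {1..n}" "v \<in> x ` {1..n}" "u \<noteq> v"
  shows "interp_kernel n k x u v = 0"
  unfolding interp_kernel_def
proof (intro sum.neutral ballI, rule ccontr)
  fix h assume h: "h \<in> {2..k} \<rightarrow>\<^sub>E {1..n}"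
    and nz: "interp_term k (\<lambda>b. if b \<in> {2..k} then x (h b) else ((\<lambda>_. 0)(0 := u, 1 := v)) b) \<noteq> 0"
  note D = interp_term_nonzeroD[OF h nz]
  show False using interp_term_eq(2)[OF h assms(1) D(1,2)] D(3) assms by (metis insert_iff)
qed

text \<open>The interpolation itself: the kernel removes all indices with a root other than
  \<open>x j\<close>, and on the remaining ones the weight is constant. The sum on the right is the
  denominator that was cleared.\<close>

lemma interp_kernel_weighted_sum:
  assumes "j \<in> {1..n}" "\<And>i. i \<in> {1..n} \<Longrightarrow> x i = x j \<Longrightarrow> w i = w j"
  shows "(\<Sum>i = 1..n. interp_kernel n k x (x j) (x i) * w i) =
    (\<Sum>i = 1..n. interp_kernel n k x (x j) (x i)) * w j"
  unfolding sum_distrib_right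
proof (rule sum.cong[OF refl])
  fix i assume i: "i \<in> {1..n}"
  show "interp_kernel n k x (x j) (x i) * w i = interp_kernel n k x (x j) (x i) * w j"
  proof (cases "x i = x j")
    case True
    then show ?thesis using assms(2)[OF i] by simp
  next
    case False
    have "interp_kernel n k x (x j) (x i) = 0"
      by (rule interp_kernel_off_diag) (use False i assms(1) in auto)
    then show ?thesis by simp
  qed
qed

lemma interp_kernel_diag:
  assumes u: "u \<in> x ` {1..n}"
  shows "interp_kernel n k x u u = of_nat (card {h \<in> {2..k} \<rightarrow>\<^sub>E {1..n}.
     inj_on (x \<circ> h) {2..k} \<and> u \<notin> (x \<circ> h) ` {2..k}}) * vandermonde_sq (x ` {1..n})"
proof -
  let ?T = "\<lambda>h. interp_term k (\<lambda>b. if b \<in> {2..k} then x (h b) else ((\<lambda>_. 0)(0 := u, 1 := u)) b)"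
  have W: "vandermonde_sq (x ` {1..n}) \<noteq> 0" by (rule vandermonde_sq_nonzero) simp
  have "interp_kernel n k x u u = of_nat (card {h \<in> {2..k} \<rightarrow>\<^sub>E {1..n}. ?T h \<noteq> 0}) * vandermonde_sq (x ` {1..n})"
    unfolding interp_kernel_def
  proof (rule sum_zero_or_const)
    show "finite ({2..k} \<rightarrow>\<^sub>E {1..n})" by (intro finite_PiE) auto
    show "?T h = 0 \<or> ?T h = vandermonde_sq (x ` {1..n})" if "h \<in> {2..k} \<rightarrow>\<^sub>E {1..n}" for h
      using interp_term_nonzeroD[OF that, of u u] interp_term_eq(1)[OF that u] by blast
  qed
  also have "{h \<in> {2..k} \<rightarrow>\<^sub>E {1..n}. ?T h \<noteq> 0} =
      {h \<in> {2..k} \<rightarrow>\<^sub>E {1..n}. inj_on (x \<circ> h) {2..k} \<and> u \<notin> (x \<circ> h) ` {2..k}}"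
  proof (intro Collect_cong conj_cong refl iffI conjI)
    fix h assume h: "h \<in> {2..k} \<rightarrow>\<^sub>E {1..n}"
    show "?T h \<noteq> 0" if "inj_on (x \<circ> h) {2..k} \<and> u \<notin> (x \<circ> h) ` {2..k}"
      using interp_term_eq(1)[OF h u] that W by simp
  qed (fact interp_term_nonzeroD)+
  finally show ?thesis .
qed

lemma interp_kernel_sum:
  assumes j: "j \<in> {1..n}"
  shows "(\<Sum>i = 1..n. interp_kernel n k x (x j) (x i)) =
    of_nat (card {i \<in> {1..n}. x i = x j}) * interp_kernel n k x (x j) (x j)"
proof -
  have "(\<Sum>i = 1..n. interp_kernel n k x (x j) (x i)) =
      (\<Sum>i\<in>{i \<in> {1..n}. x i = x j}. interp_kernel n k x (x j) (x i))"
  proof (rule sum.mono_neutral_right)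
    show "\<forall>i\<in>{1..n} - {i \<in> {1..n}. x i = x j}. interp_kernel n k x (x j) (x i) = 0"
      using j by (intro ballI interp_kernel_off_diag) auto
  qed auto
  also have "\<dots> = (\<Sum>i\<in>{i \<in> {1..n}. x i = x j}. interp_kernel n k x (x j) (x j))"
    by (intro sum.cong) auto
  finally show ?thesis by simp
qed

lemma interp_kernel_sum_nonzeroD:
  assumes j: "j \<in> {1..n}" and nz: "(\<Sum>i = 1..n. interp_kernel n k x (x j) (x i)) \<noteq> 0"
  shows "card (x ` {1..n}) = k"
proof -
  define H where "H = {h \<in> {2..k} \<rightarrow>\<^sub>E {1..n}. inj_on (x \<circ> h) {2..k} \<and> x j \<notin> (x \<circ> h) ` {2..k}}"
  have "interp_kernel n k x (x j) (x j) \<noteq> 0" using nz unfolding interp_kernel_sum[OF j] by simp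
  then have "card H \<noteq> 0"
    unfolding interp_kernel_diag[OF imageI[OF j]] H_def[symmetric] by simp
  then have "H \<noteq> {}" by auto
  then obtain h where h: "h \<in> {2..k} \<rightarrow>\<^sub>E {1..n}" "inj_on (x \<circ> h) {2..k}" "x j \<notin> (x \<circ> h) ` {2..k}"
    unfolding H_def by blast
  have "x ` {1..n} = insert (x j) ((x \<circ> h) ` {2..k})"
    by (rule interp_term_eq(2)[OF h(1) _ h(2,3), symmetric]) (use j in simp)
  moreover have "card ((x \<circ> h) ` {2..k}) = k - 1" using card_image[OF h(2)] by simp
  ultimately show ?thesis using h(3) k by (simp only:, subst card_insert_disjoint) auto
qed

text \<open>Both sides are, up to sign, integer multiples of the same Vandermonde product. On the
  left at most \<open>2 ^ n\<close> index sets are counted. On the right at least one tuple is: take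
  an index set with \<open>k\<close> distinct roots and drop the index whose root is
  \<open>x j\<close>.\<close>

lemma norm_Delta_roots_le:
  assumes j: "j \<in> {1..n}"
  shows "norm (Delta_roots n k x) \<le> 2 ^ n * norm (\<Sum>i = 1..n. interp_kernel n k x (x j) (x i))"
proof (cases "Delta_roots n k x = 0")
  case False
  let ?W = "vandermonde_sq (x ` {1..n})"
  let ?A = "{S. S \<subseteq> {1..n} \<and> card S = k \<and> inj_on x S}"
  let ?H = "{h \<in> {2..k} \<rightarrow>\<^sub>E {1..n}. inj_on (x \<circ> h) {2..k} \<and> x j \<notin> (x \<circ> h) ` {2..k}}"
  let ?I = "{i \<in> {1..n}. x i = x j}"
  have "?A \<noteq> {}" using False Delta_roots_eq[OF card_le] by force
  then obtain S where S: "S \<subseteq> {1..n}" "card S = k" "inj_on x S" by blast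
  have im: "x ` S = x ` {1..n}" by (rule Delta_term(2)[OF S(1,2) card_le S(3)])
  then have "x j \<in> x ` S" using j by simp
  then obtain s where s: "s \<in> S" "x s = x j" by auto
  have finS: "finite S" by (rule finite_subset[OF S(1) finite_atLeastAtMost])
  then have "card (S - {s}) = card {2..k}" using S s k by simp
  then obtain g where g: "bij_betw g {2..k} (S - {s})"
    using finS finite_same_card_bij[of "{2..k}" "S - {s}"] by auto
  define h where "h = restrict g {2..k}"
  have hg: "(x \<circ> h) ` {2..k} = x ` (S - {s})"
    using g by (auto simp: h_def bij_betw_def image_image[symmetric] simp flip: image_comp)
  have "inj_on (x \<circ> g) {2..k}"
    using g S(3) by (intro comp_inj_on) (auto simp: bij_betw_def inj_on_diff)
  then have "inj_on (x \<circ> h) {2..k}" by (subst inj_on_cong[of _ _ "x \<circ> g"]) (auto simp: h_def)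
  moreover have "x j \<notin> (x \<circ> h) ` {2..k}"
    unfolding hg using s S(3) by (auto simp: inj_on_def simp flip: s(2))
  moreover have "h \<in> {2..k} \<rightarrow>\<^sub>E {1..n}"
    using g S(1) by (auto simp: h_def bij_betw_def)
  ultimately have "h \<in> ?H" by blast
  moreover have "finite ?H"
    by (rule finite_subset[of _ "{2..k} \<rightarrow>\<^sub>E {1..n}"]) (auto intro: finite_PiE)
  ultimately have H: "1 \<le> card ?H" using card_gt_0_iff[of ?H] by (auto simp: Suc_le_eq)
  have I: "1 \<le> card ?I" using j by (auto simp: Suc_le_eq card_gt_0_iff)
  have HI: "1 \<le> card ?I * card ?H" using mult_le_mono[OF I H] by simp
  have "card ?A \<le> card (Pow {1..n})" by (intro card_mono) auto
  then have "real (card ?A) \<le> real (2 ^ n)" by (intro of_nat_mono) (simp add: card_Pow)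
  then have A: "real (card ?A) \<le> 2 ^ n" by simp
  have "norm (Delta_roots n k x) = real (card ?A) * norm ?W"
    by (simp add: Delta_roots_eq[OF card_le] norm_mult norm_power)
  also have "\<dots> \<le> 2 ^ n * norm ?W"
    by (rule mult_right_mono[OF A norm_ge_zero])
  also have "1 * norm ?W \<le> real (card ?I * card ?H) * norm ?W"
    using HI by (intro mult_right_mono norm_ge_zero) linarith
  then have "2 ^ n * norm ?W \<le> 2 ^ n * (real (card ?I * card ?H) * norm ?W)"
    by (simp only: mult_1) (rule mult_left_mono, simp_all)
  also have "real (card ?I * card ?H) * norm ?W = norm (\<Sum>i = 1..n. interp_kernel n k x (x j) (x i))"
    unfolding interp_kernel_sum[OF j] interp_kernel_diag[OF imageI[OF j]]
    by (simp only: norm_mult norm_of_nat mult.assoc of_nat_mult)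
  finally show ?thesis .
qed simp

end

section \<open>Differentiability of roots of constant multiplicity\<close>

lemma has_vector_derivative_quotient:
  fixes f :: "real \<Rightarrow> complex"
  shows "(f has_vector_derivative d) (at s) \<longleftrightarrow> ((\<lambda>t. (f t - f s) / of_real (t - s)) \<longlongrightarrow> d) (at s)"
proof -
  have "norm (f t - f s - (t - s) *\<^sub>R d) / norm (t - s) = norm ((f t - f s) / of_real (t - s) - d)"
    if "t \<noteq> s" for t
  proof -
    have "f t - f s - (t - s) *\<^sub>R d = ((f t - f s) / of_real (t - s) - d) * of_real (t - s)"
      using that by (simp add: field_simps scaleR_conv_of_real)
    then show ?thesis using that by (simp add: norm_mult flip: of_real_diff)
  qed
  then have ev: "\<forall>\<^sub>F t in at s. norm (f t - f s - (t - s) *\<^sub>R d) / norm (t - s) = norm ((f t - f s) / of_real (t - s) - d)"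
    by (auto simp: eventually_at_filter)
  have "(f has_vector_derivative d) (at s) \<longleftrightarrow>
      ((\<lambda>t. norm (f t - f s - (t - s) *\<^sub>R d) / norm (t - s)) \<longlongrightarrow> 0) (at s)"
    unfolding has_vector_derivative_def has_derivative_iff_norm
    by (simp add: bounded_linear_scaleR_left)
  also have "\<dots> \<longleftrightarrow> ((\<lambda>t. norm ((f t - f s) / of_real (t - s) - d)) \<longlongrightarrow> 0) (at s)"
    by (rule tendsto_cong[OF ev])
  also have "\<dots> \<longleftrightarrow> ((\<lambda>t. (f t - f s) / of_real (t - s)) \<longlongrightarrow> d) (at s)"
    by (simp only: tendsto_norm_zero_iff LIM_zero_iff)
  finally show ?thesis .
qed

text \<open>On \<open>N\<close> the function \<open>g\<close> factors through \<open>f\<close>; the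
  induced surjection between finite sets of equal size is injective.\<close>

lemma eq_iff_of_card_image_eq:
  assumes "finite N" "\<And>i j. i \<in> N \<Longrightarrow> j \<in> N \<Longrightarrow> f i = f j \<Longrightarrow> g i = g j"
    and "card (f ` N) = card (g ` N)" "i \<in> N" "j \<in> N"
  shows "f i = f j \<longleftrightarrow> g i = g j"
proof -
  define h where "h v = g (inv_into N f v)" for v
  have h: "h (f i) = g i" if "i \<in> N" for i
  proof -
    have "inv_into N f (f i) \<in> N" "f (inv_into N f (f i)) = f i"
      using that by (simp_all add: inv_into_into f_inv_into_f)
    then show ?thesis unfolding h_def using assms(2) that by blast
  qed
  then have "h ` f ` N = g ` N" by (simp add: image_image)
  then have "inj_on h (f ` N)"
    using assms(1,3) by (intro eq_card_imp_inj_on) simp_all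
  then show ?thesis using h assms(2,4,5) by (metis image_eqI inj_onD)
qed

lemma order_higher_pderiv:
  fixes p :: "complex poly"
  assumes "p \<noteq> 0" "i \<le> order a p"
  shows "(pderiv ^^ i) p \<noteq> 0 \<and> order a ((pderiv ^^ i) p) = order a p - i"
  using assms(2)
proof (induction i)
  case (Suc i)
  let ?q = "(pderiv ^^ i) p"
  have q: "?q \<noteq> 0" "order a ?q = order a p - i" using Suc by simp_all
  then have root: "poly ?q a = 0" using Suc.prems order_root[of ?q a] by simp
  have "pderiv ?q \<noteq> 0"
  proof
    assume "pderiv ?q = 0"
    then obtain c where "?q = [:c:]" using pderiv_eq_0_iff degree_eq_zeroE by metis
    then show False using root q(1) by simp
  qed
  moreover have "order a ?q = Suc (order a (pderiv ?q))" by (rule order_pderiv[OF q(1) root])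
  ultimately show ?case using q by simp
qed (use assms in simp)

lemma root_tuple_order:
  assumes "root_tuple n p r"
  shows "order a p = card {i \<in> {1..n}. r i = a}"
proof -
  have "p \<noteq> 0" unfolding root_tuple_poly_eq[OF assms] by auto
  then have "order a p = count (image_mset r (mset_set {1..n})) a"
    using root_tuple_proots[OF assms] by (metis count_proots)
  also have "\<dots> = card {i \<in> {1..n}. r i = a}"
    by (simp add: count_image_mset Int_def vimage_def conj_commute)
  finally show ?thesis .
qed

context
  fixes U :: "real set" and n k :: nat and P :: "real \<Rightarrow> complex poly"
    and lam :: "nat \<Rightarrow> real \<Rightarrow> complex" and s :: real
  assumes U: "open U" "s \<in> U"
    and cont: "\<And>j. j \<in> {1..n} \<Longrightarrow> continuous_on U (lam j)"
    and roots: "\<And>t. t \<in> U \<Longrightarrow> root_tuple n (P t) (\<lambda>j. lam j t)"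
    and card_eq: "\<And>t. t \<in> U \<Longrightarrow> card ((\<lambda>j. lam j t) ` {1..n}) = k"
begin

text \<open>By continuity, distinct roots at \<open>s\<close> stay distinct nearby. Since the number
  of distinct roots is constant, coinciding roots cannot split either.\<close>

lemma eventually_eq_iff:
  "\<forall>\<^sub>F t in nhds s. \<forall>i\<in>{1..n}. \<forall>j\<in>{1..n}. lam i t = lam j t \<longleftrightarrow> lam i s = lam j s"
proof -
  have tend: "(lam j \<longlongrightarrow> lam j s) (nhds s)" if "j \<in> {1..n}" for j
  proof -
    have "isCont (lam j) s" using cont[OF that] U by (simp add: continuous_on_eq_continuous_at)
    then show ?thesis by (simp add: isCont_def flip: tendsto_at_iff_tendsto_nhds)
  qed
  have "\<forall>\<^sub>F t in nhds s. \<forall>i\<in>{1..n}. \<forall>j\<in>{1..n}. lam i s \<noteq> lam j s \<longrightarrow> lam i t \<noteq> lam j t"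
  proof (intro eventually_ball_finite ballI finite_atLeastAtMost)
    fix i j assume ij: "i \<in> {1..n}" "j \<in> {1..n}"
    show "\<forall>\<^sub>F t in nhds s. lam i s \<noteq> lam j s \<longrightarrow> lam i t \<noteq> lam j t"
    proof (cases "lam i s = lam j s")
      case False
      have "((\<lambda>t. lam i t - lam j t) \<longlongrightarrow> lam i s - lam j s) (nhds s)"
        by (intro tendsto_diff tend ij)
      then have "\<forall>\<^sub>F t in nhds s. lam i t - lam j t \<noteq> 0"
        using False by (intro tendsto_imp_eventually_ne) auto
      then show ?thesis by eventually_elim auto
    qed simp
  qed
  moreover have "\<forall>\<^sub>F t in nhds s. t \<in> U" using U by (intro eventually_nhds_in_open)
  ultimately show ?thesis
  proof eventually_elim
    case (elim t)
    show ?case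
    proof (intro ballI)
      fix i j assume ij: "i \<in> {1..n}" "j \<in> {1..n}"
      show "lam i t = lam j t \<longleftrightarrow> lam i s = lam j s"
      proof (rule eq_iff_of_card_image_eq[where N = "{1..n}" and f = "\<lambda>j. lam j t" and g = "\<lambda>j. lam j s"])
        show "card ((\<lambda>j. lam j t) ` {1..n}) = card ((\<lambda>j. lam j s) ` {1..n})"
          unfolding card_eq[OF elim(2)] card_eq[OF U(2)] ..
        show "lam p s = lam q s" if "p \<in> {1..n}" "q \<in> {1..n}" "lam p t = lam q t" for p q
          using elim(1) that by blast
      qed (use ij in auto)
    qed
  qed
qed

text \<open>A root of locally constant multiplicity \<open>m\<close> is a simple root of the
  derivative of order \<open>m - 1\<close> of the polynomial. At a simple root the implicit function
  argument goes through with coefficients differentiable at the single point \<open>s\<close>,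
  because \<open>lam j\<close> is known to be continuous.\<close>

lemma root_has_vector_derivative:
  assumes coeffs: "\<And>i. \<exists>d. ((\<lambda>t. coeff (P t) i) has_vector_derivative d) (at s)"
    and j: "j \<in> {1..n}"
  shows "\<exists>d. (lam j has_vector_derivative d) (at s)"
proof -
  have tend: "(lam j \<longlongrightarrow> lam j s) (at s)"
    using cont[OF j] U by (simp add: continuous_on_eq_continuous_at isCont_def)
  define m where "m = card {i \<in> {1..n}. lam i s = lam j s}"
  have "{i \<in> {1..n}. lam i s = lam j s} \<noteq> {}" using j by blast
  then have m: "m \<ge> 1" by (simp add: m_def Suc_le_eq card_gt_0_iff)
  define Q where "Q t = (pderiv ^^ (m - 1)) (P t)" for t
  have coeffQ: "\<exists>d. ((\<lambda>t. coeff (Q t) i) has_vector_derivative d) (at s)" for i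
  proof -
    obtain d where "((\<lambda>t. coeff (P t) (i + (m - 1))) has_vector_derivative d) (at s)"
      using coeffs by blast
    then show ?thesis
      unfolding Q_def coeff_higher_pderiv by (intro exI, rule has_vector_derivative_mult_right)
  qed
  then obtain d where d: "((\<lambda>t. coeff (Q t) i) has_vector_derivative d i) (at s)" for i
    by metis
  have evU: "\<forall>\<^sub>F t in nhds s. t \<in> U" using U by (intro eventually_nhds_in_open)
  have nz: "P t \<noteq> 0" if "t \<in> U" for t
    unfolding root_tuple_poly_eq[OF roots[OF that]] by auto
  have "\<forall>\<^sub>F t in nhds s. order (lam j t) (P t) = m \<and> t \<in> U"
    using eventually_eq_iff evU
  proof eventually_elim
    case (elim t)
    then have "{i \<in> {1..n}. lam i t = lam j t} = {i \<in> {1..n}. lam i s = lam j s}"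
      using j by blast
    then show ?case using elim root_tuple_order[OF roots[of t], of "lam j t"] by (simp add: m_def)
  qed
  then have ev: "\<forall>\<^sub>F t in nhds s. poly (Q t) (lam j t) = 0"
  proof eventually_elim
    case (elim t)
    have "order (lam j t) (Q t) = 1"
      using order_higher_pderiv[OF nz[of t], of "m - 1" "lam j t"] elim m unfolding Q_def by auto
    then show ?case by (metis order_root zero_neq_one)
  qed
  have Qs: "poly (Q s) (lam j s) = 0" using eventually_nhds_x_imp_x[OF ev] .
  have ordP: "order (lam j s) (P s) = m"
    using root_tuple_order[OF roots[OF U(2)], of "lam j s"] by (simp add: m_def)
  have "order (lam j s) ((pderiv ^^ m) (P s)) = 0" "(pderiv ^^ m) (P s) \<noteq> 0"
    using order_higher_pderiv[OF nz[OF U(2)], of m "lam j s"] ordP by simp_all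
  moreover have "(pderiv ^^ m) (P s) = pderiv (Q s)"
    unfolding Q_def using m by (metis funpow.simps(2) comp_apply Suc_diff_1 less_le_trans zero_less_one)
  ultimately have der: "poly (pderiv (Q s)) (lam j s) \<noteq> 0" using order_root by metis
  obtain S where S: "Q s = [:- lam j s, 1:] * S"
    using Qs poly_eq_0_iff_dvd by (blast elim: dvdE)
  have S0: "poly S (lam j s) \<noteq> 0"
    using der unfolding S pderiv_mult by (simp add: pderiv_pCons)
  have tendS: "((\<lambda>t. poly S (lam j t)) \<longlongrightarrow> poly S (lam j s)) (at s)"
    by (intro tendsto_intros tend)
  have deg: "degree (Q t) \<le> n" if "t \<in> U" for t
    unfolding Q_def degree_higher_pderiv root_tuple_degree[OF roots[OF that]] by simp
  \<comment> \<open>From \<open>poly (Q t) (lam j t) = 0\<close>, the difference of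
    \<open>Q t\<close> and \<open>Q s\<close> at \<open>lam j t\<close> is
    \<open>- (lam j t - lam j s) * poly S (lam j t)\<close>. Division by \<open>t - s\<close>
    expresses the difference quotient of the root through those of the coefficients.\<close>
  have "((\<lambda>t. - (\<Sum>i\<le>n. (coeff (Q t) i - coeff (Q s) i) / of_real (t - s) * lam j t ^ i) / poly S (lam j t))
      \<longlongrightarrow> - (\<Sum>i\<le>n. d i * lam j s ^ i) / poly S (lam j s)) (at s)"
    using d unfolding has_vector_derivative_quotient
    by (intro tendsto_intros tend tendS S0)
  moreover have "\<forall>\<^sub>F t in at s. - (\<Sum>i\<le>n. (coeff (Q t) i - coeff (Q s) i) / of_real (t - s) * lam j t ^ i) / poly S (lam j t)
      = (lam j t - lam j s) / of_real (t - s)"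
    using tendsto_imp_eventually_ne[OF tendS S0] filter_leD[OF at_within_le_nhds ev]
      filter_leD[OF at_within_le_nhds evU] eventually_neq_at_within[of s s UNIV]
  proof eventually_elim
    case (elim t)
    have p: "poly (Q u) z = (\<Sum>i\<le>n. coeff (Q u) i * z ^ i)" if "u \<in> U" for u z
      by (subst poly_as_sum_of_monoms'[OF deg[OF that], symmetric]) (simp add: poly_sum poly_monom)
    have "(\<Sum>i\<le>n. (coeff (Q t) i - coeff (Q s) i) / of_real (t - s) * lam j t ^ i) =
        (poly (Q t) (lam j t) - poly (Q s) (lam j t)) / of_real (t - s)"
      unfolding p[OF elim(3)] p[OF U(2)] sum_subtractf[symmetric] sum_divide_distrib
      by (intro sum.cong) (simp_all add: field_simps)
    also have "\<dots> = - ((lam j t - lam j s) * poly S (lam j t)) / of_real (t - s)"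
    proof -
      have "poly (Q s) (lam j t) = (lam j t - lam j s) * poly S (lam j t)"
        unfolding S by (simp add: algebra_simps)
      then show ?thesis using elim(2) by simp
    qed
    finally show ?case using elim(1) by simp
  qed
  ultimately show ?thesis
    unfolding has_vector_derivative_quotient by (blast intro: Lim_transform_eventually)
qed

end

section \<open>One-sided bounds for the derivatives\<close>

lemma finite_separated:
  fixes Z :: "complex set"
  assumes "finite Z"
  obtains r where "r > 0" "\<And>z w. z \<in> Z \<Longrightarrow> w \<in> Z \<Longrightarrow> z \<noteq> w \<Longrightarrow> 2 * r \<le> dist z w"
proof -
  define P where "P = insert 1 ((\<lambda>(z, w). dist z w) ` {(z, w). z \<in> Z \<and> w \<in> Z \<and> z \<noteq> w})"
  have "finite {(z, w). z \<in> Z \<and> w \<in> Z \<and> z \<noteq> w}"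
    by (rule finite_subset[of _ "Z \<times> Z"]) (use assms in auto)
  then have P: "finite P" "P \<noteq> {}" unfolding P_def by auto
  then have "Min P \<in> P" by (rule Min_in)
  then have "Min P > 0" unfolding P_def by auto
  moreover have "Min P \<le> dist z w" if "z \<in> Z" "w \<in> Z" "z \<noteq> w" for z w
    using that P by (intro Min_le) (auto simp: P_def intro!: image_eqI[of _ _ "(z, w)"])
  ultimately show ?thesis by (intro that[of "Min P / 2"]) auto
qed

text \<open>
  A continuous root stays near one root of the limit polynomial, since the image of
  \<open>(0, \<delta>)\<close> is connected.
\<close>
lemma continuous_root_converges:
  fixes y :: "nat \<Rightarrow> real \<Rightarrow> complex"
  assumes e: "\<epsilon> > 0" and j: "j \<in> {1..n}" and cont: "continuous_on {0<..<\<epsilon>} (y j)"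
    and lim: "\<And>m. m \<le> n \<Longrightarrow> ((\<lambda>t. vieta n (\<lambda>i. y i t) m) \<longlongrightarrow> \<sigma> m) (at_right 0)"
  shows "\<exists>\<eta>. (y j \<longlongrightarrow> \<eta>) (at_right 0)"
proof -
  define q where "q = (\<Sum>m\<le>n. monom (\<sigma> m) (n - m))"
  have poly_q: "poly q z = (\<Sum>m\<le>n. \<sigma> m * z ^ (n - m))" for z
    by (simp add: q_def poly_sum poly_monom)
  have "((\<lambda>t. vieta n (\<lambda>i. y i t) 0) \<longlongrightarrow> 1) (at_right (0::real))" by (simp add: vieta_0)
  then have "\<sigma> 0 = 1" using lim[of 0] tendsto_unique trivial_limit_at_right_real by blast
  moreover have "coeff q n = (\<Sum>m\<le>n. if m = 0 then \<sigma> m else 0)"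
    unfolding q_def coeff_sum coeff_monom by (intro sum.cong) (use j in auto)
  ultimately have "q \<noteq> 0" by auto
  define Z where "Z = {z. poly q z = 0}"
  have finZ: "finite Z" unfolding Z_def by (rule poly_roots_finite[OF \<open>q \<noteq> 0\<close>])
  define B where "B = 1 + (\<Sum>m = 1..n. norm (\<sigma> m) + 1)"
  have "\<forall>\<^sub>F t in at_right 0. \<forall>m\<in>{1..n}. norm (vieta n (\<lambda>i. y i t) m) < norm (\<sigma> m) + 1"
    using lim by (intro eventually_ball_finite ballI order_tendstoD(2)[OF tendsto_norm]) auto
  then have evB: "\<forall>\<^sub>F t in at_right 0. norm (y j t) \<le> B"
  proof eventually_elim
    case (elim t)
    have "norm (y j t) \<le> 1 + (\<Sum>m = 1..n. norm (vieta n (\<lambda>i. y i t) m))"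
      by (rule norm_root_le[OF j])
    also have "\<dots> \<le> B" unfolding B_def using elim by (intro add_left_mono sum_mono) (auto intro: less_imp_le)
    finally show ?case .
  qed
  have small: "((\<lambda>t. poly q (y j t)) \<longlongrightarrow> 0) (at_right 0)"
  proof (rule Lim_null_comparison)
    show "((\<lambda>t. \<Sum>m\<le>n. norm (\<sigma> m - vieta n (\<lambda>i. y i t) m) * B ^ (n - m)) \<longlongrightarrow> 0) (at_right 0)"
    proof (intro tendsto_null_sum)
      fix m assume "m \<in> {..n}"
      then have "((\<lambda>t. norm (\<sigma> m - vieta n (\<lambda>i. y i t) m) * B ^ (n - m)) \<longlongrightarrow> norm (\<sigma> m - \<sigma> m) * B ^ (n - m)) (at_right 0)"
        by (intro tendsto_intros lim) auto
      then show "((\<lambda>t. norm (\<sigma> m - vieta n (\<lambda>i. y i t) m) * B ^ (n - m)) \<longlongrightarrow> 0) (at_right 0)" by simp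
    qed
    show "\<forall>\<^sub>F t in at_right 0. norm (poly q (y j t)) \<le> (\<Sum>m\<le>n. norm (\<sigma> m - vieta n (\<lambda>i. y i t) m) * B ^ (n - m))"
      using evB
    proof eventually_elim
      case (elim t)
      have "poly q (y j t) = (\<Sum>m\<le>n. (\<sigma> m - vieta n (\<lambda>i. y i t) m) * y j t ^ (n - m))"
        using vieta_root[OF j, of "\<lambda>i. y i t"] by (simp add: poly_q left_diff_distrib sum_subtractf)
      also have "norm \<dots> \<le> (\<Sum>m\<le>n. norm (\<sigma> m - vieta n (\<lambda>i. y i t) m) * B ^ (n - m))"
        using elim by (intro sum_norm_le) (auto simp: norm_mult norm_power intro!: mult_left_mono power_mono)
      finally show ?case .
    qed
  qed
  \<comment> \<open>Removing discs about the zeros of \<open>q\<close> from the ball of radius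
    \<open>B\<close> leaves a compact set; if it is nonempty, the modulus of \<open>q\<close> has a
    positive minimum there, which \<open>small\<close> eventually undercuts.\<close>
  have near: "\<forall>\<^sub>F t in at_right 0. \<exists>z\<in>Z. dist z (y j t) < r" if r: "r > 0" for r
  proof (cases "cball 0 B - (\<Union>z\<in>Z. ball z r) = {}")
    case True
    show ?thesis using evB
    proof eventually_elim
      case (elim t)
      then have "y j t \<in> cball 0 B" by simp
      then have "y j t \<in> (\<Union>z\<in>Z. ball z r)" using True by blast
      then show ?case by auto
    qed
  next
    case False
    define A where "A = cball 0 B - (\<Union>z\<in>Z. ball z r)"
    have "compact A" unfolding A_def by (intro compact_diff compact_cball open_UN) auto
    moreover have "continuous_on A (\<lambda>v. norm (poly q v))" by (intro continuous_intros)
    moreover have "A \<noteq> {}" unfolding A_def by (rule False)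
    ultimately obtain w where w: "w \<in> A" "\<And>v. v \<in> A \<Longrightarrow> norm (poly q w) \<le> norm (poly q v)"
      using continuous_attains_inf[of A "\<lambda>v. norm (poly q v)"] by blast
    have "w \<notin> Z" using w(1) r unfolding A_def by auto
    then have "0 < norm (poly q w)" by (simp add: Z_def)
    then have "\<forall>\<^sub>F t in at_right 0. norm (poly q (y j t)) < norm (poly q w)"
      using small by (intro order_tendstoD(2)[OF tendsto_norm_zero]) auto
    then show ?thesis using evB
    proof eventually_elim
      case (elim t)
      then have "y j t \<notin> A" using w(2)[of "y j t"] by auto
      then show ?case using elim(2) unfolding A_def by auto
    qed
  qed
  obtain r0 where r0: "r0 > 0" "\<And>z w. z \<in> Z \<Longrightarrow> w \<in> Z \<Longrightarrow> z \<noteq> w \<Longrightarrow> 2 * r0 \<le> dist z w"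
    using finite_separated[OF finZ] by blast
  obtain d where d: "d > 0" "\<And>t. 0 < t \<Longrightarrow> t < d \<Longrightarrow> \<exists>z\<in>Z. dist z (y j t) < r0"
    using near[OF r0(1)] unfolding eventually_at_right_field by blast
  define \<delta> where "\<delta> = min d \<epsilon>"
  have \<delta>: "\<delta> > 0" "\<delta> \<le> d" "\<delta> \<le> \<epsilon>" using d e by (auto simp: \<delta>_def)
  obtain z0 where z0: "z0 \<in> Z" "dist z0 (y j (\<delta> / 2)) < r0" using d(2)[of "\<delta> / 2"] \<delta> by auto
  have "connected (y j ` {0<..<\<delta>})"
    by (intro connected_continuous_image continuous_on_subset[OF cont]) (use \<delta> in auto)
  moreover have disj: "ball z0 r0 \<inter> (\<Union>z\<in>Z - {z0}. ball z r0) = {}"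
  proof (rule equals0I)
    fix v assume "v \<in> ball z0 r0 \<inter> (\<Union>z\<in>Z - {z0}. ball z r0)"
    then have v: "dist z0 v < r0" "\<exists>z\<in>Z - {z0}. dist z v < r0" by auto
    then obtain z where "dist z v < r0" "z \<in> Z" "z \<noteq> z0" by blast
    then show False using v(1) r0(2)[OF z0(1), of z] dist_triangle2[of z0 z v] by auto
  qed
  moreover have "y j ` {0<..<\<delta>} \<subseteq> ball z0 r0 \<union> (\<Union>z\<in>Z - {z0}. ball z r0)"
    using d(2) \<delta> by fastforce
  moreover have "ball z0 r0 \<inter> y j ` {0<..<\<delta>} \<noteq> {}" using z0(2) \<delta>(1) by auto
  ultimately have no: "(\<Union>z\<in>Z - {z0}. ball z r0) \<inter> y j ` {0<..<\<delta>} = {}"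
    using connectedD[of "y j ` {0<..<\<delta>}" "ball z0 r0" "\<Union>z\<in>Z - {z0}. ball z r0"] by blast
  have "(y j \<longlongrightarrow> z0) (at_right 0)"
  proof (rule tendstoI)
    fix r :: real assume "r > 0"
    then have "\<forall>\<^sub>F t in at_right 0. \<exists>z\<in>Z. dist z (y j t) < min r r0" using r0(1) by (intro near) simp
    moreover have "\<forall>\<^sub>F t in at_right 0. t \<in> {0<..<\<delta>}" using \<delta>(1) by (rule eventually_at_right_real)
    ultimately show "\<forall>\<^sub>F t in at_right 0. dist (y j t) z0 < r"
    proof eventually_elim
      case (elim t)
      then obtain z where z: "z \<in> Z" "dist z (y j t) < min r r0" by blast
      then have "z = z0" using no elim(2) by (auto simp: disjoint_iff)
      then show ?case using z by (simp add: dist_commute)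
    qed
  qed
  then show ?thesis ..
qed

text \<open>Projecting onto the direction of \<open>c\<close> turns the derivative into a real
  function above a positive multiple of \<open>1 / t\<close>, so cancellation is excluded. Its
  primitive then diverges at least logarithmically at 0, which settles the borderline
  \<open>q = 1\<close> too.\<close>

lemma unbounded_of_derivative:
  fixes f g :: "real \<Rightarrow> complex"
  assumes e: "\<epsilon> > 0"
    and der: "\<And>t. t \<in> {0<..<\<epsilon>} \<Longrightarrow> (f has_vector_derivative g t) (at t)"
    and bd: "\<And>t. t \<in> {0<..<\<epsilon>} \<Longrightarrow> norm (f t) \<le> K"
    and lim: "((\<lambda>t. g t * of_real (t powr q)) \<longlongrightarrow> c) (at_right 0)" and q: "1 \<le> q"
  shows "c = 0"
proof (rule ccontr)
  assume c: "c \<noteq> 0"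
  \<comment> \<open>Half the limit of \<open>Re (g t * of_real (t powr q) * cnj c)\<close>, so that
    this quantity eventually exceeds it.\<close>
  define \<kappa> where "\<kappa> = (norm c)\<^sup>2 / 2"
  have \<kappa>: "\<kappa> > 0" using c by (simp add: \<kappa>_def)
  have "((\<lambda>t. Re (g t * of_real (t powr q) * cnj c)) \<longlongrightarrow> Re (c * cnj c)) (at_right 0)"
    by (intro tendsto_intros lim)
  moreover have "Re (c * cnj c) > \<kappa>" using \<kappa> by (simp add: \<kappa>_def complex_mult_cnj cmod_power2)
  ultimately have "\<forall>\<^sub>F t in at_right 0. \<kappa> < Re (g t * of_real (t powr q) * cnj c)"
    by (rule order_tendstoD(1))
  then obtain d where d: "d > 0" "\<And>t. 0 < t \<Longrightarrow> t < d \<Longrightarrow> \<kappa> < Re (g t * of_real (t powr q) * cnj c)"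
    unfolding eventually_at_right_field by blast
  \<comment> \<open>The cut at 1 serves \<open>x powr q \<le> x\<close>; halving makes all three
    upper bounds strict.\<close>
  define \<delta> where "\<delta> = min (min d \<epsilon>) 1 / 2"
  have \<delta>: "\<delta> > 0" "\<delta> < d" "\<delta> < \<epsilon>" "\<delta> < 1" using d e by (auto simp: \<delta>_def)
  define \<psi> where "\<psi> t = Re (f t * cnj c) - \<kappa> * ln t" for t
  have mono: "\<psi> t \<le> \<psi> \<delta>" if t: "0 < t" "t \<le> \<delta>" for t
  proof (rule DERIV_nonneg_imp_nondecreasing[OF t(2)])
    fix x assume x: "t \<le> x" "x \<le> \<delta>"
    then have x': "x \<in> {0<..<\<epsilon>}" "0 < x" "x < d" "x < 1" using t \<delta> by auto
    have "((\<lambda>t. Re (f t * cnj c)) has_real_derivative Re (g x * cnj c)) (at x)"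
      unfolding has_real_derivative_iff_has_vector_derivative
      by (rule bounded_linear.has_vector_derivative[OF bounded_linear_Re])
        (rule has_vector_derivative_mult_left[OF der[OF x'(1)]])
    then have D: "(\<psi> has_real_derivative Re (g x * cnj c) - \<kappa> * (1 / x)) (at x)"
      unfolding \<psi>_def using x'
      by (intro DERIV_diff DERIV_cmult) (auto intro!: derivative_eq_intros)
    have "\<kappa> < Re (g x * cnj c) * x powr q" using d(2)[OF x'(2,3)] by (simp add: algebra_simps)
    moreover have "x powr q \<le> x powr 1" using x' q by (intro powr_mono') auto
    ultimately have "\<kappa> < Re (g x * cnj c) * x"
    proof -
      assume *: "\<kappa> < Re (g x * cnj c) * x powr q" "x powr q \<le> x powr 1"
      then have "0 < Re (g x * cnj c) * x powr q" using \<kappa> by linarith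
      then have "0 < Re (g x * cnj c)" using x' by (simp add: zero_less_mult_iff)
      then have "Re (g x * cnj c) * x powr q \<le> Re (g x * cnj c) * x"
        using * x' by (intro mult_left_mono) auto
      then show ?thesis using * by linarith
    qed
    then have "0 \<le> Re (g x * cnj c) - \<kappa> * (1 / x)" using x' by (simp add: field_simps)
    then show "\<exists>z. (\<psi> has_real_derivative z) (at x) \<and> 0 \<le> z" using D by blast
  qed
  have "filterlim ln at_bot (at_right (0::real))" by (rule ln_at_0)
  then have "\<forall>\<^sub>F t in at_right 0. ln t < (- K * norm c - \<psi> \<delta>) / \<kappa>"
    by (simp add: filterlim_at_bot_dense)
  moreover have "\<forall>\<^sub>F t in at_right 0. t \<in> {0<..<\<delta>}" using \<delta>(1) by (rule eventually_at_right_real)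
  ultimately have "\<forall>\<^sub>F t in at_right (0::real). False"
  proof eventually_elim
    case (elim t)
    have "\<bar>Re (f t * cnj c)\<bar> \<le> norm (f t) * norm c" by (metis abs_Re_le_cmod complex_mod_cnj norm_mult)
    also have "\<dots> \<le> K * norm c" using bd[of t] elim \<delta> by (intro mult_right_mono) auto
    finally have "- K * norm c \<le> Re (f t * cnj c)" by linarith
    moreover have "\<psi> t \<le> \<psi> \<delta>" using elim by (intro mono) auto
    ultimately have "- K * norm c - \<psi> \<delta> \<le> \<kappa> * ln t" unfolding \<psi>_def[of t] by linarith
    then show ?case using elim(1) \<kappa> by (simp add: pos_less_divide_eq mult.commute)
  qed
  then show False using trivial_limit_at_right_real eventually_False by blast
qed

lemma at_right_eq_at_within:
  fixes \<epsilon> :: real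
  assumes "\<epsilon> > 0"
  shows "at 0 within {0<..<\<epsilon>} = at_right 0"
  by (rule at_within_nhd[of _ "{..<\<epsilon>}"]) (use assms in auto)

text \<open>
  If not all coefficients are small, rescale by \<open>t powr (- \<rho>)\<close>, where \<open>\<rho> \<le> p\<close> is the least slope of
  the Newton polygon. Then all \<open>u j\<close> converge, not all of them to zero, so some derivative grows at
  least like \<open>1 / t\<close>, and its primitive is unbounded.
\<close>
lemma one_sided_estimate:
  fixes u lam :: "nat \<Rightarrow> real \<Rightarrow> complex" and D :: "real \<Rightarrow> complex"
  assumes e: "\<epsilon> > 0"
    and coeffs: "\<And>m. m \<in> {1..n} \<Longrightarrow> (\<lambda>t. vieta n (\<lambda>i. u i t) m) \<in> asymp_alg {0<..<\<epsilon>} 0"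
    and cont: "\<And>j. j \<in> {1..n} \<Longrightarrow> continuous_on {0<..<\<epsilon>} (u j)"
    and D: "((\<lambda>t. D t / of_real t ^ p) \<longlongrightarrow> d) (at_right 0)" "d \<noteq> 0"
    and der: "\<And>j t. j \<in> {1..n} \<Longrightarrow> t \<in> {0<..<\<epsilon>} \<Longrightarrow>
      (lam j has_vector_derivative u j t / (of_real t * D t)) (at t)"
    and bd: "\<And>j t. j \<in> {1..n} \<Longrightarrow> t \<in> {0<..<\<epsilon>} \<Longrightarrow> norm (lam j t) \<le> K"
  shows "\<exists>\<gamma>>0. \<exists>C\<ge>0. \<forall>\<^sub>F t in at_right 0. \<forall>j\<in>{1..n}.
    norm (u j t / (of_real t * D t)) \<le> C * t powr (\<gamma> - 1)"
proof -
  let ?F = "at_right (0::real)"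
  have F: "at 0 within {0<..<\<epsilon>} = ?F" using e by (rule at_right_eq_at_within)
  let ?e = "\<lambda>m t. vieta n (\<lambda>i. u i t) m"
  have pos: "\<forall>\<^sub>F t in ?F. 0 < t" "\<forall>\<^sub>F t in ?F. t < 1"
    using eventually_at_right_real[of 0 1] by (auto elim: eventually_mono)
  \<comment> \<open>Roots \<open>u j\<close> of order exactly \<open>p\<close> correspond to
    derivatives of size \<open>1 / t\<close>, and \<open>m * p\<close> is the corresponding order of
    the \<open>m\<close>-th coefficient. Orders being integers, a coefficient beyond that borderline
    is small to order \<open>m * p + 1\<close>.\<close>
  define J where "J = {m \<in> {1..n}. ?e m \<notin> O[?F](\<lambda>t. of_real t ^ (m * p + 1))}"
  show ?thesis
  proof (cases "J = {} \<or> n = 0")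
    case True
    show ?thesis
    proof (cases "n = 0")
      case False
      then have n: "n \<ge> 1" and J: "J = {}" using True by auto
      have "\<exists>c. \<forall>\<^sub>F t in ?F. norm (?e m t) \<le> c * norm (complex_of_real t ^ (m * p + 1))" if "m \<in> {1..n}" for m
        using J that unfolding J_def by (auto elim: landau_o.bigE)
      then obtain c where c: "\<And>m. m \<in> {1..n} \<Longrightarrow>
          \<forall>\<^sub>F t in ?F. norm (?e m t) \<le> c m * norm (complex_of_real t ^ (m * p + 1))"
        by metis
      \<comment> \<open>The largest exponent with \<open>b * m \<le> m * p + 1\<close> for all
        \<open>m\<close> from 1 to \<open>n\<close>. Scaling the roots by
        \<open>t powr (- b)\<close> therefore keeps all coefficients bounded, and dividing by
        \<open>t * D t\<close> leaves the exponent \<open>b - 1 - p = 1 / n - 1\<close>.\<close>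
      define b where "b = real p + 1 / real n"
      define B where "B = 1 + (\<Sum>m = 1..n. \<bar>c m\<bar>)"
      have "\<forall>\<^sub>F t in ?F. \<forall>m\<in>{1..n}. norm (?e m t) \<le> c m * norm (complex_of_real t ^ (m * p + 1))"
        using c by (intro eventually_ball_finite) auto
      moreover have "\<forall>\<^sub>F t in ?F. norm d / 2 < norm (D t / of_real t ^ p)"
        using D(2) by (intro order_tendstoD(1)[OF tendsto_norm[OF D(1)]]) simp
      ultimately have "\<forall>\<^sub>F t in ?F. \<forall>j\<in>{1..n}.
          norm (u j t / (of_real t * D t)) \<le> (2 * B / norm d) * t powr (1 / real n - 1)"
        using pos
      proof eventually_elim
        case (elim t)
        then have t: "0 < t" "t < 1" by auto
        show ?case
        proof
          fix j assume j: "j \<in> {1..n}"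
          let ?s = "complex_of_real (t powr (- b))"
          have "norm (?s * u j t) \<le> 1 + (\<Sum>m = 1..n. norm (vieta n (\<lambda>i. ?s * u i t) m))"
            by (rule norm_root_le[OF j])
          also have "\<dots> \<le> B"
            unfolding B_def
          proof (intro add_left_mono sum_mono)
            fix m assume m: "m \<in> {1..n}"
            have "norm (vieta n (\<lambda>i. ?s * u i t) m) = (t powr (- b)) ^ m * norm (?e m t)"
              using m t by (subst vieta_scale) (auto simp: norm_mult norm_power)
            also have "\<dots> \<le> (t powr (- b)) ^ m * (c m * t ^ (m * p + 1))"
              using elim(1) m t by (intro mult_left_mono) (auto simp: norm_power norm_mult)
            also have "\<dots> = c m * t powr (1 - real m / real n)"
            proof -
              have "(t powr (- b)) ^ m = t powr (- b * real m)"
                using t by (simp add: powr_powr flip: powr_realpow)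
              moreover have "t ^ (m * p + 1) = t powr real (m * p + 1)"
                using t by (simp only: powr_realpow)
              ultimately have "(t powr (- b)) ^ m * t ^ (m * p + 1) = t powr (- b * real m + real (m * p + 1))"
                by (simp only: powr_add)
              also have "- b * real m + real (m * p + 1) = 1 - real m / real n"
                by (simp add: b_def algebra_simps)
              finally show ?thesis by (simp add: mult.left_commute)
            qed
            also have "\<dots> \<le> \<bar>c m\<bar> * 1"
              using m t n by (intro mult_mono) (auto intro!: powr_le1)
            finally show "norm (vieta n (\<lambda>i. ?s * u i t) m) \<le> \<bar>c m\<bar>" by simp
          qed
          finally have "t powr (- b) * norm (u j t) \<le> B"
            by (simp only: norm_mult norm_of_real abs_of_nonneg[OF powr_ge_zero])
          then have "norm (u j t) \<le> B * t powr b"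
            using t by (simp add: powr_minus divide_simps)
          moreover have "norm (D t) \<ge> norm d / 2 * t powr real p"
            using elim(2) t by (simp add: norm_divide norm_power powr_realpow field_simps)
          ultimately have "norm (u j t) / (t * norm (D t)) \<le> (B * t powr b) / (t * (norm d / 2 * t powr real p))"
            using t D(2) by (intro frac_le mult_left_mono mult_nonneg_nonneg) (auto simp: B_def sum_nonneg)
          also have "\<dots> = (2 * B / norm d) * (t powr b / (t powr 1 * t powr real p))"
            using t by (simp add: mult_ac)
          also have "t powr b / (t powr 1 * t powr real p) = t powr (1 / real n - 1)"
            unfolding powr_add[symmetric] powr_diff[symmetric] by (simp add: b_def)
          finally show "norm (u j t / (of_real t * D t)) \<le> (2 * B / norm d) * t powr (1 / real n - 1)"
            using t by (simp add: norm_divide norm_mult)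
        qed
      qed
      then show ?thesis
        using n by (intro exI[of _ "1 / real n"] exI[of _ "2 * B / norm d"] conjI) (auto simp: B_def sum_nonneg)
    next
      case True
      then show ?thesis by (intro exI[of _ 1] exI[of _ 0] conjI) simp_all
    qed
  next
    case False
    then have J: "J \<noteq> {}" "finite J" by (auto simp: J_def)
    have "\<exists>q c. q < m * p + 1 \<and> c \<noteq> 0 \<and> ((\<lambda>t. ?e m t / of_real t ^ q) \<longlongrightarrow> c) ?F" if "m \<in> J" for m
    proof -
      have m: "m \<in> {1..n}" and no: "?e m \<notin> O[?F](\<lambda>t. of_real t ^ (m * p + 1))"
        using that by (auto simp: J_def)
      show ?thesis
      proof (rule asymp_alg_dichotomy[OF coeffs[OF m], of "m * p + 1"])
        assume "?e m \<in> O[at 0 within {0<..<\<epsilon>}](\<lambda>t. of_real (t - 0) ^ (m * p + 1))"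
        then show ?thesis using no unfolding F by simp
      next
        fix q c
        assume "q < m * p + 1" "c \<noteq> 0"
          "((\<lambda>t. ?e m t / of_real (t - 0) ^ q) \<longlongrightarrow> c) (at 0 within {0<..<\<epsilon>})"
        then show ?thesis unfolding F by (intro exI[of _ q] exI[of _ c]) simp
      qed
    qed
    then have "\<forall>m\<in>J. \<exists>q c. q < m * p + 1 \<and> c \<noteq> 0 \<and> ((\<lambda>t. ?e m t / of_real t ^ q) \<longlongrightarrow> c) ?F"
      by blast
    from bchoice[OF this] obtain q where "\<forall>m\<in>J. \<exists>c. q m < m * p + 1 \<and> c \<noteq> 0 \<and>
        ((\<lambda>t. ?e m t / of_real t ^ q m) \<longlongrightarrow> c) ?F" ..
    from bchoice[OF this] obtain c where qc: "\<forall>m\<in>J. q m < m * p + 1 \<and> c m \<noteq> 0 \<and>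
        ((\<lambda>t. ?e m t / of_real t ^ q m) \<longlongrightarrow> c m) ?F" ..
    then have q: "q m < m * p + 1" and c: "c m \<noteq> 0"
        and lim: "((\<lambda>t. ?e m t / of_real t ^ q m) \<longlongrightarrow> c m) ?F" if "m \<in> J" for m
      using that by blast+
    define \<rho> where "\<rho> = Min ((\<lambda>m. real (q m) / real m) ` J)"
    have "\<rho> \<in> (\<lambda>m. real (q m) / real m) ` J" unfolding \<rho>_def using J by (intro Min_in) auto
    then obtain m0 where m0: "m0 \<in> J" "\<rho> = real (q m0) / real m0" by blast
    have Jpos: "m \<ge> 1" "m \<le> n" if "m \<in> J" for m using that by (auto simp: J_def)
    have \<rho>_le: "\<rho> * real m \<le> real (q m)" if "m \<in> J" for m
    proof -
      have "\<rho> \<le> real (q m) / real m" unfolding \<rho>_def using J that by (intro Min_le) auto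
      then show ?thesis using Jpos[OF that] by (simp add: field_simps)
    qed
    have "real (q m0) \<le> real m0 * real p" using q[OF m0(1)] by (simp flip: of_nat_mult)
    then have \<rho>_p: "\<rho> \<le> real p" unfolding m0(2) using Jpos[OF m0(1)] by (simp add: field_simps)
    define y where "y i t = complex_of_real (t powr (- \<rho>)) * u i t" for i t
    \<comment> \<open>The limits of the rescaled coefficients: those on the edge of slope \<rho>
      keep their leading coefficient, those above it tend to 0. So do those outside
      \<open>J\<close>, since their order \<open>m * p + 1\<close> exceeds
      \<open>\<rho> * m\<close>.\<close>
    define \<sigma> where "\<sigma> m = (if m = 0 then 1 else if m \<in> J \<and> real (q m) = \<rho> * real m then c m else 0)" for m
    have powr0: "((\<lambda>t. complex_of_real (t powr a)) \<longlongrightarrow> (if a = 0 then 1 else 0)) ?F" if "a \<ge> 0" for a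
    proof (cases "a = 0")
      case True
      have "\<forall>\<^sub>F t in ?F. 1 = complex_of_real (t powr a)"
        using pos(1) by eventually_elim (simp add: True)
      then show ?thesis using True by (simp add: tendsto_eventually eventually_mono)
    next
      case False
      then have "((\<lambda>t. complex_of_real (t powr a)) \<longlongrightarrow> of_real (0 powr a)) ?F"
        using that pos(1) by (intro tendsto_of_real tendsto_powr') (auto intro: eventually_mono)
      then show ?thesis using False by simp
    qed
    have limy: "((\<lambda>t. vieta n (\<lambda>i. y i t) m) \<longlongrightarrow> \<sigma> m) ?F" if m: "m \<le> n" for m
    proof (cases "m = 0")
      case True
      then show ?thesis by (simp add: vieta_0 \<sigma>_def)
    next
      case m': False
      have ev: "\<forall>\<^sub>F t in ?F. vieta n (\<lambda>i. y i t) m = complex_of_real (t powr (- \<rho> * real m)) * ?e m t"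
        using pos(1)
      proof eventually_elim
        case (elim t)
        have "(t powr (- \<rho>)) ^ m = t powr (- \<rho> * real m)"
          using elim by (simp add: powr_powr flip: powr_realpow)
        moreover have "vieta n (\<lambda>i. y i t) m = complex_of_real ((t powr (- \<rho>)) ^ m) * ?e m t"
          unfolding y_def using elim m by (subst vieta_scale) auto
        ultimately show ?case by simp
      qed
      show ?thesis
      proof (cases "m \<in> J")
        case True
        have "((\<lambda>t. complex_of_real (t powr (real (q m) - \<rho> * real m)) * (?e m t / of_real t ^ q m)) \<longlongrightarrow>
            (if real (q m) - \<rho> * real m = 0 then 1 else 0) * c m) ?F"
          using \<rho>_le[OF True] by (intro tendsto_mult powr0 lim True) simp
        moreover have "(if real (q m) - \<rho> * real m = 0 then 1 else 0) * c m = \<sigma> m"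
          using True m' by (simp add: \<sigma>_def)
        moreover have "\<forall>\<^sub>F t in ?F. complex_of_real (t powr (real (q m) - \<rho> * real m)) * (?e m t / of_real t ^ q m) =
            vieta n (\<lambda>i. y i t) m"
          using ev pos(1)
        proof eventually_elim
          case (elim t)
          have "t powr (real (q m) - \<rho> * real m) = t powr (- \<rho> * real m) * t ^ q m"
            using elim(2) by (simp add: powr_diff powr_minus powr_realpow field_simps)
          then show ?case using elim by simp
        qed
        ultimately show ?thesis by (simp only:) (rule Lim_transform_eventually)
      next
        case nJ: False
        then have "?e m \<in> O[?F](\<lambda>t. of_real t ^ (m * p + 1))" using m m' by (simp add: J_def)
        then obtain C where C: "\<forall>\<^sub>F t in ?F. norm (?e m t) \<le> C * norm (complex_of_real t ^ (m * p + 1))"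
          by (auto elim: landau_o.bigE)
        have a: "0 < real (m * p + 1) - \<rho> * real m" using mult_right_mono[OF \<rho>_p, of "real m"] by (simp add: mult.commute)
        have "((\<lambda>t. vieta n (\<lambda>i. y i t) m) \<longlongrightarrow> 0) ?F"
        proof (rule Lim_null_comparison)
          show "\<forall>\<^sub>F t in ?F. norm (vieta n (\<lambda>i. y i t) m) \<le> C * norm (complex_of_real (t powr (real (m * p + 1) - \<rho> * real m)))"
            using ev pos(1) C
          proof eventually_elim
            case (elim t)
            have "norm (vieta n (\<lambda>i. y i t) m) \<le> t powr (- \<rho> * real m) * (C * t ^ (m * p + 1))"
              unfolding elim(1) norm_mult using elim(2,3) by (intro mult_mono) (auto simp: norm_power norm_mult)
            also have "\<dots> = C * (t powr (- \<rho> * real m) * t powr real (m * p + 1))"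
              using elim(2) by (simp only: powr_realpow mult.left_commute)
            also have "\<dots> = C * t powr (real (m * p + 1) - \<rho> * real m)"
              unfolding powr_add[symmetric] by simp
            finally show ?case by simp
          qed
          show "((\<lambda>t. C * norm (complex_of_real (t powr (real (m * p + 1) - \<rho> * real m)))) \<longlongrightarrow> 0) ?F"
            using tendsto_mult_right[OF tendsto_norm[OF powr0], of "real (m * p + 1) - \<rho> * real m" C] a
            by (simp add: mult.commute)
        qed
        then show ?thesis using nJ m' by (simp add: \<sigma>_def)
      qed
    qed
    have conty: "continuous_on {0<..<\<epsilon>} (y j)" if "j \<in> {1..n}" for j
      unfolding y_def by (intro continuous_intros cont that) auto
    have "\<exists>\<eta>. (y j \<longlongrightarrow> \<eta>) ?F" if "j \<in> {1..n}" for j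
      using continuous_root_converges[OF e that conty[OF that] limy] .
    then obtain \<eta> where \<eta>: "\<And>j. j \<in> {1..n} \<Longrightarrow> (y j \<longlongrightarrow> \<eta> j) ?F" by metis
    have v\<eta>: "vieta n \<eta> m = \<sigma> m" if "m \<le> n" for m
    proof (rule vieta_unique[OF _ that])
      fix z
      have "((\<lambda>t. \<Prod>i = 1..n. z - y i t) \<longlongrightarrow> (\<Prod>i = 1..n. z - \<eta> i)) ?F"
        by (intro tendsto_prod tendsto_diff tendsto_const \<eta>)
      moreover have "((\<lambda>t. \<Prod>i = 1..n. z - y i t) \<longlongrightarrow> (\<Sum>m\<le>n. \<sigma> m * z ^ (n - m))) ?F"
        unfolding prod_eq_vieta by (intro tendsto_sum tendsto_mult tendsto_const limy) auto
      ultimately show "(\<Prod>i = 1..n. z - \<eta> i) = (\<Sum>m\<le>n. \<sigma> m * z ^ (n - m))"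
        by (rule tendsto_unique[OF trivial_limit_at_right_real])
    qed
    have "\<eta> j = 0" if j: "j \<in> {1..n}" for j
    proof -
      \<comment> \<open>The exponent \<open>1 + real p - \<rho>\<close> is at least 1 because \<rho>
        \<le> p; a nonzero limit would thus contradict the boundedness of
        \<open>lam j\<close>.\<close>
      have "((\<lambda>t. (u j t / (of_real t * D t)) * of_real (t powr (1 + real p - \<rho>))) \<longlongrightarrow> \<eta> j / d) ?F"
      proof (rule Lim_transform_eventually)
        show "((\<lambda>t. y j t / (D t / of_real t ^ p)) \<longlongrightarrow> \<eta> j / d) ?F"
          by (intro tendsto_divide \<eta> j D)
        show "\<forall>\<^sub>F t in ?F. y j t / (D t / of_real t ^ p) = (u j t / (of_real t * D t)) * of_real (t powr (1 + real p - \<rho>))"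
          using pos(1)
        proof eventually_elim
          case (elim t)
          have "t powr (1 + real p - \<rho>) = t powr 1 * t powr real p * t powr (- \<rho>)"
            unfolding powr_add[symmetric] by simp
          also have "\<dots> = t * t ^ p * t powr (- \<rho>)" using elim by (simp add: powr_realpow)
          finally show ?case using elim by (simp add: y_def)
        qed
      qed
      from unbounded_of_derivative[OF e der[OF j] bd[OF j] this] \<rho>_p
      have "\<eta> j / d = 0" by simp
      then show ?thesis using D(2) by simp
    qed
    \<comment> \<open>If all limits are zero, so is the limiting coefficient at \<open>m0\<close>;
      but the least slope is attained there, and this coefficient is \<open>c m0\<close>.\<close>
    then have "vieta n \<eta> m0 = vieta n (\<lambda>_. 0) m0" by (intro vieta_cong) auto
    also have "\<dots> = 0" using Jpos[OF m0(1)] by (simp add: vieta_def one_pCons[symmetric])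
    finally have "\<sigma> m0 = 0" using v\<eta>[of m0] Jpos[OF m0(1)] by simp
    moreover have "\<sigma> m0 = c m0" using m0 Jpos[OF m0(1)] by (simp add: \<sigma>_def)
    ultimately show ?thesis using c[OF m0(1)] by simp
  qed
qed

section \<open>Absolute continuity\<close>

text \<open>Split off the interval with the largest left endpoint: all others end before it begins,
  so the induction applies with this endpoint as the new right bound.\<close>

lemma sum_mono_increments_le:
  fixes h :: "real \<Rightarrow> real" and u v :: "'i \<Rightarrow> real"
  assumes h: "mono h" and "finite J"
    and "\<And>i. i \<in> J \<Longrightarrow> a \<le> u i \<and> u i \<le> v i \<and> v i \<le> b" "a \<le> b"
    and "\<And>i j. i \<in> J \<Longrightarrow> j \<in> J \<Longrightarrow> i \<noteq> j \<Longrightarrow> {u i<..<v i} \<inter> {u j<..<v j} = {}"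
  shows "(\<Sum>i\<in>J. h (v i) - h (u i)) \<le> h b - h a"
  using assms(2-)
proof (induction "card J" arbitrary: J b)
  case 0
  then show ?case using monoD[OF h] by simp
next
  case (Suc m)
  then have "J \<noteq> {}" by auto
  then have "Max (u ` J) \<in> u ` J" using Suc.prems(1) by (intro Max_in) auto
  then obtain k where k: "k \<in> J" "u k = Max (u ` J)" by auto
  have max: "u i \<le> u k" if "i \<in> J" for i
    unfolding k(2) using Suc.prems(1) that by (intro Max_ge) auto
  \<comment> \<open>A degenerate interval has empty interior and may lie inside another one, so
    disjointness does not order it. Its increment is 0, and it is removed beforehand.\<close>
  show ?case
  proof (cases "\<exists>i\<in>J. u i = v i")
    case True
    then obtain i where i: "i \<in> J" "u i = v i" by blast
    have "(\<Sum>i\<in>J - {i}. h (v i) - h (u i)) \<le> h b - h a"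
      using Suc.hyps(2) i(1) Suc.prems by (intro Suc.hyps(1)) auto
    then show ?thesis
      using i Suc.prems(1) by (simp add: sum.remove[of J i])
  next
    case False
    have "v i \<le> u k" if i: "i \<in> J - {k}" for i
    proof (rule ccontr)
      assume "\<not> v i \<le> u k"
      moreover have "u i < v i" "u k < v k" "u i \<le> u k"
        using Suc.prems(2)[of i] Suc.prems(2)[of k] False i k(1) max[of i] by force+
      ultimately have "(u k + min (v i) (v k)) / 2 \<in> {u i<..<v i} \<inter> {u k<..<v k}"
        by (auto simp: min_def field_simps)
      then show False using Suc.prems(4)[of i k] i k(1) by blast
    qed
    then have "(\<Sum>i\<in>J - {k}. h (v i) - h (u i)) \<le> h (u k) - h a"
      using Suc.hyps(2) k(1) Suc.prems by (intro Suc.hyps(1)) auto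
    moreover have "h (v k) \<le> h b" using Suc.prems(2)[OF k(1)] by (intro monoD[OF h]) simp
    ultimately show ?thesis
      using k(1) Suc.prems(1) by (simp add: sum.remove[of J k])
  qed
qed

text \<open>For \<gamma> > 0 this is the monotone primitive of
  \<open>\<gamma> * \<bar>x\<bar> powr (\<gamma> - 1)\<close> that vanishes at 0. It stands for the
  integral of the derivative bound across its singularity.\<close>

definition signed_powr :: "real \<Rightarrow> real \<Rightarrow> real" where
  "signed_powr \<gamma> x = (if x \<ge> 0 then x powr \<gamma> else - ((-x) powr \<gamma>))"

lemma signed_powr_mono:
  assumes "\<gamma> > 0"
  shows "mono (signed_powr \<gamma>)"
proof (rule monoI)
  fix x y :: real assume "x \<le> y"
  then show "signed_powr \<gamma> x \<le> signed_powr \<gamma> y"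
    using assms powr_mono2[of \<gamma> x y] powr_mono2[of \<gamma> "-y" "-x"]
    by (auto simp: signed_powr_def intro: order_trans[of _ 0])
qed

text \<open>
  The increments of \<open>signed_powr \<gamma>\<close> are split at \<open>\<plusminus>\<eta>\<close>: inside \<open>[-\<eta>, \<eta>]\<close> their sum is
  bounded by monotonicity, and outside the function is Lipschitz.
\<close>
lemma signed_powr_increment_le:
  assumes g: "0 < \<gamma>" and e: "0 < \<eta>" "\<eta> < r" and uv: "-r \<le> u" "u \<le> v" "v \<le> r"
  defines "c \<equiv> \<lambda>x. max (-\<eta>) (min \<eta> x)"
  shows "signed_powr \<gamma> v - signed_powr \<gamma> u \<le>
    signed_powr \<gamma> (c v) - signed_powr \<gamma> (c u) + \<gamma> * (\<eta> powr (\<gamma> - 1) + r powr (\<gamma> - 1)) * (v - u)"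
proof -
  let ?h = "signed_powr \<gamma>"
  \<comment> \<open>The derivative of \<open>x powr \<gamma>\<close> on \<open>[\<eta>, r]\<close>
    is largest at \<open>r\<close> if \<gamma> \<ge> 1 and at \<eta> otherwise; the sum of both
    values covers either case.\<close>
  define L where "L = \<gamma> * (\<eta> powr (\<gamma> - 1) + r powr (\<gamma> - 1))"
  have L0: "0 \<le> L" using g by (simp add: L_def)
  have pos: "y powr \<gamma> - x powr \<gamma> \<le> L * (y - x)" if "\<eta> \<le> x" "x \<le> y" "y \<le> r" for x y
  proof (cases "x = y")
    case False
    then have "\<exists>z>x. z < y \<and> y powr \<gamma> - x powr \<gamma> = (y - x) * (\<gamma> * z powr (\<gamma> - 1))"
      using that e by (intro MVT2) (auto intro!: derivative_eq_intros has_real_derivative_powr simp: )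
    then obtain z where z: "x < z" "z < y" "y powr \<gamma> - x powr \<gamma> = (y - x) * (\<gamma> * z powr (\<gamma> - 1))"
      by blast
    have "z powr (\<gamma> - 1) \<le> \<eta> powr (\<gamma> - 1) + r powr (\<gamma> - 1)"
    proof (cases "\<gamma> \<ge> 1")
      case True
      then have "z powr (\<gamma> - 1) \<le> r powr (\<gamma> - 1)" using z that e by (intro powr_mono2) auto
      then show ?thesis by (simp add: add_increasing)
    next
      case False
      then have "z powr (\<gamma> - 1) \<le> \<eta> powr (\<gamma> - 1)" using z that e by (intro powr_mono2') auto
      then show ?thesis by (simp add: add_increasing2)
    qed
    then have "\<gamma> * z powr (\<gamma> - 1) \<le> L" unfolding L_def using g by (intro mult_left_mono) auto
    then have "(y - x) * (\<gamma> * z powr (\<gamma> - 1)) \<le> (y - x) * L" using that by (intro mult_left_mono) auto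
    then show ?thesis unfolding z(3) by (simp add: mult.commute)
  qed simp
  have right: "?h v - ?h u \<le> L * (v - u)" if "\<eta> \<le> u" "u \<le> v" "v \<le> r" for u v
    using pos[of u v] that e by (simp add: signed_powr_def)
  have left: "?h v - ?h u \<le> L * (v - u)" if "-r \<le> u" "u \<le> v" "v \<le> -\<eta>" for u v
    using pos[of "-v" "-u"] that e by (simp add: signed_powr_def)
  have split: "\<exists>a b. u \<le> a \<and> a \<le> b \<and> b \<le> v \<and> ?h a - ?h u \<le> L * (a - u) \<and> ?h v - ?h b \<le> L * (v - b) \<and>
      ?h b - ?h a \<le> ?h (c v) - ?h (c u)"
  proof -
    consider "v \<le> -\<eta>" | "\<eta> \<le> u" | "u < \<eta>" "-\<eta> < v" by linarith
    then show ?thesis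
    proof cases
      case 1
      then show ?thesis using left[of u v] uv e
        by (intro exI[of _ v] exI[of _ v]) (auto simp: c_def)
    next
      case 2
      then show ?thesis using right[of u v] uv e
        by (intro exI[of _ v] exI[of _ v]) (auto simp: c_def)
    next
      case 3
      show ?thesis
        using 3 left[of u "-\<eta>"] right[of \<eta> v] uv e
        by (intro exI[of _ "c u"] exI[of _ "c v"]) (auto simp: c_def max_def min_def)
    qed
  qed
  then obtain a b where "u \<le> a" "a \<le> b" "b \<le> v" "?h a - ?h u \<le> L * (a - u)" "?h v - ?h b \<le> L * (v - b)"
      "?h b - ?h a \<le> ?h (c v) - ?h (c u)" by blast
  moreover have "0 \<le> L * (b - a)" using L0 \<open>a \<le> b\<close> by simp
  ultimately have "?h v - ?h u \<le> ?h (c v) - ?h (c u) + L * (v - u)"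
    by (simp add: algebra_simps)
  then show ?thesis by (simp add: L_def)
qed

text \<open>First \<eta> is taken so small that the total increment of the majorant over
  \<open>[-\<eta>, \<eta>]\<close> is harmless for any family of intervals; only then does the total
  length matter, through the Lipschitz constant outside.\<close>

lemma abs_continuous_on_signed_powr:
  fixes f :: "real \<Rightarrow> complex"
  assumes g: "0 < \<gamma>" and C: "0 \<le> C" and r: "0 < r" and S: "S \<subseteq> ball s r"
    and f: "\<And>u v. u \<in> S \<Longrightarrow> v \<in> S \<Longrightarrow> u \<le> v \<Longrightarrow>
      norm (f v - f u) \<le> C * (signed_powr \<gamma> (v - s) - signed_powr \<gamma> (u - s))"
  shows "abs_continuous_on S f"
  unfolding abs_continuous_on_def
proof (intro allI impI)
  fix \<epsilon> :: real assume eps: "\<epsilon> > 0"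
  let ?h = "signed_powr \<gamma>"
  have "((\<lambda>\<eta>. C * (2 * \<eta> powr \<gamma>)) \<longlongrightarrow> C * (2 * 0)) (at_right 0)"
    using g by (intro tendsto_intros) (auto intro!: tendsto_eq_intros simp: eventually_at_filter)
  then have "\<forall>\<^sub>F \<eta> in at_right 0. C * (2 * \<eta> powr \<gamma>) < \<epsilon> / 2"
    using eps by (intro order_tendstoD(2)) auto
  moreover have "\<forall>\<^sub>F \<eta> in at_right 0. \<eta> < r" "\<forall>\<^sub>F \<eta> in at_right (0::real). 0 < \<eta>"
    using r eventually_at_right_less by (auto simp: eventually_at_right intro: exI[of _ r])
  ultimately have "\<forall>\<^sub>F \<eta> in at_right 0. C * (2 * \<eta> powr \<gamma>) < \<epsilon> / 2 \<and> 0 < \<eta> \<and> \<eta> < r"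
    by eventually_elim auto
  then obtain \<eta> where e: "C * (2 * \<eta> powr \<gamma>) < \<epsilon> / 2" "0 < \<eta>" "\<eta> < r"
    using eventually_happens' trivial_limit_at_right_real by blast
  define L where "L = \<gamma> * (\<eta> powr (\<gamma> - 1) + r powr (\<gamma> - 1))"
  have L: "0 \<le> L" using g by (simp add: L_def)
  define c where "c x = max (-\<eta>) (min \<eta> x)" for x
  \<comment> \<open>The summand 1 keeps the denominator positive when
    \<open>C * L = 0\<close>.\<close>
  define \<delta> where "\<delta> = \<epsilon> / (2 * (C * L + 1))"
  have CL: "0 \<le> C * L" using C L by simp
  have d: "0 < \<delta>" using eps CL by (simp add: \<delta>_def)
  have main: "(\<Sum>i<m. norm (f (v i) - f (u i))) < \<epsilon>"
    if uv: "\<forall>i<m. u i \<le> v i \<and> {u i..v i} \<subseteq> S"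
      and disj: "\<forall>i<m. \<forall>j<m. i \<noteq> j \<longrightarrow> {u i<..<v i} \<inter> {u j<..<v j} = {}"
      and len: "(\<Sum>i<m. v i - u i) < \<delta>"
    for m :: nat and u v :: "nat \<Rightarrow> real"
  proof -
    have inS: "u i \<in> S" "v i \<in> S" if "i < m" for i
      using uv that by (auto simp: subset_iff)
    have inr: "-r \<le> u i - s" "v i - s \<le> r" if "i < m" for i
      using subsetD[OF S inS(1)[OF that]] subsetD[OF S inS(2)[OF that]] by (auto simp: dist_real_def)
    have "(\<Sum>i<m. norm (f (v i) - f (u i))) \<le>
        (\<Sum>i<m. C * (?h (c (v i - s)) - ?h (c (u i - s)) + L * (v i - u i)))"
    proof (rule sum_mono)
      fix i assume "i \<in> {..<m}"
      then have i: "i < m" by simp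
      have "norm (f (v i) - f (u i)) \<le> C * (?h (v i - s) - ?h (u i - s))"
        using f[OF inS[OF i]] uv i by simp
      also have "?h (v i - s) - ?h (u i - s) \<le> ?h (c (v i - s)) - ?h (c (u i - s)) + L * (v i - s - (u i - s))"
        unfolding c_def L_def using uv i inr[OF i] by (intro signed_powr_increment_le g e) auto
      then have "C * (?h (v i - s) - ?h (u i - s)) \<le> C * (?h (c (v i - s)) - ?h (c (u i - s)) + L * (v i - u i))"
        using C by (intro mult_left_mono) simp_all
      finally show "norm (f (v i) - f (u i)) \<le> C * (?h (c (v i - s)) - ?h (c (u i - s)) + L * (v i - u i))" .
    qed
    also have "\<dots> = C * (\<Sum>i<m. ?h (c (v i - s)) - ?h (c (u i - s))) + C * L * (\<Sum>i<m. v i - u i)"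
      by (simp add: sum_distrib_left sum.distrib algebra_simps sum_subtractf)
    also have "(\<Sum>i<m. ?h (c (v i - s)) - ?h (c (u i - s))) \<le> ?h \<eta> - ?h (- \<eta>)"
    proof (rule sum_mono_increments_le[OF signed_powr_mono[OF g]])
      fix i j assume ij: "i \<in> {..<m}" "j \<in> {..<m}" "i \<noteq> j"
      then have "{u i<..<v i} \<inter> {u j<..<v j} = {}" using disj by simp
      moreover have "z + s \<in> {u i<..<v i} \<inter> {u j<..<v j}"
        if "z \<in> {c (u i - s)<..<c (v i - s)} \<inter> {c (u j - s)<..<c (v j - s)}" for z
        using that by (auto simp: c_def max_def min_def split: if_splits)
      ultimately show "{c (u i - s)<..<c (v i - s)} \<inter> {c (u j - s)<..<c (v j - s)} = {}" by blast
    qed (use uv e in \<open>auto simp: c_def max_def min_def\<close>)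
    then have "C * (\<Sum>i<m. ?h (c (v i - s)) - ?h (c (u i - s))) \<le> C * (2 * \<eta> powr \<gamma>)"
      using C e by (intro mult_left_mono) (simp_all add: signed_powr_def)
    moreover have "C * L * (\<Sum>i<m. v i - u i) \<le> (C * L + 1) * \<delta>"
    proof -
      have "0 \<le> (\<Sum>i<m. v i - u i)" using uv by (intro sum_nonneg) simp
      then show ?thesis using len CL by (intro mult_mono) auto
    qed
    moreover have "(C * L + 1) * \<delta> = \<epsilon> / 2" using CL by (simp add: \<delta>_def field_simps)
    ultimately show "(\<Sum>i<m. norm (f (v i) - f (u i))) < \<epsilon>"
      using e(1) by linarith
  qed
  show "\<exists>\<delta>>0. \<forall>(m::nat) u v. (\<forall>i<m. u i \<le> v i \<and> {u i..v i} \<subseteq> S) \<and>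
      (\<forall>i<m. \<forall>j<m. i \<noteq> j \<longrightarrow> {u i<..<v i} \<inter> {u j<..<v j} = {}) \<and> (\<Sum>i<m. v i - u i) < \<delta> \<longrightarrow>
      (\<Sum>i<m. norm (f (v i) - f (u i))) < \<epsilon>"
    using d main by blast
qed

section \<open>The derivatives of the roots\<close>

text \<open>Asymptotic expansions cannot be differentiated in general, so the expansion of the
  derivative is part of the requirement. The derivative is two-sided.\<close>

definition diff_alg :: "real set \<Rightarrow> real \<Rightarrow> (real \<Rightarrow> complex) set" where
  "diff_alg U s = {f \<in> asymp_alg U s. \<exists>f'\<in>asymp_alg U s. \<forall>t\<in>U. (f has_vector_derivative f' t) (at t)}"

lemma function_algebra_diff_alg:
  assumes "open U"
  shows "function_algebra U (diff_alg U s)"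
proof -
  interpret A: function_algebra U "asymp_alg U s" by (rule function_algebra_asymp_alg)
  show ?thesis
  proof
    fix c show "(\<lambda>t. c) \<in> diff_alg U s"
      unfolding diff_alg_def using A.const by (auto intro!: bexI[of _ "\<lambda>t. 0"])
  next
    fix f g assume f: "f \<in> diff_alg U s" and g: "g \<in> diff_alg U s"
    obtain f' where f': "f' \<in> asymp_alg U s" "\<And>t. t \<in> U \<Longrightarrow> (f has_vector_derivative f' t) (at t)"
      using f unfolding diff_alg_def by blast
    obtain g' where g': "g' \<in> asymp_alg U s" "\<And>t. t \<in> U \<Longrightarrow> (g has_vector_derivative g' t) (at t)"
      using g unfolding diff_alg_def by blast
    have fg: "f \<in> asymp_alg U s" "g \<in> asymp_alg U s" using f g by (auto simp: diff_alg_def)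
    show "(\<lambda>t. f t + g t) \<in> diff_alg U s"
      unfolding diff_alg_def
    proof (intro CollectI conjI bexI[of _ "\<lambda>t. f' t + g' t"] ballI)
      show "((\<lambda>t. f t + g t) has_vector_derivative f' t + g' t) (at t)" if "t \<in> U" for t
        by (intro has_vector_derivative_add f'(2) g'(2) that)
    qed (intro A.add fg f' g')+
    show "(\<lambda>t. f t * g t) \<in> diff_alg U s"
      unfolding diff_alg_def
    proof (intro CollectI conjI bexI[of _ "\<lambda>t. f t * g' t + f' t * g t"] ballI)
      show "((\<lambda>t. f t * g t) has_vector_derivative f t * g' t + f' t * g t) (at t)" if "t \<in> U" for t
        by (intro has_vector_derivative_mult f'(2) g'(2) that)
    qed (intro A.add A.mult fg f' g')+
  next
    fix f g assume f: "f \<in> diff_alg U s" and eq: "\<And>t. t \<in> U \<Longrightarrow> f t = g t"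
    obtain f' where f': "f' \<in> asymp_alg U s" "\<And>t. t \<in> U \<Longrightarrow> (f has_vector_derivative f' t) (at t)"
      using f unfolding diff_alg_def by blast
    have "f \<in> asymp_alg U s" using f by (simp add: diff_alg_def)
    then have "g \<in> asymp_alg U s" using eq by (rule A.cong)
    moreover have "(g has_vector_derivative f' t) (at t)" if "t \<in> U" for t
      by (rule has_vector_derivative_transform_within_open[OF f'(2)[OF that] assms that eq])
    ultimately show "g \<in> diff_alg U s" unfolding diff_alg_def using f'(1) by blast
  qed
qed

text \<open>The cleared denominator of the interpolation at the node \<open>x j\<close>. It depends
  on \<open>j\<close>, so it is not itself a symmetric function of the roots.\<close>

definition interp_sum :: "nat \<Rightarrow> nat \<Rightarrow> (nat \<Rightarrow> complex) \<Rightarrow> nat \<Rightarrow> complex" where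
  "interp_sum n k x j = (\<Sum>i = 1..n. interp_kernel n k x (x j) (x i))"

text \<open>Up to sign the product of all \<open>interp_sum n k x j\<close>, in analogy to the norm
  of an algebraic element. As a symmetric function of the roots it has an expansion.\<close>

definition interp_norm :: "nat \<Rightarrow> nat \<Rightarrow> (nat \<Rightarrow> complex) \<Rightarrow> complex" where
  "interp_norm n k x = vieta n (interp_sum n k x) n"

text \<open>The product of \<open>norm_Delta_roots_le\<close> over all \<open>j\<close>. It carries
  the finite order of vanishing from \<open>Delta_roots\<close> over to the common
  denominator.\<close>

lemma norm_Delta_roots_power_le:
  assumes "1 \<le> k" "card (x ` {1..n}) \<le> k"
  shows "norm (Delta_roots n k x) ^ n \<le> 2 ^ (n * n) * norm (interp_norm n k x)"
proof -
  have "norm (Delta_roots n k x) ^ n = (\<Prod>j = 1..n. norm (Delta_roots n k x))" by simp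
  also have "\<dots> \<le> (\<Prod>j = 1..n. 2 ^ n * norm (interp_sum n k x j))"
    using norm_Delta_roots_le[OF assms] by (intro prod_mono) (auto simp: interp_sum_def)
  also have "\<dots> = 2 ^ (n * n) * norm (interp_norm n k x)"
    by (simp add: interp_norm_def vieta_top prod.distrib power_mult norm_minus_cancel flip: prod_norm)
  finally show ?thesis .
qed

context
  fixes U :: "real set" and s :: real and n k :: nat and lam :: "nat \<Rightarrow> real \<Rightarrow> complex"
  assumes U: "open U" "s \<notin> U" and k: "1 \<le> k"
    and cont: "\<And>j. j \<in> {1..n} \<Longrightarrow> continuous_on U (lam j)"
    and card_le: "\<And>t. t \<in> U \<Longrightarrow> card ((\<lambda>j. lam j t) ` {1..n}) \<le> k"
    and coeffs: "\<And>m. m \<in> {1..n} \<Longrightarrow> (\<lambda>t. vieta n (\<lambda>i. lam i t) m) \<in> diff_alg U s"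
begin

interpretation A: function_algebra U "asymp_alg U s" by (rule function_algebra_asymp_alg)
interpretation B: function_algebra U "diff_alg U s" by (rule function_algebra_diff_alg[OF U(1)])

lemma power_sum_diff_alg: "(\<lambda>t. \<Sum>i = 1..n. lam i t ^ l) \<in> diff_alg U s"
  by (rule B.power_sum[OF coeffs])

lemma power_sum_asymp_alg: "(\<lambda>t. \<Sum>i = 1..n. lam i t ^ l) \<in> asymp_alg U s"
  using power_sum_diff_alg by (simp add: diff_alg_def)

lemma poly_over_interp_term: "A.poly_over (\<lambda>t z. interp_term k z)"
  unfolding interp_term_def
  by (intro A.times A.poly_over_prod A.poly_over_diff A.var)

text \<open>Variables \<open>2..k\<close> are eliminated through power sums and variable
  \<open>1\<close> through the moments of \<open>w\<close>; variable \<open>0\<close>, the node,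
  remains. With \<open>w = 1\<close> this describes \<open>interp_sum\<close>, with
  \<open>w = lam'\<close> the numerator of the interpolation.\<close>

lemma poly_over_interp_sum:
  assumes "\<And>l. (\<lambda>t. \<Sum>i = 1..n. lam i t ^ l * w i t) \<in> asymp_alg U s"
  obtains f where "A.poly_over f"
    "\<And>t u. f t ((\<lambda>_. 0)(0 := u)) = (\<Sum>i = 1..n. interp_kernel n k (\<lambda>j. lam j t) u (lam i t) * w i t)"
proof -
  let ?G = "\<lambda>t z. \<Sum>h\<in>{2..k} \<rightarrow>\<^sub>E {1..n}. interp_term k (\<lambda>b. if b \<in> {2..k} then lam (h b) t else z b)"
  have "A.poly_over ?G"
    by (rule A.poly_over_sum_PiE[OF poly_over_interp_term]) (simp_all only: power_sum_asymp_alg finite_atLeastAtMost)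
  from A.poly_over_eliminate[OF this assms, of 1]
  have "A.poly_over (\<lambda>t z. \<Sum>i = 1..n. ?G t (z(1 := lam i t)) * w i t)" .
  then show ?thesis by (rule that) (simp only: interp_kernel_def)
qed

lemma interp_sum_poly_over:
  obtains f where "A.poly_over f"
    "\<And>t j. f t ((\<lambda>_. 0)(0 := lam j t)) = interp_sum n k (\<lambda>j. lam j t) j"
proof (rule poly_over_interp_sum[of "\<lambda>_ _. 1"])
  show "(\<lambda>t. \<Sum>i = 1..n. lam i t ^ l * 1) \<in> asymp_alg U s" for l
    using power_sum_asymp_alg by simp
next
  fix f assume f: "A.poly_over f" "\<And>t u. f t ((\<lambda>_. 0)(0 := u)) =
      (\<Sum>i = 1..n. interp_kernel n k (\<lambda>j. lam j t) u (lam i t) * 1)"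
  show ?thesis by (rule that[OF f(1)]) (simp only: f(2) interp_sum_def mult_1_right)
qed

lemma vieta_interp_sum_asymp_alg:
  "(\<lambda>t. vieta n (interp_sum n k (\<lambda>j. lam j t)) m) \<in> asymp_alg U s"
proof -
  obtain f where f: "A.poly_over f"
      "\<And>t j. f t ((\<lambda>_. 0)(0 := lam j t)) = interp_sum n k (\<lambda>j. lam j t) j"
    by (rule interp_sum_poly_over, rule that)
  from A.vieta_poly_over[OF f(1) power_sum_asymp_alg, where b = 0 and x = "\<lambda>_. 0" and m = m]
  show ?thesis unfolding f(2) .
qed

lemma interp_norm_asymp_alg: "(\<lambda>t. interp_norm n k (\<lambda>j. lam j t)) \<in> asymp_alg U s"
  unfolding interp_norm_def by (rule vieta_interp_sum_asymp_alg)

lemma poly_over_continuous: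
  assumes "A.poly_over f" "j \<in> {1..n}"
  shows "continuous_on U (\<lambda>t. f t ((\<lambda>_. 0)(0 := lam j t)))"
  using assms(1)
proof (induction rule: A.poly_over.induct)
  case (var b)
  then show ?case using cont[OF assms(2)] by (cases "b = 0") auto
qed (auto simp: asymp_alg_def intro: continuous_on_add continuous_on_mult)

context
  assumes norm_nonzero: "\<And>t. t \<in> U \<Longrightarrow> interp_norm n k (\<lambda>j. lam j t) \<noteq> 0"
begin

lemma interp_sum_nonzero: "t \<in> U \<Longrightarrow> j \<in> {1..n} \<Longrightarrow> interp_sum n k (\<lambda>j. lam j t) j \<noteq> 0"
  using norm_nonzero[of t] by (auto simp: interp_norm_def vieta_top)

lemma card_eq: "t \<in> U \<Longrightarrow> 1 \<le> n \<Longrightarrow> card ((\<lambda>j. lam j t) ` {1..n}) = k"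
  by (rule interp_kernel_sum_nonzeroD[OF k card_le, of t 1])
    (use interp_sum_nonzero[of t 1] in \<open>auto simp: interp_sum_def\<close>)

lemma lam_has_vector_derivative:
  assumes t: "t \<in> U" and j: "j \<in> {1..n}"
  shows "\<exists>d. (lam j has_vector_derivative d) (at t)"
proof -
  define P where "P t = (\<Prod>i = 1..n. [:- lam i t, 1:])" for t
  have roots: "root_tuple n (P t) (\<lambda>j. lam j t)" for t
    by (simp add: root_tuple_def P_def poly_prod)
  have "\<exists>d. ((\<lambda>t. coeff (P t) i) has_vector_derivative d) (at t)" for i
  proof (cases "i \<le> n")
    case True
    have eq: "coeff (P t) i = vieta n (\<lambda>i. lam i t) (n - i)" for t
      using True by (simp add: vieta_eq_coeff P_def)
    show ?thesis
    proof (cases "i = n")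
      case True
      then show ?thesis unfolding eq by (auto simp: vieta_0 intro!: exI[of _ 0])
    next
      case False
      then have "n - i \<in> {1..n}" using True by auto
      from coeffs[OF this] show ?thesis unfolding eq diff_alg_def using t by blast
    qed
  next
    case False
    then have "coeff (P t) i = 0" for t
      by (simp add: coeff_eq_0 root_tuple_degree[OF roots])
    then show ?thesis by (auto intro!: exI[of _ 0])
  qed
  moreover have "1 \<le> n" using j by simp
  ultimately show ?thesis
    by (intro root_has_vector_derivative[OF U(1) t cont roots card_eq]) (use j in auto)
qed

text \<open>
  With \<open>E j\<close> for \<open>interp_sum\<close>, interpolation gives \<open>lam' j * E j = F j\<close> with \<open>F j\<close> a polynomial in
  \<open>lam j\<close>. The characteristic equation of \<open>E\<close> makes \<open>interp_norm / E j\<close> a polynomial in \<open>E j\<close>, which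
  yields the denominator \<open>interp_norm\<close> common to all \<open>j\<close>.
\<close>
lemma derivative_quotient:
  assumes der: "\<And>t j. t \<in> U \<Longrightarrow> j \<in> {1..n} \<Longrightarrow> (lam j has_vector_derivative lam' j t) (at t)"
  obtains u where "\<And>j. j \<in> {1..n} \<Longrightarrow> continuous_on U (u j)"
    "\<And>m. (\<lambda>t. vieta n (\<lambda>i. u i t) m) \<in> asymp_alg U s"
    "\<And>t j. t \<in> U \<Longrightarrow> j \<in> {1..n} \<Longrightarrow>
      lam' j t = u j t / (of_real (t - s) * interp_norm n k (\<lambda>j. lam j t))"
proof -
  \<comment> \<open>\<open>lam i ^ l * lam' i\<close> is the derivative of
    \<open>lam i ^ Suc l\<close> divided by \<open>Suc l\<close>, so the moments of the derivatives
    come from derivatives of power sums.\<close>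
  have w: "(\<lambda>t. \<Sum>i = 1..n. lam i t ^ l * lam' i t) \<in> asymp_alg U s" for l
  proof -
    obtain f' where f': "f' \<in> asymp_alg U s"
        "\<And>t. t \<in> U \<Longrightarrow> ((\<lambda>t. \<Sum>i = 1..n. lam i t ^ Suc l) has_vector_derivative f' t) (at t)"
      using power_sum_diff_alg[of "Suc l"] unfolding diff_alg_def by blast
    have "f' t = of_nat (Suc l) * (\<Sum>i = 1..n. lam i t ^ l * lam' i t)" if t: "t \<in> U" for t
    proof (rule vector_derivative_unique_at[OF f'(2)[OF t]])
      have "((\<lambda>t. lam i t ^ Suc l) has_vector_derivative of_nat (Suc l) * (lam i t ^ l * lam' i t)) (at t)"
        if "i \<in> {1..n}" for i
      proof -
        have "((\<lambda>z. z ^ Suc l) has_field_derivative of_nat (Suc l) * lam i t ^ l) (at (lam i t))"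
          by (rule DERIV_cong[OF DERIV_power[OF DERIV_ident]]) simp
        from field_vector_diff_chain_at[OF der[OF t that] this]
        show ?thesis by (simp add: o_def mult_ac del: power_Suc of_nat_Suc)
      qed
      then show "((\<lambda>t. \<Sum>i = 1..n. lam i t ^ Suc l) has_vector_derivative
          of_nat (Suc l) * (\<Sum>i = 1..n. lam i t ^ l * lam' i t)) (at t)"
        unfolding sum_distrib_left by (rule has_vector_derivative_sum)
    qed
    then have "\<And>t. t \<in> U \<Longrightarrow> 1 / of_nat (Suc l) * f' t = (\<Sum>i = 1..n. lam i t ^ l * lam' i t)"
      by (simp del: of_nat_Suc)
    then show ?thesis by (rule A.cong[OF A.mult[OF A.const f'(1)]])
  qed
  obtain F where F: "A.poly_over F" "\<And>t u. F t ((\<lambda>_. 0)(0 := u)) =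
      (\<Sum>i = 1..n. interp_kernel n k (\<lambda>j. lam j t) u (lam i t) * lam' i t)"
    using poly_over_interp_sum[OF w] by blast
  obtain E where E: "A.poly_over E"
      "\<And>t j. E t ((\<lambda>_. 0)(0 := lam j t)) = interp_sum n k (\<lambda>j. lam j t) j"
    by (rule interp_sum_poly_over, rule that)
  let ?v = "\<lambda>t. vieta n (interp_sum n k (\<lambda>j. lam j t))"
  define R where "R t z = (\<Sum>m<n. (- 1) * ?v t m * E t z ^ (n - 1 - m))" for t z
  have R: "A.poly_over R"
    unfolding R_def
    by (intro A.poly_over_sum A.times A.poly_over_power E A.poly_over_const A.coeff vieta_interp_sum_asymp_alg)
  have factor: "interp_norm n k (\<lambda>j. lam j t) = interp_sum n k (\<lambda>j. lam j t) j * R t ((\<lambda>_. 0)(0 := lam j t))"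
    if j: "j \<in> {1..n}" for t j
  proof -
    let ?E = "interp_sum n k (\<lambda>j. lam j t)"
    have "0 = (\<Sum>m\<le>n. ?v t m * ?E j ^ (n - m))" by (rule vieta_root[OF j, symmetric])
    also have "\<dots> = ?v t n + (\<Sum>m<n. ?v t m * ?E j ^ (n - m))"
      by (simp add: lessThan_Suc_atMost[symmetric])
    finally have "?v t n = (\<Sum>m<n. - (?v t m * ?E j ^ (n - m)))"
      unfolding sum_negf by (simp add: eq_neg_iff_add_eq_0)
    also have "\<dots> = ?E j * (\<Sum>m<n. (- 1) * ?v t m * ?E j ^ (n - 1 - m))"
      unfolding sum_distrib_left
    proof (rule sum.cong[OF refl])
      fix m assume "m \<in> {..<n}"
      then have "n - m = Suc (n - 1 - m)" by simp
      then show "- (?v t m * ?E j ^ (n - m)) = ?E j * (- 1 * ?v t m * ?E j ^ (n - 1 - m))" by simp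
    qed
    finally show ?thesis unfolding R_def E(2) interp_norm_def .
  qed
  \<comment> \<open>The factor \<open>t - s\<close> normalizes the derivatives against
    \<open>1 / (t - s)\<close>, the threshold in the one-sided estimate.\<close>
  define V where "V t z = of_real (t - s) * (F t z * R t z)" for t z
  have V: "A.poly_over V"
    unfolding V_def by (intro A.times R F A.coeff asymp_alg_ident)
  define u where "u j t = V t ((\<lambda>_. 0)(0 := lam j t))" for j t
  show ?thesis
  proof (rule that[of u])
    show "continuous_on U (u j)" if "j \<in> {1..n}" for j
      unfolding u_def by (rule poly_over_continuous[OF V that])
    show "(\<lambda>t. vieta n (\<lambda>i. u i t) m) \<in> asymp_alg U s" for m
      unfolding u_def by (rule A.vieta_poly_over[OF V power_sum_asymp_alg])
    fix t j assume t: "t \<in> U" and j: "j \<in> {1..n}"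
    have n: "1 \<le> n" using j by simp
    \<comment> \<open>Interpolation at the distinct roots needs a weight that depends on the root
      only: coinciding roots coincide on a whole neighbourhood and so share their
      derivative.\<close>
    have eqd: "lam' i t = lam' j t" if i: "i \<in> {1..n}" and eq: "lam i t = lam j t" for i
    proof -
      have roots: "root_tuple n (\<Prod>i = 1..n. [:- lam i t, 1:]) (\<lambda>j. lam j t)" for t
        by (simp add: root_tuple_def poly_prod)
      have "\<forall>\<^sub>F r in nhds t. \<forall>i\<in>{1..n}. \<forall>j\<in>{1..n}. lam i r = lam j r \<longleftrightarrow> lam i t = lam j t"
        by (rule eventually_eq_iff[OF U(1) t cont roots card_eq[OF _ n]])
      then have "\<forall>\<^sub>F r in nhds t. lam i r = lam j r"
        by eventually_elim (use i j eq in blast)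
      then have "(lam j has_vector_derivative lam' i t) (at t)"
        using der[OF t i] eq
        by (subst has_vector_derivative_cong_ev[where g = "lam i" and S = UNIV])
          (auto elim: eventually_mono)
      then show ?thesis by (rule vector_derivative_unique_at) (rule der[OF t j])
    qed
    have "F t ((\<lambda>_. 0)(0 := lam j t)) = interp_sum n k (\<lambda>j. lam j t) j * lam' j t"
      unfolding F(2) interp_sum_def by (rule interp_kernel_weighted_sum[OF k card_le[OF t] j,
          where w = "\<lambda>j. lam' j t", OF eqd])
    then have "u j t = of_real (t - s) * interp_norm n k (\<lambda>j. lam j t) * lam' j t"
      unfolding u_def V_def factor[OF j, of t] by (simp only: mult_ac)
    moreover have "of_real (t - s) \<noteq> (0 :: complex)" using t U(2) by auto
    ultimately show "lam' j t = u j t / (of_real (t - s) * interp_norm n k (\<lambda>j. lam j t))"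
      using norm_nonzero[OF t] by (simp del: of_real_diff)
  qed
qed

end

end

section \<open>Local estimates at a point\<close>

lemma signed_powr_has_derivative:
  assumes "x \<noteq> 0"
  shows "(signed_powr \<gamma> has_real_derivative \<gamma> * \<bar>x\<bar> powr (\<gamma> - 1)) (at x)"
proof (cases "x > 0")
  case True
  have "((\<lambda>x. x powr \<gamma>) has_real_derivative \<gamma> * \<bar>x\<bar> powr (\<gamma> - 1)) (at x)"
    using has_real_derivative_powr[OF True, of \<gamma>] True by simp
  then show ?thesis
    by (rule has_field_derivative_transform_within_open[of _ _ _ "{0<..}"])
      (use True in \<open>auto simp: signed_powr_def\<close>)
next
  case False
  then have x: "- x > 0" using assms by simp
  have "((\<lambda>x. - ((- x) powr \<gamma>)) has_real_derivative \<gamma> * \<bar>x\<bar> powr (\<gamma> - 1)) (at x)"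
    using x by (auto intro!: derivative_eq_intros simp: powr_diff field_simps)
  then show ?thesis
    by (rule has_field_derivative_transform_within_open[of _ _ _ "{..<0}"])
      (use x in \<open>auto simp: signed_powr_def\<close>)
qed

lemma signed_powr_continuous:
  assumes "\<gamma> > 0"
  shows "continuous_on A (signed_powr \<gamma>)"
proof -
  have "isCont (signed_powr \<gamma>) x" for x
  proof (cases "x = 0")
    case False
    then show ?thesis using signed_powr_has_derivative DERIV_isCont by blast
  next
    case True
    have "((\<lambda>x. \<bar>x\<bar> powr \<gamma>) \<longlongrightarrow> \<bar>0\<bar> powr \<gamma>) (at (0::real))"
      using assms by (intro tendsto_powr' tendsto_intros) auto
    then have "((\<lambda>x. \<bar>x\<bar> powr \<gamma>) \<longlongrightarrow> 0) (at (0::real))" by simp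
    then have "(signed_powr \<gamma> \<longlongrightarrow> 0) (at 0)"
      by (rule Lim_null_comparison[rotated]) (auto simp: signed_powr_def intro!: always_eventually)
    then show ?thesis using True by (simp add: isCont_def signed_powr_def)
  qed
  then show ?thesis by (simp add: continuous_at_imp_continuous_on)
qed

text \<open>The mean value inequality against the majorant
  \<open>C / \<gamma> * signed_powr \<gamma> (t - s)\<close>. If \<open>s\<close> is an interior
  point of the segment, the segment is split there, since differentiability is assumed only away
  from \<open>s\<close>.\<close>

lemma increment_le_signed_powr:
  fixes f g :: "real \<Rightarrow> complex"
  assumes \<gamma>: "\<gamma> > 0" and S: "is_interval S" and cont: "continuous_on S f"
    and der: "\<And>t. t \<in> S \<Longrightarrow> t \<noteq> s \<Longrightarrow> (f has_vector_derivative g t) (at t)"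
    and bound: "\<And>t. t \<in> S \<Longrightarrow> t \<noteq> s \<Longrightarrow> norm (g t) \<le> C * \<bar>t - s\<bar> powr (\<gamma> - 1)"
    and uv: "u \<in> S" "v \<in> S" "u \<le> v"
  shows "norm (f v - f u) \<le> C / \<gamma> * (signed_powr \<gamma> (v - s) - signed_powr \<gamma> (u - s))"
proof -
  have one: "norm (f v - f u) \<le> C / \<gamma> * (signed_powr \<gamma> (v - s) - signed_powr \<gamma> (u - s))"
    if uv: "u \<in> S" "v \<in> S" "u \<le> v" and s: "s \<notin> {u<..<v}" for u v
  proof (cases "u = v")
    case False
    then have lt: "u < v" using uv by simp
    have sub: "{u..v} \<subseteq> S" using mem_is_interval_1_I[OF S uv(1,2)] by auto
    have "norm (f v - f u) \<le> C / \<gamma> * signed_powr \<gamma> (v - s) - C / \<gamma> * signed_powr \<gamma> (u - s)"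
    proof (rule differentiable_bound_general[OF lt])
      show "continuous_on {u..v} f" by (rule continuous_on_subset[OF cont sub])
      show "continuous_on {u..v} (\<lambda>t. C / \<gamma> * signed_powr \<gamma> (t - s))"
        by (intro continuous_intros continuous_on_compose2[OF signed_powr_continuous[OF \<gamma>, of UNIV]]) auto
      fix x assume x: "u < x" "x < v"
      then have xs: "x \<noteq> s" "x \<in> S" using s sub by auto
      show "(f has_vector_derivative g x) (at x)" by (rule der[OF xs(2,1)])
      show "norm (g x) \<le> C * \<bar>x - s\<bar> powr (\<gamma> - 1)" by (rule bound[OF xs(2,1)])
      have "((\<lambda>t. C / \<gamma> * signed_powr \<gamma> (t - s)) has_real_derivative
          C / \<gamma> * (\<gamma> * \<bar>x - s\<bar> powr (\<gamma> - 1) * (1 - 0))) (at x)"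
        by (intro DERIV_cmult DERIV_chain2[OF signed_powr_has_derivative] DERIV_diff DERIV_ident DERIV_const)
          (use xs in simp)
      then show "((\<lambda>t. C / \<gamma> * signed_powr \<gamma> (t - s)) has_vector_derivative C * \<bar>x - s\<bar> powr (\<gamma> - 1)) (at x)"
        using \<gamma> by (simp add: has_real_derivative_iff_has_vector_derivative)
    qed
    then show ?thesis by (simp add: right_diff_distrib)
  qed simp
  show ?thesis
  proof (cases "s \<in> {u<..<v}")
    case False
    then show ?thesis using one uv by blast
  next
    case True
    then have "s \<in> S" using mem_is_interval_1_I[OF S uv(1,2), of s] by simp
    then have "norm (f s - f u) \<le> C / \<gamma> * (signed_powr \<gamma> (s - s) - signed_powr \<gamma> (u - s))"
      "norm (f v - f s) \<le> C / \<gamma> * (signed_powr \<gamma> (v - s) - signed_powr \<gamma> (s - s))"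
      using one[of u s] one[of s v] uv True by auto
    moreover have "norm (f v - f u) \<le> norm (f v - f s) + norm (f s - f u)"
      using norm_triangle_ineq[of "f v - f s" "f s - f u"] by simp
    ultimately show ?thesis by (simp add: algebra_simps)
  qed
qed

section \<open>Reduction of either side of a point to the right of 0\<close>

lemma filterlim_side:
  fixes s \<sigma> :: real
  assumes "\<And>t. t \<in> {0<..<\<epsilon>} \<Longrightarrow> s + \<sigma> * t \<in> U" "s \<notin> U"
  shows "filterlim (\<lambda>t. s + \<sigma> * t) (at s within U) (at 0 within {0<..<\<epsilon>})"
proof -
  have "((\<lambda>t. s + \<sigma> * t) \<longlongrightarrow> s + \<sigma> * 0) (at 0 within {0<..<\<epsilon>})" by (intro tendsto_intros)
  moreover have "\<forall>\<^sub>F t in at 0 within {0<..<\<epsilon>}. s + \<sigma> * t \<in> U \<and> s + \<sigma> * t \<noteq> s"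
    unfolding eventually_at_filter using assms by (intro always_eventually) fastforce
  ultimately show ?thesis by (simp add: filterlim_at)
qed

lemma asymp_alg_side:
  assumes f: "f \<in> asymp_alg U s" and \<sigma>: "\<bar>\<sigma>\<bar> = 1"
    and U: "\<And>t. t \<in> {0<..<\<epsilon>} \<Longrightarrow> s + \<sigma> * t \<in> U" "s \<notin> U"
  shows "(\<lambda>t. f (s + \<sigma> * t)) \<in> asymp_alg {0<..<\<epsilon>} 0"
  unfolding asymp_alg_def
proof (intro CollectI conjI allI)
  have "continuous_on U f" using f by (simp add: asymp_alg_def)
  then show "continuous_on {0<..<\<epsilon>} (\<lambda>t. f (s + \<sigma> * t))"
    by (rule continuous_on_compose2) (use U in \<open>auto intro!: continuous_intros\<close>)
  fix M
  let ?F = "at 0 within {0<..<\<epsilon>}"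
  obtain q where "(\<lambda>t. f t - poly q (of_real (t - s))) \<in> O[at s within U](\<lambda>t. of_real (t - s) ^ M)"
    using f unfolding asymp_alg_def by blast
  from landau_o.big.compose[OF this filterlim_side[of \<epsilon> s \<sigma> U, OF U]]
  have "(\<lambda>t. f (s + \<sigma> * t) - poly q (of_real (\<sigma> * t))) \<in> O[?F](\<lambda>t. of_real (\<sigma> * t) ^ M)" by simp
  also have "(\<lambda>t. of_real (\<sigma> * t) ^ M :: complex) \<in> O[?F](\<lambda>t. of_real (t - 0) ^ M)"
    by (rule bigoI[of _ 1]) (use \<sigma> in \<open>auto simp: norm_power norm_mult intro!: always_eventually\<close>)
  also have "(\<lambda>t. f (s + \<sigma> * t) - poly q (of_real (\<sigma> * t))) =
      (\<lambda>t. f (s + \<sigma> * t) - poly (pcompose q [:0, of_real \<sigma>:]) (of_real (t - 0)))"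
    by (simp add: poly_pcompose mult.commute)
  finally show "\<exists>q. (\<lambda>t. f (s + \<sigma> * t) - poly q (of_real (t - 0))) \<in> O[?F](\<lambda>t. of_real (t - 0) ^ M)" ..
qed

text \<open>For \<sigma> = 1 or -1 the points \<open>s + \<sigma> * t\<close> run through one side
  of \<open>s\<close>. The sign changes the leading coefficient of \<open>D\<close> to
  \<open>d * \<sigma> ^ p\<close> and multiplies the derivatives by a factor of modulus 1.\<close>

lemma side_estimate:
  fixes u lam lam' :: "nat \<Rightarrow> real \<Rightarrow> complex" and D :: "real \<Rightarrow> complex"
  assumes e: "\<epsilon> > 0" and \<sigma>: "\<bar>\<sigma>\<bar> = 1"
    and U: "\<And>t. t \<in> {0<..<\<epsilon>} \<Longrightarrow> s + \<sigma> * t \<in> U" "s \<notin> U"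
    and cont: "\<And>j. j \<in> {1..n} \<Longrightarrow> continuous_on U (u j)"
    and coeffs: "\<And>m. (\<lambda>t. vieta n (\<lambda>i. u i t) m) \<in> asymp_alg U s"
    and D: "((\<lambda>t. D t / of_real (t - s) ^ p) \<longlongrightarrow> d) (at s within U)" "d \<noteq> 0"
    and der: "\<And>t j. t \<in> U \<Longrightarrow> j \<in> {1..n} \<Longrightarrow> (lam j has_vector_derivative lam' j t) (at t)"
    and eq: "\<And>t j. t \<in> U \<Longrightarrow> j \<in> {1..n} \<Longrightarrow> lam' j t = u j t / (of_real (t - s) * D t)"
    and bd: "\<And>t j. t \<in> U \<Longrightarrow> j \<in> {1..n} \<Longrightarrow> norm (lam j t) \<le> K"
  shows "\<exists>\<gamma>>0. \<exists>C\<ge>0. \<forall>\<^sub>F t in at_right 0. \<forall>j\<in>{1..n}. norm (lam' j (s + \<sigma> * t)) \<le> C * t powr (\<gamma> - 1)"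
proof -
  have F: "at 0 within {0<..<\<epsilon>} = at_right 0" using e by (rule at_right_eq_at_within)
  have \<sigma>2: "complex_of_real \<sigma> * of_real \<sigma> = 1"
    using \<sigma> by (metis abs_mult_self_eq mult_1 of_real_1 of_real_mult)
  have ders: "u j (s + \<sigma> * t) / (of_real t * D (s + \<sigma> * t)) = of_real \<sigma> * lam' j (s + \<sigma> * t)"
    if "j \<in> {1..n}" "t \<in> {0<..<\<epsilon>}" for j t
    unfolding eq[OF U(1)[OF that(2)] that(1)] using \<sigma> that(2) \<sigma>2 by (simp add: field_simps)
  have "\<exists>\<gamma>>0. \<exists>C\<ge>0. \<forall>\<^sub>F t in at_right 0. \<forall>j\<in>{1..n}.
      norm (u j (s + \<sigma> * t) / (of_real t * D (s + \<sigma> * t))) \<le> C * t powr (\<gamma> - 1)"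
  proof (rule one_sided_estimate[OF e, where lam = "\<lambda>j t. lam j (s + \<sigma> * t)" and K = K and p = p
        and d = "d * of_real \<sigma> ^ p"])
    show "(\<lambda>t. vieta n (\<lambda>i. u i (s + \<sigma> * t)) m) \<in> asymp_alg {0<..<\<epsilon>} 0" for m
      by (rule asymp_alg_side[OF coeffs \<sigma> U])
    show "continuous_on {0<..<\<epsilon>} (\<lambda>t. u j (s + \<sigma> * t))" if "j \<in> {1..n}" for j
      by (rule continuous_on_compose2[OF cont[OF that]]) (use U in \<open>auto intro!: continuous_intros\<close>)
    show "d * of_real \<sigma> ^ p \<noteq> 0" using D(2) \<sigma> by auto
    have "((\<lambda>t. D (s + \<sigma> * t) / of_real (s + \<sigma> * t - s) ^ p) \<longlongrightarrow> d) (at_right 0)"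
      using filterlim_compose[OF D(1) filterlim_side[of \<epsilon> s \<sigma> U, OF U]] unfolding F .
    then have "((\<lambda>t. D (s + \<sigma> * t) / of_real (s + \<sigma> * t - s) ^ p * of_real \<sigma> ^ p) \<longlongrightarrow> d * of_real \<sigma> ^ p) (at_right 0)"
      by (intro tendsto_mult tendsto_const)
    moreover have "D (s + \<sigma> * t) / of_real (s + \<sigma> * t - s) ^ p * of_real \<sigma> ^ p = D (s + \<sigma> * t) / of_real t ^ p" for t
    proof -
      have "\<sigma> \<noteq> 0" using \<sigma> by auto
      then show ?thesis by (simp add: power_mult_distrib field_simps)
    qed
    ultimately show "((\<lambda>t. D (s + \<sigma> * t) / of_real t ^ p) \<longlongrightarrow> d * of_real \<sigma> ^ p) (at_right 0)"
      by simp
    fix j t assume j: "j \<in> {1..n}" and t: "t \<in> {0<..<\<epsilon>}"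
    show "norm (lam j (s + \<sigma> * t)) \<le> K" by (rule bd[OF U(1)[OF t] j])
    have "((\<lambda>t. s + \<sigma> * t) has_vector_derivative \<sigma>) (at t)"
      by (auto intro!: derivative_eq_intros)
    from vector_diff_chain_at[OF this der[OF U(1)[OF t] j]]
    show "((\<lambda>t. lam j (s + \<sigma> * t)) has_vector_derivative u j (s + \<sigma> * t) / (of_real t * D (s + \<sigma> * t))) (at t)"
      unfolding ders[OF j t] by (simp add: o_def scaleR_conv_of_real)
  qed
  then obtain \<gamma> C where \<gamma>: "\<gamma> > 0" "C \<ge> 0" and ev: "\<forall>\<^sub>F t in at_right 0. \<forall>j\<in>{1..n}.
      norm (u j (s + \<sigma> * t) / (of_real t * D (s + \<sigma> * t))) \<le> C * t powr (\<gamma> - 1)" by blast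
  have "\<forall>\<^sub>F t in at_right 0. \<forall>j\<in>{1..n}. norm (lam' j (s + \<sigma> * t)) \<le> C * t powr (\<gamma> - 1)"
    using ev eventually_at_right_real[OF e]
  proof eventually_elim
    case (elim t)
    show ?case
    proof
      fix j assume j: "j \<in> {1..n}"
      have "norm (lam' j (s + \<sigma> * t)) = norm (u j (s + \<sigma> * t) / (of_real t * D (s + \<sigma> * t)))"
        unfolding ders[OF j elim(2)] using \<sigma> by (simp add: norm_mult)
      then show "norm (lam' j (s + \<sigma> * t)) \<le> C * t powr (\<gamma> - 1)" using elim(1) j by simp
    qed
  qed
  with \<gamma> show ?thesis by blast
qed

text \<open>The quotient by \<open>(t - s) ^ p\<close>, extended by 0 at \<open>s\<close>, is the
  continuous cofactor; the exponent \<open>Suc p\<close> in the bound makes it tend to 0. That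
  \<open>f\<close> vanishes at \<open>s\<close> follows from continuity, as \<open>s\<close> is a
  limit point of \<open>I\<close>.\<close>

lemma flatness_infinite:
  fixes f :: "real \<Rightarrow> complex"
  assumes cont: "continuous_on I f" and s: "s \<in> I" "at s within I \<noteq> bot"
    and small: "\<And>p. \<exists>C. \<exists>\<delta>>0. \<forall>t\<in>I. t \<noteq> s \<and> dist t s < \<delta> \<longrightarrow> norm (f t) \<le> C * \<bar>t - s\<bar> ^ Suc p"
  shows "flatness I s f = \<infinity>"
proof -
  have small0: "((\<lambda>t. f t / of_real ((t - s) ^ p)) \<longlongrightarrow> 0) (at s within I)" for p
  proof -
    obtain C \<delta> where C: "\<delta> > 0" "\<And>t. t \<in> I \<Longrightarrow> t \<noteq> s \<Longrightarrow> dist t s < \<delta> \<Longrightarrow> norm (f t) \<le> C * \<bar>t - s\<bar> ^ Suc p"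
      using small[of p] by blast
    show ?thesis
    proof (rule Lim_null_comparison)
      have "((\<lambda>t. C * \<bar>t - s\<bar>) \<longlongrightarrow> C * \<bar>s - s\<bar>) (at s within I)" by (intro tendsto_intros)
      then show "((\<lambda>t. C * \<bar>t - s\<bar>) \<longlongrightarrow> 0) (at s within I)" by simp
      show "\<forall>\<^sub>F t in at s within I. norm (f t / of_real ((t - s) ^ p)) \<le> C * \<bar>t - s\<bar>"
        unfolding eventually_at
      proof (intro exI[of _ \<delta>] conjI C(1) ballI impI, elim conjE)
        fix t assume t: "t \<in> I" "t \<noteq> s" "dist t s < \<delta>"
        then have "norm (f t) \<le> C * \<bar>t - s\<bar> * \<bar>t - s\<bar> ^ p" using C(2)[OF t] by (simp add: mult.assoc)
        then show "norm (f t / of_real ((t - s) ^ p)) \<le> C * \<bar>t - s\<bar>"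
          using t(2) by (simp add: norm_divide norm_power divide_le_eq power_abs del: of_real_power)
      qed
    qed
  qed
  have "(f \<longlongrightarrow> f s) (at s within I)" using cont s(1) by (auto simp: continuous_on_def)
  moreover have "(f \<longlongrightarrow> 0) (at s within I)" using small0[of 0] by simp
  ultimately have fs: "f s = 0" using s(2) tendsto_unique by blast
  have mem: "enat p \<le> flatness I s f" for p
    unfolding flatness_def
  proof (intro Sup_upper CollectI exI[of _ p] conjI refl)
    define g where "g t = (if t = s then 0 else f t / of_real ((t - s) ^ p))" for t
    show "\<exists>U g. open U \<and> s \<in> U \<and> continuous_on (I \<inter> U) g \<and> (\<forall>t\<in>I \<inter> U. f t = of_real ((t - s) ^ p) * g t)"
    proof (intro exI[of _ UNIV] exI[of _ g] conjI ballI)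
      show "continuous_on (I \<inter> UNIV) g"
        unfolding continuous_on_def
      proof
        fix x assume x: "x \<in> I \<inter> UNIV"
        show "(g \<longlongrightarrow> g x) (at x within I \<inter> UNIV)"
        proof (cases "x = s")
          case True
          have "\<forall>\<^sub>F t in at s within I. f t / of_real ((t - s) ^ p) = g t"
            by (auto simp: eventually_at_filter g_def)
          with small0[of p] have "(g \<longlongrightarrow> 0) (at s within I)" by (rule Lim_transform_eventually)
          then show ?thesis by (simp add: g_def True)
        next
          case False
          have "(f \<longlongrightarrow> f x) (at x within I)" using cont x by (auto simp: continuous_on_def)
          then have "((\<lambda>t. f t / of_real ((t - s) ^ p)) \<longlongrightarrow> f x / of_real ((x - s) ^ p)) (at x within I)"
            using False by (intro tendsto_intros) auto
          moreover have "\<forall>\<^sub>F t in at x within I. f t / of_real ((t - s) ^ p) = g t"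
            using eventually_neq_at_within[of s x I] by eventually_elim (simp add: g_def)
          ultimately have "(g \<longlongrightarrow> f x / of_real ((x - s) ^ p)) (at x within I)"
            by (rule Lim_transform_eventually)
          then show ?thesis using False by (simp add: g_def)
        qed
      qed
      show "f t = of_real ((t - s) ^ p) * g t" for t by (simp add: g_def fs)
    qed auto
  qed
  show ?thesis
  proof (rule ccontr)
    assume "flatness I s f \<noteq> \<infinity>"
    then obtain p where "flatness I s f = enat p" by auto
    then show False using mem[of "Suc p"] by simp
  qed
qed

section \<open>Neighbourhoods of interior points and endpoints, and data of the given curve\<close>

lemma interval_sides:
  fixes I :: "real set"
  assumes "is_interval I" "s \<in> I"
  obtains e where "e > 0" "{s<..<s + e} \<subseteq> I \<or> I \<inter> {s<..} = {}" "{s - e<..<s} \<subseteq> I \<or> I \<inter> {..<s} = {}"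
proof -
  have I: "x \<in> I" if "a \<in> I" "b \<in> I" "a \<le> x" "x \<le> b" for a b x
    by (rule mem_is_interval_1_I[OF assms(1) that])
  have "\<exists>e>0. {s<..<s + e} \<subseteq> I \<or> I \<inter> {s<..} = {}"
  proof (cases "I \<inter> {s<..} = {}")
    case False
    then obtain b where "b \<in> I" "s < b" by auto
    then show ?thesis using I[OF assms(2), of b] by (intro exI[of _ "b - s"]) auto
  qed (auto intro: exI[of _ 1])
  then obtain e1 where e1: "e1 > 0" "{s<..<s + e1} \<subseteq> I \<or> I \<inter> {s<..} = {}" by blast
  have "\<exists>e>0. {s - e<..<s} \<subseteq> I \<or> I \<inter> {..<s} = {}"
  proof (cases "I \<inter> {..<s} = {}")
    case False
    then obtain b where "b \<in> I" "b < s" by auto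
    then show ?thesis using I[of b, OF _ assms(2)] by (intro exI[of _ "s - b"]) auto
  qed (auto intro: exI[of _ 1])
  then obtain e2 where e2: "e2 > 0" "{s - e2<..<s} \<subseteq> I \<or> I \<inter> {..<s} = {}" by blast
  show ?thesis
  proof (rule that[of "min e1 e2"])
    have "{s<..<s + min e1 e2} \<subseteq> {s<..<s + e1}" "{s - min e1 e2<..<s} \<subseteq> {s - e2<..<s}" by auto
    then show "{s<..<s + min e1 e2} \<subseteq> I \<or> I \<inter> {s<..} = {}" "{s - min e1 e2<..<s} \<subseteq> I \<or> I \<inter> {..<s} = {}"
      using e1(2) e2(2) by blast+
  qed (use e1 e2 in simp)
qed

lemma vieta_poly_curve:
  assumes "root_tuple n (poly_curve n a t) x" "m \<in> {1..n}"
  shows "vieta n x m = (-1) ^ m * a m t"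
proof -
  define c where "c m = (if m = 0 then 1 else (-1) ^ m * a m t)" for m
  have "vieta n x m = c m"
  proof (rule vieta_unique)
    fix z
    have ins: "{..n} = insert 0 {1..n}" by auto
    have "(\<Prod>i = 1..n. z - x i) = poly (poly_curve n a t) z"
      using assms(1) by (simp add: root_tuple_def)
    also have "\<dots> = z ^ n + (\<Sum>m = 1..n. c m * z ^ (n - m))"
      unfolding poly_curve_def by (simp add: poly_sum poly_monom c_def)
    also have "\<dots> = (\<Sum>m\<le>n. c m * z ^ (n - m))"
      unfolding ins by (simp add: c_def)
    finally show "(\<Prod>i = 1..n. z - x i) = (\<Sum>m\<le>n. c m * z ^ (n - m))" .
  qed (use assms in simp)
  then show ?thesis using assms(2) by (simp add: c_def)
qed

text \<open>Guarantees for \<open>n \<ge> 1\<close> that some germ is nonzero, so that a maximal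
  \<open>k\<close> as in the genericity condition exists.\<close>

lemma Delta_roots_1: "Delta_roots n 1 x = of_nat n"
proof -
  have "(\<Prod>(p, q)\<in>{(p, q). p \<in> S \<and> q \<in> S \<and> p < q}. (x p - x q)\<^sup>2) = 1"
    if "card S = 1" for S :: "nat set"
  proof -
    have "{(p, q). p \<in> S \<and> q \<in> S \<and> p < q} = {}" using that by (auto simp: card_1_singleton_iff)
    then show ?thesis by (simp only: prod.empty)
  qed
  then have "Delta_roots n 1 x = (\<Sum>S | S \<subseteq> {1..n} \<and> card S = 1. 1)"
    unfolding Delta_roots_def by (intro sum.cong refl) simp
  also have "\<dots> = of_nat (card {S. S \<subseteq> {1..n} \<and> card S = 1})" by simp
  also have "card {S. S \<subseteq> {1..n} \<and> card S = 1} = n"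
    using n_subsets[of "{1..n}" 1] by simp
  finally show ?thesis .
qed

lemma smooth_on_diff_alg:
  assumes I: "is_interval I" "s \<in> I" and U: "U \<subseteq> I" "open U" and f: "smooth_on I f"
  shows "f \<in> diff_alg U s"
proof -
  interpret function_algebra U "diff_alg U s" by (rule function_algebra_diff_alg[OF U(2)])
  obtain D where D: "\<forall>t\<in>I. D 0 t = f t"
      "\<And>k t. t \<in> I \<Longrightarrow> (D k has_vector_derivative D (Suc k) t) (at t within I)"
    using f unfolding smooth_on_def by blast
  have asymp: "D k \<in> asymp_alg U s" for k
    by (rule derivatives_asymp_alg[where D = D, OF I U(1) D(2)])
  have "(D 0 has_vector_derivative D (Suc 0) t) (at t)" if "t \<in> U" for t
    using has_vector_derivative_within_subset[OF D(2) U(1), of t 0] that U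
    by (simp add: at_within_open[OF that U(2)] subset_iff)
  then have "D 0 \<in> diff_alg U s" unfolding diff_alg_def using asymp by blast
  then show ?thesis by (rule cong) (use D(1) U(1) in blast)
qed

lemma eventually_zero_germs:
  assumes "finite L" "\<And>l. l \<in> L \<Longrightarrow> zero_germ I s (f l)"
  shows "\<forall>\<^sub>F t in nhds s. \<forall>l\<in>L. t \<in> I \<longrightarrow> f l t = 0"
proof (intro eventually_ball_finite assms(1) ballI)
  fix l assume "l \<in> L"
  then obtain V where "open V" "s \<in> V" "\<forall>t\<in>I \<inter> V. f l t = 0"
    using assms(2) unfolding zero_germ_def by blast
  then show "\<forall>\<^sub>F t in nhds s. t \<in> I \<longrightarrow> f l t = 0"
    unfolding eventually_nhds by blast
qed

text \<open>Near \<open>s\<close> the interval contains a whole side or nothing of it. Without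
  \<open>s\<close> the neighbourhood is thus open even if \<open>s\<close> is an endpoint, and
  derivatives on it are two-sided.\<close>

lemma punctured_ball_open:
  fixes I :: "real set"
  assumes "0 < r" "r \<le> e"
    and sides: "{s<..<s + e} \<subseteq> I \<or> I \<inter> {s<..} = {}" "{s - e<..<s} \<subseteq> I \<or> I \<inter> {..<s} = {}"
  shows "open (I \<inter> ball s r - {s})"
proof -
  show ?thesis
  proof (subst open_subopen, intro ballI)
    fix x assume x: "x \<in> I \<inter> ball s r - {s}"
    have sub: "{s<..<s + r} \<subseteq> {s<..<s + e}" "{s - r<..<s} \<subseteq> {s - e<..<s}"
      using assms(2) by (intro greaterThanLessThan_subseteq_greaterThanLessThan[THEN iffD2]; simp)+
    consider "s < x" "x < s + r" | "x < s" "s - r < x"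
      using x by (cases x s rule: linorder_cases) (auto simp: dist_real_def)
    then show "\<exists>T. open T \<and> x \<in> T \<and> T \<subseteq> I \<inter> ball s r - {s}"
    proof cases
      case 1
      then have "I \<inter> {s<..} \<noteq> {}" using x by blast
      then have "{s<..<s + r} \<subseteq> I" using sides(1) sub(1) by blast
      then have "{s<..<s + r} \<subseteq> I \<inter> ball s r - {s}" by (auto simp: dist_real_def)
      then show ?thesis using 1 by (intro exI[of _ "{s<..<s + r}"]) simp
    next
      case 2
      then have "I \<inter> {..<s} \<noteq> {}" using x by blast
      then have "{s - r<..<s} \<subseteq> I" using sides(2) sub(2) by blast
      then have "{s - r<..<s} \<subseteq> I \<inter> ball s r - {s}" by (auto simp: dist_real_def)
      then show ?thesis using 2 by (intro exI[of _ "{s - r<..<s}"]) simp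
    qed
  qed
qed

lemma punctured_ball_limit_point:
  fixes I :: "real set"
  assumes "0 < r" "is_interval I" "s \<in> I" "t \<in> I" "t \<noteq> s"
  shows "at s within (I \<inter> ball s r - {s}) \<noteq> bot"
proof -
  have "s islimpt (I \<inter> ball s r - {s})"
    unfolding islimpt_approachable
  proof (intro allI impI)
    fix e :: real assume "0 < e"
    define d where "d = min (min e r) \<bar>t - s\<bar> / 2"
    have "0 < min (min e r) \<bar>t - s\<bar>" using \<open>0 < e\<close> assms(1,5) by simp
    moreover have "min (min e r) \<bar>t - s\<bar> \<le> e" "min (min e r) \<bar>t - s\<bar> \<le> r"
      "min (min e r) \<bar>t - s\<bar> \<le> \<bar>t - s\<bar>" by auto
    ultimately have d: "0 < d" "d < e" "d < r" "d < \<bar>t - s\<bar>" unfolding d_def by linarith+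
    define x where "x = (if s < t then s + d else s - d)"
    have "x \<in> I"
      using d assms(5) mem_is_interval_1_I[OF assms(2,3,4), of x] mem_is_interval_1_I[OF assms(2,4,3), of x]
      by (auto simp: x_def)
    then show "\<exists>x'\<in>I \<inter> ball s r - {s}. x' \<noteq> s \<and> dist x' s < e"
      using d by (intro bexI[of _ x]) (auto simp: x_def dist_real_def)
  qed
  then show ?thesis by (simp add: trivial_limit_within)
qed

text \<open>The germs beyond the maximal \<open>k\<close> vanish, which limits the number of
  distinct roots. The last conclusion negates that bounds of all orders hold, with the constants
  given as a function \<open>C\<close> of the order.\<close>

lemma generic_Delta_order:
  assumes gen: "generic_curve I n (poly_curve n a)"
    and par: "continuous_root_param I n (poly_curve n a) lam"
    and s: "s \<in> I" "at s within I \<noteq> bot" and n: "1 \<le> n"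
  obtains k where "1 \<le> k" "\<forall>\<^sub>F t in nhds s. t \<in> I \<longrightarrow> card ((\<lambda>j. lam j t) ` {1..n}) \<le> k"
    "\<And>C. \<exists>p. \<not> (\<exists>\<delta>>0. \<forall>t\<in>I. t \<noteq> s \<and> dist t s < \<delta> \<longrightarrow>
        norm (Delta_roots n k (\<lambda>j. lam j t)) \<le> C p * \<bar>t - s\<bar> ^ Suc p)"
proof -
  let ?D = "\<lambda>k t. Delta k (poly_curve n a t)"
  have D: "?D k t = Delta_roots n k (\<lambda>j. lam j t)" if "t \<in> I" for k t
    using par that unfolding continuous_root_param_def by (intro Delta_eq) blast
  define K where "K = {k \<in> {1..n}. \<not> zero_germ I s (?D k)}"
  have "\<not> zero_germ I s (?D 1)"
    using s(1) n by (auto simp: zero_germ_def D Delta_roots_1[simplified])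
  then have K: "finite K" "K \<noteq> {}" using n by (auto simp: K_def)
  define k where "k = Max K"
  have "k \<in> K" unfolding k_def using K by (rule Max_in)
  have zero: "zero_germ I s (?D l)" if "l \<in> {k<..n}" for l
  proof (rule ccontr)
    assume "\<not> zero_germ I s (?D l)"
    then have "l \<in> K" using that by (auto simp: K_def)
    then show False using Max_ge[OF K(1), of l] that by (simp add: k_def)
  qed
  have flat: "flatness I s (?D k) \<noteq> \<infinity>"
    using gen s(1) \<open>k \<in> K\<close> zero unfolding generic_curve_def K_def by blast
  have cont: "continuous_on I (?D k)"
  proof (rule continuous_on_eq)
    show "continuous_on I (\<lambda>t. Delta_roots n k (\<lambda>j. lam j t))"
      unfolding Delta_roots_def case_prod_unfold using par unfolding continuous_root_param_def
      by (intro continuous_intros) auto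
  qed (simp add: D)
  show ?thesis
  proof (rule that[of k])
    show "1 \<le> k" using \<open>k \<in> K\<close> by (simp add: K_def)
    have "\<forall>\<^sub>F t in nhds s. \<forall>l\<in>{k<..n}. t \<in> I \<longrightarrow> ?D l t = 0"
      by (rule eventually_zero_germs) (use zero in auto)
    then show "\<forall>\<^sub>F t in nhds s. t \<in> I \<longrightarrow> card ((\<lambda>j. lam j t) ` {1..n}) \<le> k"
    proof eventually_elim
      case (elim t)
      show ?case
      proof
        assume t: "t \<in> I"
        show "card ((\<lambda>j. lam j t) ` {1..n}) \<le> k"
          by (rule card_roots_le) (use elim t D[OF t] in simp)
      qed
    qed
    show "\<exists>p. \<not> (\<exists>\<delta>>0. \<forall>t\<in>I. t \<noteq> s \<and> dist t s < \<delta> \<longrightarrow>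
        norm (Delta_roots n k (\<lambda>j. lam j t)) \<le> C p * \<bar>t - s\<bar> ^ Suc p)" for C
    proof (rule ccontr)
      assume "\<not> ?thesis"
      then have "\<exists>\<delta>>0. \<forall>t\<in>I. t \<noteq> s \<and> dist t s < \<delta> \<longrightarrow> norm (?D k t) \<le> C p * \<bar>t - s\<bar> ^ Suc p" for p
        using D by metis
      then have "flatness I s (?D k) = \<infinity>" by (intro flatness_infinite[OF cont s]) blast
      with flat show False ..
    qed
  qed
qed

text \<open>Without a leading term at any order, the dichotomy makes \<open>interp_norm\<close>
  small to all orders; by \<open>norm_Delta_roots_power_le\<close> this passes to
  \<open>Delta_roots\<close>, against \<open>ord\<close>.\<close>

lemma interp_norm_order:
  fixes lam :: "nat \<Rightarrow> real \<Rightarrow> complex"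
  assumes asymp: "(\<lambda>t. interp_norm n k (\<lambda>j. lam j t)) \<in> asymp_alg U s"
    and U: "U = I \<inter> ball s e - {s}" "0 < e" and n: "1 \<le> n" "1 \<le> k"
    and card_le: "\<And>t. t \<in> U \<Longrightarrow> card ((\<lambda>j. lam j t) ` {1..n}) \<le> k"
    and ord: "\<And>C. \<exists>p. \<not> (\<exists>\<delta>>0. \<forall>t\<in>I. t \<noteq> s \<and> dist t s < \<delta> \<longrightarrow>
        norm (Delta_roots n k (\<lambda>j. lam j t)) \<le> C p * \<bar>t - s\<bar> ^ Suc p)"
  obtains p d where "d \<noteq> 0"
    "((\<lambda>t. interp_norm n k (\<lambda>j. lam j t) / of_real (t - s) ^ p) \<longlongrightarrow> d) (at s within U)"
proof (rule ccontr)
  let ?D = "\<lambda>t. interp_norm n k (\<lambda>j. lam j t)"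
  assume none: "\<not> thesis"
  have "\<exists>C. \<exists>\<delta>>0. \<forall>t\<in>I. t \<noteq> s \<and> dist t s < \<delta> \<longrightarrow>
        norm (Delta_roots n k (\<lambda>j. lam j t)) \<le> C * \<bar>t - s\<bar> ^ Suc p" for p
  proof -
    \<comment> \<open>The exponent has the factor \<open>n\<close> because the comparison concerns
      the \<open>n\<close>-th power of \<open>Delta_roots\<close>.\<close>
    have "?D \<in> O[at s within U](\<lambda>t. of_real (t - s) ^ (Suc p * n))"
      by (rule asymp_alg_dichotomy[OF asymp, of "Suc p * n"]) (use none that in blast)+
    then obtain c where "\<forall>\<^sub>F t in at s within U. norm (?D t) \<le> c * norm (complex_of_real (t - s) ^ (Suc p * n))"
      by (rule landau_o.bigE)
    then obtain r where r: "r > 0" "\<And>t. t \<in> U \<Longrightarrow> t \<noteq> s \<Longrightarrow> dist t s < r \<Longrightarrow>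
        norm (?D t) \<le> c * norm (complex_of_real (t - s) ^ (Suc p * n))"
      unfolding eventually_at by blast
    \<comment> \<open>At least 1, so that \<open>C \<le> C ^ n\<close> and the \<open>n\<close>-th
      root can be taken on both sides.\<close>
    define C where "C = max 1 (2 ^ (n * n) * c)"
    have C: "1 \<le> C" "2 ^ (n * n) * c \<le> C" by (auto simp: C_def)
    have "norm (Delta_roots n k (\<lambda>j. lam j t)) \<le> C * \<bar>t - s\<bar> ^ Suc p"
      if t: "t \<in> I" "t \<noteq> s" "dist t s < min r e" for t
    proof -
      have tU: "t \<in> U" using t U by (simp add: dist_commute)
      have "norm (?D t) \<le> c * \<bar>t - s\<bar> ^ (Suc p * n)"
        using r(2)[OF tU t(2)] t(3) by (simp add: norm_power flip: of_real_diff del: mult_Suc)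
      have "norm (Delta_roots n k (\<lambda>j. lam j t)) ^ n \<le> 2 ^ (n * n) * norm (?D t)"
        by (rule norm_Delta_roots_power_le[OF n(2) card_le[OF tU]])
      also have "\<dots> \<le> 2 ^ (n * n) * (c * \<bar>t - s\<bar> ^ (Suc p * n))"
        by (rule mult_left_mono) (fact, simp)
      also have "\<dots> = 2 ^ (n * n) * c * (\<bar>t - s\<bar> ^ Suc p) ^ n"
        by (simp only: power_mult mult.assoc)
      also have "\<dots> \<le> C ^ n * (\<bar>t - s\<bar> ^ Suc p) ^ n"
        using C self_le_power[of C n] n by (intro mult_right_mono order.trans[OF C(2)]) auto
      finally have "norm (Delta_roots n k (\<lambda>j. lam j t)) ^ n \<le> (C * \<bar>t - s\<bar> ^ Suc p) ^ n"
        by (simp only: power_mult_distrib)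
      then show ?thesis using n C by (subst (asm) power_mono_iff) auto
    qed
    then show ?thesis using r(1) U(2) by (intro exI[of _ C] exI[of _ "min r e"]) auto
  qed
  then obtain C where "\<And>p. \<exists>\<delta>>0. \<forall>t\<in>I. t \<noteq> s \<and> dist t s < \<delta> \<longrightarrow>
        norm (Delta_roots n k (\<lambda>j. lam j t)) \<le> C p * \<bar>t - s\<bar> ^ Suc p" by metis
  then show False using ord[of C] by blast
qed

text \<open>Genericity is applied at \<open>s\<close> alone, while differentiability is obtained at
  all nearby points other than \<open>s\<close>. The second point \<open>r\<close> makes
  \<open>s\<close> a limit point of \<open>I\<close>.\<close>

lemma derivative_bound_near:
  assumes I: "is_interval I" "s \<in> I" and n: "1 \<le> n"
    and smooth: "\<And>j. j \<in> {1..n} \<Longrightarrow> smooth_on I (a j)"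
    and gen: "generic_curve I n (poly_curve n a)"
    and par: "continuous_root_param I n (poly_curve n a) lam"
    and other: "r \<in> I" "r \<noteq> s"
  obtains \<gamma> C \<delta> lam' where "\<gamma> > 0" "C \<ge> 0" "\<delta> > 0"
    "\<And>j t. j \<in> {1..n} \<Longrightarrow> t \<in> I \<inter> ball s \<delta> \<Longrightarrow> t \<noteq> s \<Longrightarrow>
      (lam j has_vector_derivative lam' j t) (at t) \<and> norm (lam' j t) \<le> C * \<bar>t - s\<bar> powr (\<gamma> - 1)"
proof -
  have contI: "continuous_on I (lam j)" if "j \<in> {1..n}" for j
    using par that by (simp add: continuous_root_param_def)
  have roots: "root_tuple n (poly_curve n a t) (\<lambda>j. lam j t)" if "t \<in> I" for t
    using par that by (simp add: continuous_root_param_def)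
  have "at s within (I \<inter> ball s 1 - {s}) \<noteq> bot" by (rule punctured_ball_limit_point[OF _ I other]) simp
  moreover have "at s within (I \<inter> ball s 1 - {s}) \<le> at s within I" by (rule at_le) auto
  ultimately have lim: "at s within I \<noteq> bot" by (auto simp: le_bot)
  obtain k where k: "1 \<le> k" and ev_card: "\<forall>\<^sub>F t in nhds s. t \<in> I \<longrightarrow> card ((\<lambda>j. lam j t) ` {1..n}) \<le> k"
    and ord: "\<And>C. \<exists>p. \<not> (\<exists>\<delta>>0. \<forall>t\<in>I. t \<noteq> s \<and> dist t s < \<delta> \<longrightarrow>
        norm (Delta_roots n k (\<lambda>j. lam j t)) \<le> C p * \<bar>t - s\<bar> ^ Suc p)"
    using generic_Delta_order[OF gen par I(2) lim n] by blast
  obtain e0 where e0: "e0 > 0" "{s<..<s + e0} \<subseteq> I \<or> I \<inter> {s<..} = {}" "{s - e0<..<s} \<subseteq> I \<or> I \<inter> {..<s} = {}"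
    using interval_sides[OF I] by blast
  define K where "K = (\<Sum>j = 1..n. norm (lam j s) + 1)"
  have "\<forall>\<^sub>F t in at s within I. \<forall>j\<in>{1..n}. norm (lam j t) < norm (lam j s) + 1"
  proof (intro eventually_ball_finite ballI finite_atLeastAtMost)
    fix j assume "j \<in> {1..n}"
    then have "(lam j \<longlongrightarrow> lam j s) (at s within I)" using contI I(2) by (auto simp: continuous_on_def)
    then show "\<forall>\<^sub>F t in at s within I. norm (lam j t) < norm (lam j s) + 1"
      by (intro order_tendstoD(2)[OF tendsto_norm]) auto
  qed
  with ev_card have "\<forall>\<^sub>F t in nhds s. t \<in> I \<longrightarrow> t \<noteq> s \<longrightarrow> card ((\<lambda>j. lam j t) ` {1..n}) \<le> k \<and>
      (\<forall>j\<in>{1..n}. norm (lam j t) < norm (lam j s) + 1)"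
    unfolding eventually_at_filter by eventually_elim auto
  then obtain e1 where e1: "e1 > 0" "\<And>t. t \<in> I \<Longrightarrow> t \<noteq> s \<Longrightarrow> dist t s < e1 \<Longrightarrow>
      card ((\<lambda>j. lam j t) ` {1..n}) \<le> k \<and> (\<forall>j\<in>{1..n}. norm (lam j t) < norm (lam j s) + 1)"
    unfolding eventually_nhds_metric by blast
  define e where "e = min e0 e1"
  have e: "0 < e" "e \<le> e0" "e \<le> e1" using e0 e1 by (auto simp: e_def)
  define V where "V r = I \<inter> ball s r - {s}" for r
  have V: "open (V r)" "s \<notin> V r" "V r \<subseteq> I" if "0 < r" "r \<le> e" for r
    unfolding V_def using punctured_ball_open[OF that(1) _ e0(2,3)] that e by auto
  have contV: "continuous_on (V r) (lam j)" if "j \<in> {1..n}" for r j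
    by (rule continuous_on_subset[OF contI[OF that]]) (auto simp: V_def)
  have cardV: "card ((\<lambda>j. lam j t) ` {1..n}) \<le> k" if "t \<in> V r" "r \<le> e" for t r
    using e1(2)[of t] that e by (auto simp: V_def dist_commute)
  have bdV: "norm (lam j t) \<le> K" if t: "t \<in> V r" "r \<le> e" and j: "j \<in> {1..n}" for t r j
  proof -
    have "norm (lam j t) \<le> norm (lam j s) + 1"
      using e1(2)[of t] t j e by (auto simp: V_def dist_commute intro: less_imp_le)
    also have "\<dots> \<le> K" unfolding K_def using j by (intro member_le_sum) auto
    finally show ?thesis .
  qed
  have coeffsV: "(\<lambda>t. vieta n (\<lambda>i. lam i t) m) \<in> diff_alg (V r) s" if m: "m \<in> {1..n}" and r: "0 < r" "r \<le> e" for m r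
  proof -
    interpret function_algebra "V r" "diff_alg (V r) s" by (rule function_algebra_diff_alg[OF V(1)[OF r]])
    show ?thesis
    proof (rule cong[OF mult[OF const[of "(-1) ^ m"] smooth_on_diff_alg[OF I V(3)[OF r] V(1)[OF r] smooth[OF m]]]])
      fix t assume "t \<in> V r"
      then show "(-1) ^ m * a m t = vieta n (\<lambda>i. lam i t) m"
        using vieta_poly_curve[OF roots m, of t] V(3)[OF r] by auto
    qed
  qed
  let ?D = "\<lambda>t. interp_norm n k (\<lambda>j. lam j t)"
  have "?D \<in> asymp_alg (V e) s"
    by (rule interp_norm_asymp_alg[OF V(1,2) k contV cardV coeffsV]) (use e in auto)
  then obtain p d where d: "d \<noteq> 0" "((\<lambda>t. ?D t / of_real (t - s) ^ p) \<longlongrightarrow> d) (at s within V e)"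
    using interp_norm_order[OF _ V_def e(1) n k cardV[OF _ order_refl] ord] by blast
  have "\<forall>\<^sub>F t in at s within V e. ?D t / of_real (t - s) ^ p \<noteq> 0"
    by (rule tendsto_imp_eventually_ne[OF d(2,1)])
  then obtain e' where e': "e' > 0" "\<And>t. t \<in> V e \<Longrightarrow> t \<noteq> s \<Longrightarrow> dist t s < e' \<Longrightarrow> ?D t / of_real (t - s) ^ p \<noteq> 0"
    unfolding eventually_at by blast
  \<comment> \<open>On the smaller set the common denominator vanishes nowhere, because its leading
    term does not. This forces exactly \<open>k\<close> distinct roots there and makes them
    differentiable.\<close>
  define \<epsilon> where "\<epsilon> = min e e'"
  have \<epsilon>: "0 < \<epsilon>" "\<epsilon> \<le> e" using e e' by (auto simp: \<epsilon>_def)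
  have sub: "V \<epsilon> \<subseteq> V e" using \<epsilon> by (auto simp: V_def)
  have D0: "?D t \<noteq> 0" if "t \<in> V \<epsilon>" for t
    using e'(2)[of t] that sub by (auto simp: V_def \<epsilon>_def dist_commute)
  note ctx = V(1,2)[OF \<epsilon>] k contV cardV[OF _ \<epsilon>(2)] coeffsV[OF _ \<epsilon>] D0
  have "\<forall>j\<in>{1..n}. \<forall>t\<in>V \<epsilon>. \<exists>d. (lam j has_vector_derivative d) (at t)"
    using lam_has_vector_derivative[OF ctx] by blast
  then obtain lam' where der: "\<And>t j. t \<in> V \<epsilon> \<Longrightarrow> j \<in> {1..n} \<Longrightarrow> (lam j has_vector_derivative lam' j t) (at t)"
    by metis
  obtain u where u: "\<And>j. j \<in> {1..n} \<Longrightarrow> continuous_on (V \<epsilon>) (u j)"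
    "\<And>m. (\<lambda>t. vieta n (\<lambda>i. u i t) m) \<in> asymp_alg (V \<epsilon>) s"
    "\<And>t j. t \<in> V \<epsilon> \<Longrightarrow> j \<in> {1..n} \<Longrightarrow> lam' j t = u j t / (of_real (t - s) * ?D t)"
    using derivative_quotient[OF ctx der] by blast
  have dV: "((\<lambda>t. ?D t / of_real (t - s) ^ p) \<longlongrightarrow> d) (at s within V \<epsilon>)"
    by (rule tendsto_within_subset[OF d(2) sub])
  have side: "\<exists>\<gamma>>0. \<exists>C\<ge>0. \<exists>\<delta>>0. \<forall>t. 0 < t \<longrightarrow> t < \<delta> \<longrightarrow> s + \<sigma> * t \<in> I \<longrightarrow>
      (\<forall>j\<in>{1..n}. norm (lam' j (s + \<sigma> * t)) \<le> C * t powr (\<gamma> - 1))"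
    if \<sigma>: "\<sigma> = 1 \<or> \<sigma> = -1" for \<sigma>
  proof (cases "\<exists>t>0. s + \<sigma> * t \<in> I")
    case True
    then obtain t0 where "t0 > 0" "s + \<sigma> * t0 \<in> I" by blast
    then have "(\<sigma> = 1 \<and> {s<..<s + e0} \<subseteq> I) \<or> (\<sigma> = -1 \<and> {s - e0<..<s} \<subseteq> I)"
      using e0(2,3) \<sigma> by auto
    then have inV: "s + \<sigma> * t \<in> V \<epsilon>" if "t \<in> {0<..<\<epsilon>}" for t
      using that \<epsilon> e by (auto simp: V_def dist_real_def)
    have "\<exists>\<gamma>>0. \<exists>C\<ge>0. \<forall>\<^sub>F t in at_right 0. \<forall>j\<in>{1..n}. norm (lam' j (s + \<sigma> * t)) \<le> C * t powr (\<gamma> - 1)"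
      by (rule side_estimate[OF \<epsilon>(1) _ inV V(2)[OF \<epsilon>] u(1,2) dV d(1) der u(3) bdV[OF _ \<epsilon>(2)]])
        (use \<sigma> in auto)
    then show ?thesis unfolding eventually_at_right_field by blast
  qed (auto intro!: exI[of _ 1])
  obtain \<gamma>1 C1 \<delta>1 where 1: "\<gamma>1 > 0" "C1 \<ge> 0" "\<delta>1 > 0"
      "\<And>t j. 0 < t \<Longrightarrow> t < \<delta>1 \<Longrightarrow> s + t \<in> I \<Longrightarrow> j \<in> {1..n} \<Longrightarrow> norm (lam' j (s + t)) \<le> C1 * t powr (\<gamma>1 - 1)"
    using side[of 1] by auto
  obtain \<gamma>2 C2 \<delta>2 where 2: "\<gamma>2 > 0" "C2 \<ge> 0" "\<delta>2 > 0"
      "\<And>t j. 0 < t \<Longrightarrow> t < \<delta>2 \<Longrightarrow> s - t \<in> I \<Longrightarrow> j \<in> {1..n} \<Longrightarrow> norm (lam' j (s - t)) \<le> C2 * t powr (\<gamma>2 - 1)"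
    using side[of "-1"] by auto
  define \<gamma> where "\<gamma> = min \<gamma>1 \<gamma>2"
  define C where "C = max C1 C2"
  \<comment> \<open>Below distance 1 the smaller exponent gives the larger bound, so \<gamma> and
    \<open>C\<close> serve both sides.\<close>
  define \<delta> where "\<delta> = min (min \<delta>1 \<delta>2) (min 1 \<epsilon>)"
  have weaken: "c * x powr (g - 1) \<le> C * x powr (\<gamma> - 1)"
    if "0 < x" "x < 1" "0 \<le> c" "c \<le> C" "\<gamma> \<le> g" for c x g
    using that by (intro mult_mono powr_mono') auto
  show ?thesis
  proof (rule that[of \<gamma> C \<delta> lam'])
    show "\<gamma> > 0" "C \<ge> 0" "\<delta> > 0" using 1 2 \<epsilon> by (auto simp: \<gamma>_def C_def \<delta>_def)
    fix j t assume j: "j \<in> {1..n}" and t: "t \<in> I \<inter> ball s \<delta>" "t \<noteq> s"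
    have tV: "t \<in> V \<epsilon>" using t by (auto simp: V_def \<delta>_def)
    have x: "0 < \<bar>t - s\<bar>" "\<bar>t - s\<bar> < \<delta>" "\<bar>t - s\<bar> < 1" using t by (auto simp: \<delta>_def dist_real_def)
    have "norm (lam' j t) \<le> C * \<bar>t - s\<bar> powr (\<gamma> - 1)"
    proof (cases "s < t")
      case True
      then have "norm (lam' j t) \<le> C1 * \<bar>t - s\<bar> powr (\<gamma>1 - 1)"
        using 1(4)[of "t - s" j] t x j by (simp add: \<delta>_def)
      also have "\<dots> \<le> C * \<bar>t - s\<bar> powr (\<gamma> - 1)"
        by (rule weaken[OF x(1,3) 1(2)]) (auto simp: C_def \<gamma>_def)
      finally show ?thesis .
    next
      case False
      then have "norm (lam' j t) \<le> C2 * \<bar>t - s\<bar> powr (\<gamma>2 - 1)"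
        using 2(4)[of "s - t" j] t x j by (simp add: \<delta>_def abs_minus_commute)
      also have "\<dots> \<le> C * \<bar>t - s\<bar> powr (\<gamma> - 1)"
        by (rule weaken[OF x(1,3) 2(2)]) (auto simp: C_def \<gamma>_def)
      finally show ?thesis .
    qed
    with der[OF tV j]
    show "(lam j has_vector_derivative lam' j t) (at t) \<and> norm (lam' j t) \<le> C * \<bar>t - s\<bar> powr (\<gamma> - 1)" ..
  qed
qed

theorem theorem3p3:
  fixes I :: "real set" and n :: nat
    and a :: "nat \<Rightarrow> real \<Rightarrow> complex" and lam :: "nat \<Rightarrow> real \<Rightarrow> complex"
  assumes "is_interval I"
    and "\<And>j. j \<in> {1..n} \<Longrightarrow> smooth_on I (a j)"
    and "generic_curve I n (poly_curve n a)"
    and "continuous_root_param I n (poly_curve n a) lam"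
  shows "\<forall>j\<in>{1..n}. locally_abs_continuous_on I (lam j)"
  unfolding locally_abs_continuous_on_def
proof (intro ballI)
  fix j s assume j: "j \<in> {1..n}" and s: "s \<in> I"
  show "\<exists>e>0. abs_continuous_on (I \<inter> ball s e) (lam j)"
  proof (cases "I = {s}")
    case True
    \<comment> \<open>On a one-point interval all increments are 0, so the majorant with constant 0
      suffices.\<close>
    have "abs_continuous_on (I \<inter> ball s 1) (lam j)"
      by (rule abs_continuous_on_signed_powr[of 1 0 1 _ s]) (use True in auto)
    then show ?thesis by (intro exI[of _ 1]) simp
  next
    case False
    then obtain r where r: "r \<in> I" "r \<noteq> s" using s by blast
    have "1 \<le> n" using j by simp
    from derivative_bound_near[OF assms(1) s this assms(2-4) r]
    obtain \<gamma> C \<delta> lam' where b: "\<gamma> > 0" "C \<ge> 0" "\<delta> > 0"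
      "\<And>j t. j \<in> {1..n} \<Longrightarrow> t \<in> I \<inter> ball s \<delta> \<Longrightarrow> t \<noteq> s \<Longrightarrow>
        (lam j has_vector_derivative lam' j t) (at t) \<and> norm (lam' j t) \<le> C * \<bar>t - s\<bar> powr (\<gamma> - 1)"
      by blast
    have "is_interval (I \<inter> ball s \<delta>)"
      using assms(1) by (intro is_interval_Int) (simp_all add: is_interval_ball_real)
    moreover have "continuous_on (I \<inter> ball s \<delta>) (lam j)"
      using assms(4) j by (auto simp: continuous_root_param_def intro: continuous_on_subset)
    ultimately have "norm (lam j v - lam j u) \<le> C / \<gamma> * (signed_powr \<gamma> (v - s) - signed_powr \<gamma> (u - s))"
      if "u \<in> I \<inter> ball s \<delta>" "v \<in> I \<inter> ball s \<delta>" "u \<le> v" for u v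
      using increment_le_signed_powr[OF b(1), of "I \<inter> ball s \<delta>" "lam j" s "lam' j" C u v] b(4)[OF j] that by blast
    then have "abs_continuous_on (I \<inter> ball s \<delta>) (lam j)"
      using b by (intro abs_continuous_on_signed_powr[of \<gamma> "C / \<gamma>" \<delta> _ s]) auto
    then show ?thesis using b(3) by blast
  qed
qed

end
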